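(* Let $k$ be a field of characteristic zero, let $R\subseteq H$ be an extension of finite dimensional Hopf algebras over $k$ (i.e. $R$ is a Hopf subalgebra of the finite dimensional Hopf algebra $H$), and let $Q=H/R^+H$ be its quotient module coalgebra. Let $Q^{*op}\#_{\overline{\psi}}H$ be the generalised factorised smash product. Then $$d_{odd}(H,\,Q^{*op}\#_{\overline{\psi}}H)=d_h(R,H).$$
   Context: Depth. For modules (or bimodules) $V,W$ over the same ring(s), $V\sim W$ (similar) means that there are positive integers $p,q$ such that $V$ is isomorphic to a direct summand of $pW=W\oplus\cdots\oplus W$ and $W$ is isomorphic to a direct summand of $qV$. For a unital ring extension $B\subseteq A$ put $A^{\otimes_B(0)}=B$ and $A^{\otimes_B(n)}=A\otimes_B\cdots\otimes_B A$ ($n$ factors). The minimum odd depth is $d_{odd}(B,A)=2n+1$, where $n\ge 0$ is the least integer with $A^{\otimes_B(n)}\sim A^{\otimes_B(n+1)}$ as $B$-$B$-bimodules. The minimum $H$-depth is $d_h(B,A)=2n-1$, where $n\ge1$ is the least integer with $A^{\otimes_B(n)}\sim A^{\otimes_B(n+1)}$ as $A$-$A$-bimodules. (The "$H$" in "$H$-depth" is part of the name, not the Hopf algebra.) The depth is $\infty$ if no such $n$ exists. Quotient coalgebra. $R^+=R\cap\ker\varepsilon$ is the augmentation ideal of $R$. $Q=H/R^+H$ is the quotient of $H$ by the right ideal and coideal $R^+H$. It is a coalgebra and a right $H$-module via $\overline{x}\cdot h=\overline{xh}$, where $\overline{x}$ is the class of $x\in H$; its comultiplication is $\Delta(\overline{x})=\overline{x_{(1)}}\otimes\overline{x_{(2)}}$.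 Generalised factorised smash product. $Q^{*op}$ is the linear dual $Q^*$ with multiplication $$\langle\overline{h},\theta\gamma\rangle=\langle\overline{h_{(2)}},\theta\rangle\langle\overline{h_{(1)}},\gamma\rangle\qquad(\theta,\gamma\in Q^*,\ h\in H)$$ and unit the counit of $Q$ (denoted $\varepsilon_H$). $H$ acts on $Q^*$ from the left by $(h\rightharpoonup\theta)(\overline{x})=\theta(\overline{xh})$. Let $\overline{\psi}:H\otimes Q^*\to Q^*\otimes H$ be $\overline{\psi}(h\otimes\theta)=(h_{(2)}\rightharpoonup\theta)\otimes h_{(1)}$. Then $Q^{*op}\#_{\overline{\psi}}H$ is the vector space $Q^*\otimes H$ with the associative product $$(\theta\# h)(\gamma\# g)=\theta(h_{(2)}\rightharpoonup\gamma)\# h_{(1)}g,$$ and $H$ is regarded as the subalgebra $\varepsilon_H\# H$. *)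

theory Defs
  imports
    "HOL-Algebra.Free_Abelian_Groups"
    "HOL-Algebra.Subrings"
    "HOL-Library.Extended_Nat"
    "Jordan_Normal_Form.Missing_VectorSpace"
begin

section \<open>Abelian groups given by generators and relations\<close>

definition pres_group :: "'g set \<Rightarrow> ('g \<Rightarrow>\<^sub>0 int) set \<Rightarrow> ('g \<Rightarrow>\<^sub>0 int) set monoid" where
  "pres_group S X = free_Abelian_group S Mod generate (free_Abelian_group S) X"

definition pres_gen :: "'g set \<Rightarrow> ('g \<Rightarrow>\<^sub>0 int) set \<Rightarrow> 'g \<Rightarrow> ('g \<Rightarrow>\<^sub>0 int) set" where
  "pres_gen S X g =
     generate (free_Abelian_group S) X #>\<^bsub>free_Abelian_group S\<^esub> frag_of g"

text \<open>The homomorphism out of \<^term>\<open>pres_group S X\<close> with prescribed values on the generators.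
  It is determined on the carrier, and it exists whenever \<^term>\<open>f\<close> respects the relations.\<close>

definition pres_lift ::
  "'g set \<Rightarrow> ('g \<Rightarrow>\<^sub>0 int) set \<Rightarrow> ('b, 'm) monoid_scheme \<Rightarrow> ('g \<Rightarrow> 'b) \<Rightarrow> ('g \<Rightarrow>\<^sub>0 int) set \<Rightarrow> 'b" where
  "pres_lift S X G f =
     (SOME \<phi>. \<phi> \<in> hom (pres_group S X) G \<and> (\<forall>g\<in>S. \<phi> (pres_gen S X g) = f g))"

lemma pres_lift_exists:
  assumes G: "comm_group G"
    and f: "\<And>g. g \<in> S \<Longrightarrow> f g \<in> carrier G"
    and X: "\<And>x. x \<in> X \<Longrightarrow> Poly_Mapping.keys x \<subseteq> S"
    and rel: "\<And>\<psi> x. \<psi> \<in> hom (free_Abelian_group S) G \<Longrightarrow> (\<And>g. g \<in> S \<Longrightarrow> \<psi> (frag_of g) = f g) \<Longrightarrow>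
      x \<in> X \<Longrightarrow> \<psi> x = \<one>\<^bsub>G\<^esub>"
  shows "pres_lift S X G f \<in> hom (pres_group S X) G"
    and "g \<in> S \<Longrightarrow> pres_lift S X G f (pres_gen S X g) = f g"
proof -
  let ?F = "free_Abelian_group S"
  let ?N = "generate ?F X"
  interpret F: comm_group ?F by (rule abelian_free_Abelian_group)
  interpret G: comm_group G by (rule G)
  have XF: "X \<subseteq> carrier ?F" using X by auto
  obtain h where h: "h \<in> hom ?F G" "\<And>g. g \<in> S \<Longrightarrow> h (frag_of g) = f g"
    using G.free_Abelian_group_universal[of f S] f by (metis image_subsetI)
  interpret h: group_hom ?F G h
    using h(1) by unfold_locales
  have N: "?N \<lhd> ?F"
    using XF F.generate_is_subgroup F.subgroup_imp_normal by blast
  have "X \<subseteq> kernel ?F G h"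
    using rel[OF h] XF unfolding kernel_def by blast
  then have "?N \<subseteq> kernel ?F G h"
    by (rule F.generate_subgroup_incl[OF _ h.subgroup_kernel])
  then obtain \<phi> where "\<phi> \<in> hom (?F Mod ?N) G"
      "\<And>x. x \<in> carrier ?F \<Longrightarrow> \<phi> (?N #>\<^bsub>?F\<^esub> x) = h x"
    using h.FactGroup_universal_kernel[OF N] by blast
  then have "\<exists>\<phi>. \<phi> \<in> hom (pres_group S X) G \<and> (\<forall>g\<in>S. \<phi> (pres_gen S X g) = f g)"
    using h(2) by (auto simp: pres_group_def pres_gen_def intro!: exI[of _ \<phi>])
  from someI_ex[OF this]
  show "pres_lift S X G f \<in> hom (pres_group S X) G"
    and "g \<in> S \<Longrightarrow> pres_lift S X G f (pres_gen S X g) = f g"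
    unfolding pres_lift_def by auto
qed


section \<open>The tensor product of two vector spaces\<close>

definition tensor_gens ::
  "('k, 'v, 'x) module_scheme \<Rightarrow> ('k, 'w, 'y) module_scheme \<Rightarrow> ('v \<times> 'w) set" where
  "tensor_gens V W = carrier V \<times> carrier W"

definition tensor_rels ::
  "('k, 'z) ring_scheme \<Rightarrow> ('k, 'v, 'x) module_scheme \<Rightarrow> ('k, 'w, 'y) module_scheme \<Rightarrow>
    ('v \<times> 'w \<Rightarrow>\<^sub>0 int) set" where
  "tensor_rels K V W =
     {frag_of (v \<oplus>\<^bsub>V\<^esub> v', w) - frag_of (v, w) - frag_of (v', w) | v v' w.
        v \<in> carrier V \<and> v' \<in> carrier V \<and> w \<in> carrier W} \<union>
     {frag_of (v, w \<oplus>\<^bsub>W\<^esub> w') - frag_of (v, w) - frag_of (v, w') | v w w'.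
        v \<in> carrier V \<and> w \<in> carrier W \<and> w' \<in> carrier W} \<union>
     {frag_of (c \<odot>\<^bsub>V\<^esub> v, w) - frag_of (v, c \<odot>\<^bsub>W\<^esub> w) | c v w.
        c \<in> carrier K \<and> v \<in> carrier V \<and> w \<in> carrier W}"

abbreviation tensor_group ::
  "('k, 'z) ring_scheme \<Rightarrow> ('k, 'v, 'x) module_scheme \<Rightarrow> ('k, 'w, 'y) module_scheme \<Rightarrow>
    ('v \<times> 'w \<Rightarrow>\<^sub>0 int) set monoid" where
  "tensor_group K V W \<equiv> pres_group (tensor_gens V W) (tensor_rels K V W)"

definition pure_tensor ::
  "('k, 'z) ring_scheme \<Rightarrow> ('k, 'v, 'x) module_scheme \<Rightarrow> ('k, 'w, 'y) module_scheme \<Rightarrow>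
    'v \<Rightarrow> 'w \<Rightarrow> ('v \<times> 'w \<Rightarrow>\<^sub>0 int) set" where
  "pure_tensor K V W v w = pres_gen (tensor_gens V W) (tensor_rels K V W) (v, w)"

text \<open>The additive map from the tensor product to \<^term>\<open>G\<close> with
  \<^term>\<open>pure_tensor K V W v w\<close> sent to \<^term>\<open>f v w\<close>, for a balanced biadditive \<^term>\<open>f\<close>.\<close>

definition tensor_lift ::
  "('k, 'z) ring_scheme \<Rightarrow> ('k, 'v, 'x) module_scheme \<Rightarrow> ('k, 'w, 'y) module_scheme \<Rightarrow>
    ('b, 'm) ring_scheme \<Rightarrow> ('v \<Rightarrow> 'w \<Rightarrow> 'b) \<Rightarrow> ('v \<times> 'w \<Rightarrow>\<^sub>0 int) set \<Rightarrow> 'b" where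
  "tensor_lift K V W G f =
     pres_lift (tensor_gens V W) (tensor_rels K V W) (add_monoid G) (\<lambda>(v, w). f v w)"

text \<open>As for every record below that only serves as a vector space, the ring multiplication and
  unit that are part of the record type \<open>module\<close> carry no information.\<close>

definition tensor ::
  "('k, 'z) ring_scheme \<Rightarrow> ('k, 'v, 'x) module_scheme \<Rightarrow> ('k, 'w, 'y) module_scheme \<Rightarrow>
    ('k, ('v \<times> 'w \<Rightarrow>\<^sub>0 int) set) module" where
  "tensor K V W =
     \<lparr>carrier = carrier (tensor_group K V W), mult = undefined, one = undefined,
      zero = \<one>\<^bsub>tensor_group K V W\<^esub>, add = mult (tensor_group K V W),
      smult = (\<lambda>c. pres_lift (tensor_gens V W) (tensor_rels K V W) (tensor_group K V W)
                     (\<lambda>(v, w). pure_tensor K V W (c \<odot>\<^bsub>V\<^esub> v) w))\<rparr>"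


section \<open>Hopf algebras\<close>

record ('k, 'c) coalgebra = "('k, 'c) module" +
  comult :: "'c \<Rightarrow> ('c \<times> 'c \<Rightarrow>\<^sub>0 int) set"
  counit :: "'c \<Rightarrow> 'k"

record ('k, 'h) hopf = "('k, 'h) coalgebra" +
  antipode :: "'h \<Rightarrow> 'h"

text \<open>\<^term>\<open>sweedler K C G f c\<close> is the sum of \<open>f c\<^sub>(\<^sub>1\<^sub>) c\<^sub>(\<^sub>2\<^sub>)\<close> in the additive group of
  \<^term>\<open>G\<close>.\<close>

definition sweedler ::
  "('k, 'z) ring_scheme \<Rightarrow> ('k, 'c, 'x) coalgebra_scheme \<Rightarrow> ('b, 'm) ring_scheme \<Rightarrow>
    ('c \<Rightarrow> 'c \<Rightarrow> 'b) \<Rightarrow> 'c \<Rightarrow> 'b" where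
  "sweedler K C G f c = tensor_lift K C C G f (comult C c)"

definition self_module :: "('k, 'z) ring_scheme \<Rightarrow> ('k, 'k) module" where
  "self_module K =
     \<lparr>carrier = carrier K, mult = mult K, one = one K, zero = zero K, add = add K,
      smult = mult K\<rparr>"

locale coalgebra = vectorspace K C
  for K :: "('k, 'z) ring_scheme" (structure) and C :: "('k, 'c, 'x) coalgebra_scheme" (structure) +
  assumes comult_hom: "comult C \<in> module_hom K C (tensor K C C)"
    and counit_hom: "counit C \<in> module_hom K C (self_module K)"
    and coassoc: "c \<in> carrier C \<Longrightarrow>
      sweedler K C (tensor K C (tensor K C C))
        (\<lambda>a b. pure_tensor K C (tensor K C C) a (comult C b)) c =
      sweedler K C (tensor K C (tensor K C C))
        (\<lambda>a b. sweedler K C (tensor K C (tensor K C C))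
                 (\<lambda>a1 a2. pure_tensor K C (tensor K C C) a1 (pure_tensor K C C a2 b)) a) c"
    and counit_left: "c \<in> carrier C \<Longrightarrow> sweedler K C C (\<lambda>a b. counit C a \<odot>\<^bsub>C\<^esub> b) c = c"
    and counit_right: "c \<in> carrier C \<Longrightarrow> sweedler K C C (\<lambda>a b. counit C b \<odot>\<^bsub>C\<^esub> a) c = c"

locale hopf_algebra = coalgebra K H + ring H
  for K :: "('k, 'z) ring_scheme" (structure) and H :: "('k, 'h, 'x) hopf_scheme" (structure) +
  assumes smult_mult_left: "\<lbrakk>c \<in> carrier K; x \<in> carrier H; y \<in> carrier H\<rbrakk> \<Longrightarrow>
      (c \<odot>\<^bsub>H\<^esub> x) \<otimes>\<^bsub>H\<^esub> y = c \<odot>\<^bsub>H\<^esub> (x \<otimes>\<^bsub>H\<^esub> y)"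
    and smult_mult_right: "\<lbrakk>c \<in> carrier K; x \<in> carrier H; y \<in> carrier H\<rbrakk> \<Longrightarrow>
      x \<otimes>\<^bsub>H\<^esub> (c \<odot>\<^bsub>H\<^esub> y) = c \<odot>\<^bsub>H\<^esub> (x \<otimes>\<^bsub>H\<^esub> y)"
    and comult_mult: "\<lbrakk>x \<in> carrier H; y \<in> carrier H\<rbrakk> \<Longrightarrow>
      comult H (x \<otimes>\<^bsub>H\<^esub> y) =
        sweedler K H (tensor K H H)
          (\<lambda>a b. sweedler K H (tensor K H H)
                   (\<lambda>c d. pure_tensor K H H (a \<otimes>\<^bsub>H\<^esub> c) (b \<otimes>\<^bsub>H\<^esub> d)) y) x"
    and comult_one: "comult H \<one>\<^bsub>H\<^esub> = pure_tensor K H H \<one>\<^bsub>H\<^esub> \<one>\<^bsub>H\<^esub>"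
    and counit_mult: "\<lbrakk>x \<in> carrier H; y \<in> carrier H\<rbrakk> \<Longrightarrow>
      counit H (x \<otimes>\<^bsub>H\<^esub> y) = counit H x \<otimes>\<^bsub>K\<^esub> counit H y"
    and counit_one: "counit H \<one>\<^bsub>H\<^esub> = \<one>\<^bsub>K\<^esub>"
    and antipode_hom: "antipode H \<in> module_hom K H H"
    and antipode_left: "x \<in> carrier H \<Longrightarrow>
      sweedler K H H (\<lambda>a b. antipode H a \<otimes>\<^bsub>H\<^esub> b) x = counit H x \<odot>\<^bsub>H\<^esub> \<one>\<^bsub>H\<^esub>"
    and antipode_right: "x \<in> carrier H \<Longrightarrow>
      sweedler K H H (\<lambda>a b. a \<otimes>\<^bsub>H\<^esub> antipode H b) x = counit H x \<odot>\<^bsub>H\<^esub> \<one>\<^bsub>H\<^esub>"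

text \<open>Over a field \<open>R \<otimes> R\<close> embeds in \<open>H \<otimes> H\<close>; its image is the subgroup generated by the
  pure tensors of elements of \<^term>\<open>R\<close>.\<close>

definition hopf_subalgebra ::
  "('k, 'z) ring_scheme \<Rightarrow> 'h set \<Rightarrow> ('k, 'h, 'x) hopf_scheme \<Rightarrow> bool" where
  "hopf_subalgebra K R H \<longleftrightarrow>
     subspace K R H \<and> subring R H \<and>
     (\<forall>r\<in>R. comult H r \<in>
        generate (add_monoid (tensor K H H)) {pure_tensor K H H a b | a b. a \<in> R \<and> b \<in> R}) \<and>
     (\<forall>r\<in>R. antipode H r \<in> R)"


section \<open>The quotient module coalgebra\<close>

definition aug_ideal :: "('k, 'z) ring_scheme \<Rightarrow> ('k, 'h, 'x) hopf_scheme \<Rightarrow> 'h set \<Rightarrow> 'h set" where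
  "aug_ideal K H R = {r \<in> R. counit H r = \<zero>\<^bsub>K\<^esub>}"

definition aug_right_ideal ::
  "('k, 'z) ring_scheme \<Rightarrow> ('k, 'h, 'x) hopf_scheme \<Rightarrow> 'h set \<Rightarrow> 'h set" where
  "aug_right_ideal K H R =
     generate (add_monoid H) {r \<otimes>\<^bsub>H\<^esub> h | r h. r \<in> aug_ideal K H R \<and> h \<in> carrier H}"

text \<open>Operations on a quotient are induced from representatives: if \<^term>\<open>f\<close> is constant on
  the coset \<^term>\<open>X\<close>, its value there is \<^term>\<open>the_elem (f ` X)\<close>.\<close>

definition quot_module :: "('k, 'h, 'x) module_scheme \<Rightarrow> 'h set \<Rightarrow> ('k, 'h set) module" where
  "quot_module H I =
     \<lparr>carrier = a_rcosets\<^bsub>H\<^esub> I, mult = undefined, one = undefined, zero = I,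
      add = set_add H, smult = (\<lambda>c X. the_elem ((\<lambda>x. I +>\<^bsub>H\<^esub> (c \<odot>\<^bsub>H\<^esub> x)) ` X))\<rparr>"

definition quot_coalgebra ::
  "('k, 'z) ring_scheme \<Rightarrow> ('k, 'h, 'x) hopf_scheme \<Rightarrow> 'h set \<Rightarrow> ('k, 'h set) coalgebra" where
  "quot_coalgebra K H I =
     module.extend (quot_module H I)
       \<lparr>comult = (\<lambda>X. the_elem
          (sweedler K H (tensor K (quot_module H I) (quot_module H I))
             (\<lambda>a b. pure_tensor K (quot_module H I) (quot_module H I) (I +>\<^bsub>H\<^esub> a) (I +>\<^bsub>H\<^esub> b)) ` X)),
        counit = (\<lambda>X. the_elem (counit H ` X))\<rparr>"

definition quot_act :: "('k, 'h, 'x) module_scheme \<Rightarrow> 'h set \<Rightarrow> 'h set \<Rightarrow> 'h \<Rightarrow> 'h set" where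
  "quot_act H I X h = the_elem ((\<lambda>x. I +>\<^bsub>H\<^esub> (x \<otimes>\<^bsub>H\<^esub> h)) ` X)"

definition Q_coalg ::
  "('k, 'z) ring_scheme \<Rightarrow> ('k, 'h, 'x) hopf_scheme \<Rightarrow> 'h set \<Rightarrow> ('k, 'h set) coalgebra" where
  "Q_coalg K H R = quot_coalgebra K H (aug_right_ideal K H R)"

definition Q_act ::
  "('k, 'z) ring_scheme \<Rightarrow> ('k, 'h, 'x) hopf_scheme \<Rightarrow> 'h set \<Rightarrow> 'h set \<Rightarrow> 'h \<Rightarrow> 'h set" where
  "Q_act K H R = quot_act H (aug_right_ideal K H R)"


section \<open>The generalised factorised smash product\<close>

definition dual_op ::
  "('k, 'z) ring_scheme \<Rightarrow> ('k, 'c, 'x) coalgebra_scheme \<Rightarrow> ('k, 'c \<Rightarrow> 'k) module" where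
  "dual_op K C =
     \<lparr>carrier = module_hom K C (self_module K) \<inter> extensional (carrier C),
      mult = (\<lambda>\<theta> \<gamma>. \<lambda>x\<in>carrier C. sweedler K C K (\<lambda>x1 x2. \<theta> x2 \<otimes>\<^bsub>K\<^esub> \<gamma> x1) x),
      one = (\<lambda>x\<in>carrier C. counit C x),
      zero = (\<lambda>x\<in>carrier C. \<zero>\<^bsub>K\<^esub>),
      add = (\<lambda>\<theta> \<gamma>. \<lambda>x\<in>carrier C. \<theta> x \<oplus>\<^bsub>K\<^esub> \<gamma> x),
      smult = (\<lambda>c \<theta>. \<lambda>x\<in>carrier C. c \<otimes>\<^bsub>K\<^esub> \<theta> x)\<rparr>"

definition Q_dual_op ::
  "('k, 'z) ring_scheme \<Rightarrow> ('k, 'h, 'x) hopf_scheme \<Rightarrow> 'h set \<Rightarrow> ('k, 'h set \<Rightarrow> 'k) module" where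
  "Q_dual_op K H R = dual_op K (Q_coalg K H R)"

definition Q_dual_act ::
  "('k, 'z) ring_scheme \<Rightarrow> ('k, 'h, 'x) hopf_scheme \<Rightarrow> 'h set \<Rightarrow> 'h \<Rightarrow> ('h set \<Rightarrow> 'k) \<Rightarrow> 'h set \<Rightarrow> 'k" where
  "Q_dual_act K H R h \<theta> = (\<lambda>X\<in>carrier (Q_coalg K H R). \<theta> (Q_act K H R X h))"

abbreviation smash_space ::
  "('k, 'z) ring_scheme \<Rightarrow> ('k, 'h, 'x) hopf_scheme \<Rightarrow> 'h set \<Rightarrow>
    ('k, (('h set \<Rightarrow> 'k) \<times> 'h \<Rightarrow>\<^sub>0 int) set) module" where
  "smash_space K H R \<equiv> tensor K (Q_dual_op K H R) H"

definition smash_elem ::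
  "('k, 'z) ring_scheme \<Rightarrow> ('k, 'h, 'x) hopf_scheme \<Rightarrow> 'h set \<Rightarrow> ('h set \<Rightarrow> 'k) \<Rightarrow> 'h \<Rightarrow>
    (('h set \<Rightarrow> 'k) \<times> 'h \<Rightarrow>\<^sub>0 int) set" where
  "smash_elem K H R \<theta> h = pure_tensor K (Q_dual_op K H R) H \<theta> h"

definition smash ::
  "('k, 'z) ring_scheme \<Rightarrow> ('k, 'h, 'x) hopf_scheme \<Rightarrow> 'h set \<Rightarrow>
    (('h set \<Rightarrow> 'k) \<times> 'h \<Rightarrow>\<^sub>0 int) set ring" where
  "smash K H R =
     \<lparr>carrier = carrier (smash_space K H R),
      mult = (\<lambda>s t.
        tensor_lift K (Q_dual_op K H R) H (smash_space K H R)
          (\<lambda>\<theta> h. tensor_lift K (Q_dual_op K H R) H (smash_space K H R)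
             (\<lambda>\<gamma> g. sweedler K H (smash_space K H R)
                (\<lambda>h1 h2. smash_elem K H R
                   (\<theta> \<otimes>\<^bsub>Q_dual_op K H R\<^esub> Q_dual_act K H R h2 \<gamma>) (h1 \<otimes>\<^bsub>H\<^esub> g)) h) t) s),
      one = smash_elem K H R \<one>\<^bsub>Q_dual_op K H R\<^esub> \<one>\<^bsub>H\<^esub>,
      zero = \<zero>\<^bsub>smash_space K H R\<^esub>,
      add = add (smash_space K H R)\<rparr>"

definition smash_base ::
  "('k, 'z) ring_scheme \<Rightarrow> ('k, 'h, 'x) hopf_scheme \<Rightarrow> 'h set \<Rightarrow>
    (('h set \<Rightarrow> 'k) \<times> 'h \<Rightarrow>\<^sub>0 int) set set" where
  "smash_base K H R = {smash_elem K H R \<one>\<^bsub>Q_dual_op K H R\<^esub> h | h. h \<in> carrier H}"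


section \<open>Similarity of bimodules\<close>

text \<open>The acting ring is not part of the record: a subset \<^term>\<open>S\<close> of a ring acts on both sides,
  and restricting the scalars of a bimodule to a subring only changes \<^term>\<open>S\<close>.\<close>

record ('a, 'm) bimodule = "'m ring" +
  lact :: "'a \<Rightarrow> 'm \<Rightarrow> 'm"
  ract :: "'m \<Rightarrow> 'a \<Rightarrow> 'm"

definition bimodule_iso ::
  "'a set \<Rightarrow> ('a, 'm, 'x) bimodule_scheme \<Rightarrow> ('a, 'n, 'y) bimodule_scheme \<Rightarrow> ('m \<Rightarrow> 'n) set" where
  "bimodule_iso S V W =
     {f \<in> iso (add_monoid V) (add_monoid W).
        \<forall>s\<in>S. \<forall>v\<in>carrier V. f (lact V s v) = lact W s (f v) \<and> f (ract V v s) = ract W (f v) s}"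

definition subbimodule :: "'a set \<Rightarrow> 'm set \<Rightarrow> ('a, 'm, 'x) bimodule_scheme \<Rightarrow> bool" where
  "subbimodule S N V \<longleftrightarrow>
     subgroup N (add_monoid V) \<and> (\<forall>s\<in>S. \<forall>v\<in>N. lact V s v \<in> N \<and> ract V v s \<in> N)"

definition direct_summand :: "'a set \<Rightarrow> 'm set \<Rightarrow> ('a, 'm, 'x) bimodule_scheme \<Rightarrow> bool" where
  "direct_summand S N V \<longleftrightarrow>
     subbimodule S N V \<and>
     (\<exists>N'. subbimodule S N' V \<and> N \<inter> N' = {\<zero>\<^bsub>V\<^esub>} \<and> N <+>\<^bsub>V\<^esub> N' = carrier V)"

definition bimodule_power :: "nat \<Rightarrow> ('a, 'm, 'x) bimodule_scheme \<Rightarrow> ('a, nat \<Rightarrow> 'm) bimodule" where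
  "bimodule_power p W =
     \<lparr>carrier = {..<p} \<rightarrow>\<^sub>E carrier W, mult = undefined, one = undefined,
      zero = (\<lambda>i\<in>{..<p}. \<zero>\<^bsub>W\<^esub>),
      add = (\<lambda>v w. \<lambda>i\<in>{..<p}. v i \<oplus>\<^bsub>W\<^esub> w i),
      lact = (\<lambda>s v. \<lambda>i\<in>{..<p}. lact W s (v i)),
      ract = (\<lambda>v s. \<lambda>i\<in>{..<p}. ract W (v i) s)\<rparr>"

definition divides_power ::
  "'a set \<Rightarrow> ('a, 'm, 'x) bimodule_scheme \<Rightarrow> ('a, 'n, 'y) bimodule_scheme \<Rightarrow> bool" where
  "divides_power S V W \<longleftrightarrow>
     (\<exists>p>0. \<exists>N f. direct_summand S N (bimodule_power p W) \<and>
        f \<in> bimodule_iso S V ((bimodule_power p W)\<lparr>carrier := N\<rparr>))"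

definition similar ::
  "'a set \<Rightarrow> ('a, 'm, 'x) bimodule_scheme \<Rightarrow> ('a, 'n, 'y) bimodule_scheme \<Rightarrow> bool" where
  "similar S V W \<longleftrightarrow> divides_power S V W \<and> divides_power S W V"


section \<open>Depth of a ring extension\<close>

text \<open>For \<open>n \<ge> 1\<close> the \<open>n\<close>-fold tensor product of \<^term>\<open>A\<close> over the subring \<^term>\<open>B\<close> is
  presented by the lists \<open>[a\<^sub>1, \<dots>, a\<^sub>n]\<close>, which stand for \<open>a\<^sub>1 \<otimes> \<dots> \<otimes> a\<^sub>n\<close>, subject to
  additivity in every position and \<^term>\<open>B\<close>-balancedness at every tensor sign.\<close>

definition power_gens :: "('a, 'x) ring_scheme \<Rightarrow> nat \<Rightarrow> 'a list set" where
  "power_gens A n = {xs. length xs = n \<and> set xs \<subseteq> carrier A}"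

definition power_rels :: "('a, 'x) ring_scheme \<Rightarrow> 'a set \<Rightarrow> nat \<Rightarrow> ('a list \<Rightarrow>\<^sub>0 int) set" where
  "power_rels A B n =
     {frag_of (xs[i := a \<oplus>\<^bsub>A\<^esub> a']) - frag_of (xs[i := a]) - frag_of (xs[i := a']) | xs i a a'.
        xs \<in> power_gens A n \<and> i < n \<and> a \<in> carrier A \<and> a' \<in> carrier A} \<union>
     {frag_of (xs[i := xs ! i \<otimes>\<^bsub>A\<^esub> b]) - frag_of (xs[Suc i := b \<otimes>\<^bsub>A\<^esub> xs ! Suc i]) | xs i b.
        xs \<in> power_gens A n \<and> Suc i < n \<and> b \<in> B}"

abbreviation power_group ::
  "('a, 'x) ring_scheme \<Rightarrow> 'a set \<Rightarrow> nat \<Rightarrow> ('a list \<Rightarrow>\<^sub>0 int) set monoid" where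
  "power_group A B n \<equiv> pres_group (power_gens A n) (power_rels A B n)"

definition tensor_power ::
  "('a, 'x) ring_scheme \<Rightarrow> 'a set \<Rightarrow> nat \<Rightarrow> ('a, ('a list \<Rightarrow>\<^sub>0 int) set) bimodule" where
  "tensor_power A B n =
     \<lparr>carrier = carrier (power_group A B n), mult = undefined, one = undefined,
      zero = \<one>\<^bsub>power_group A B n\<^esub>, add = mult (power_group A B n),
      lact = (\<lambda>s. pres_lift (power_gens A n) (power_rels A B n) (power_group A B n)
        (\<lambda>xs. pres_gen (power_gens A n) (power_rels A B n) (xs[0 := s \<otimes>\<^bsub>A\<^esub> xs ! 0]))),
      ract = (\<lambda>v s. pres_lift (power_gens A n) (power_rels A B n) (power_group A B n)
        (\<lambda>xs. pres_gen (power_gens A n) (power_rels A B n) (xs[n - 1 := xs ! (n - 1) \<otimes>\<^bsub>A\<^esub> s])) v)\<rparr>"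

definition regular_bimodule :: "('a, 'x) ring_scheme \<Rightarrow> 'a set \<Rightarrow> ('a, 'a) bimodule" where
  "regular_bimodule A B =
     \<lparr>carrier = B, mult = mult A, one = one A, zero = zero A, add = add A,
      lact = mult A, ract = mult A\<rparr>"

text \<open>The case distinction is needed because the zeroth tensor power, \<^term>\<open>B\<close> itself, has
  another type than the positive ones.\<close>

definition odd_depth_cond :: "'a set \<Rightarrow> ('a, 'x) ring_scheme \<Rightarrow> nat \<Rightarrow> bool" where
  "odd_depth_cond B A n \<longleftrightarrow>
     (if n = 0 then similar B (regular_bimodule A B) (tensor_power A B 1)
      else similar B (tensor_power A B n) (tensor_power A B (Suc n)))"

definition odd_depth :: "'a set \<Rightarrow> ('a, 'x) ring_scheme \<Rightarrow> enat" where
  "odd_depth B A =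
     (if \<exists>n. odd_depth_cond B A n then enat (2 * (LEAST n. odd_depth_cond B A n) + 1) else \<infinity>)"

definition H_depth_cond :: "'a set \<Rightarrow> ('a, 'x) ring_scheme \<Rightarrow> nat \<Rightarrow> bool" where
  "H_depth_cond B A n \<longleftrightarrow>
     n \<ge> 1 \<and> similar (carrier A) (tensor_power A B n) (tensor_power A B (Suc n))"

definition H_depth :: "'a set \<Rightarrow> ('a, 'x) ring_scheme \<Rightarrow> enat" where
  "H_depth B A =
     (if \<exists>n. H_depth_cond B A n then enat (2 * (LEAST n. H_depth_cond B A n) - 1) else \<infinity>)"

end

theory Submission
  imports Defs
begin

text \<open>The two depths agree because a duality of bimodules matches the conditions that define them.
  Write \<open>A\<close> for the smash product, \<open>M\<^sub>n = H \<otimes>\<^sub>R \<dots> \<otimes>\<^sub>R H\<close> with \<open>n + 1\<close> factors and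
  \<open>N\<^sub>n = A \<otimes>\<^sub>H \<dots> \<otimes>\<^sub>H A\<close> with \<open>n\<close> factors, \<open>N\<^sub>0\<close> being \<open>H\<close> itself. For every \<open>n\<close>, \<open>M\<^sub>n\<close> is
  finitely generated projective as a left \<open>H\<close>-module and \<open>N\<^sub>n\<close> is its dual \<open>Hom\<^sub>H(M\<^sub>n, H)\<close>, as
  \<open>H\<close>-\<open>H\<close>-bimodules. Transposing homomorphisms therefore turns a splitting of \<open>M\<^sub>n\<close> off a multiple of
  \<open>M\<^sub>n\<^sub>+\<^sub>1\<close> into a splitting of \<open>N\<^sub>n\<close> off a multiple of \<open>N\<^sub>n\<^sub>+\<^sub>1\<close>, and back, and likewise with \<open>n\<close>
  and \<open>n + 1\<close> exchanged. So \<open>N\<^sub>n \<sim> N\<^sub>n\<^sub>+\<^sub>1\<close> holds iff \<open>M\<^sub>n \<sim> M\<^sub>n\<^sub>+\<^sub>1\<close> does: the condition for odd depth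
  \<open>2n + 1\<close> is the condition for \<open>H\<close>-depth \<open>2(n + 1) - 1\<close>, the same number
  (\<open>depth_conditions\<close>).

  The duality comes from an action of \<open>A\<close> on \<open>H\<close>. The element \<open>a = \<theta> # g\<close> acts as the map
  \<open>\<Phi>\<^sub>a(x) = \<theta>(x\<^sub>(\<^sub>2\<^sub>)) x\<^sub>(\<^sub>1\<^sub>) g\<close>, which is left \<open>R\<close>-linear because \<open>\<theta>\<close> only sees the second leg of an
  element of \<open>R\<close> through the counit; moreover \<open>\<Phi>\<^bsub>ha\<^esub>(x) = \<Phi>\<^sub>a(xh)\<close> and \<open>\<Phi>\<^bsub>ah\<^esub>(x) = \<Phi>\<^sub>a(x)h\<close>. These
  rules are exactly what makes
  \<open>\<langle>x\<^sub>0 \<otimes> \<dots> \<otimes> x\<^sub>n, a\<^sub>1 \<otimes> \<dots> \<otimes> a\<^sub>n\<rangle> = x\<^sub>0 \<Phi>\<^bsub>a\<^sub>n\<^esub>(x\<^sub>1 \<Phi>\<^bsub>a\<^sub>n\<^sub>-\<^sub>1\<^esub>(\<dots> \<Phi>\<^bsub>a\<^sub>1\<^esub>(x\<^sub>n)))\<close> a well-defined pairing of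
  bimodules. For \<open>n = 1\<close> it has dual bases \<open>S(q\<^sub>(\<^sub>1\<^sub>)) \<otimes> q\<^sub>(\<^sub>2\<^sub>)\<close> and \<open>q\<^sup>* # 1\<close>, where \<open>q\<close> runs through
  lifts of a basis of \<open>Q = H/R\<^sup>+H\<close> and \<open>q\<^sup>*\<close> through the dual basis (\<open>basis1_dual_left\<close>,
  \<open>basis1_dual_right\<close>). Behind this is the isomorphism of \<open>H \<otimes>\<^sub>R H\<close> with \<open>H \<otimes> Q\<close> sending \<open>x \<otimes> y\<close> to
  \<open>x y\<^sub>(\<^sub>1\<^sub>) \<otimes> y\<^sub>(\<^sub>2\<^sub>)\<close>; that its inverse is well defined needs the antipode to be anti-multiplicative
  (\<open>S_mult\<close>). Splicing these bases gives dual bases for all \<open>n\<close> (\<open>dual_pair_powers\<close>).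

  Modules of homomorphisms are never formed: a duality is a pairing together with dual bases, and
  this data suffices to transpose homomorphisms (\<open>dual_pair_retracts_iff\<close>). Every tensor product is a
  group with a presentation, so additive maps out of it are built and compared on generators, and
  a Sweedler sum is the sum over a list of pairs that represents the coproduct.\<close>

section \<open>Finite sums and additive maps in abelian groups\<close>

text \<open>Sums run over lists because a tensor is a sum of pure tensors in which repetitions matter.\<close>

definition lsum :: "('b, 'm) ring_scheme \<Rightarrow> ('i \<Rightarrow> 'b) \<Rightarrow> 'i list \<Rightarrow> 'b" where
  "lsum G f xs = foldr (\<lambda>x s. f x \<oplus>\<^bsub>G\<^esub> s) xs \<zero>\<^bsub>G\<^esub>"

lemma lsum_Nil [simp]: "lsum G f [] = \<zero>\<^bsub>G\<^esub>"
  and lsum_Cons [simp]: "lsum G f (x # xs) = f x \<oplus>\<^bsub>G\<^esub> lsum G f xs"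
  by (simp_all add: lsum_def)

lemma lsum_cong: "xs = ys \<Longrightarrow> (\<And>x. x \<in> set ys \<Longrightarrow> f x = g x) \<Longrightarrow> lsum G f xs = lsum G g ys"
proof (induction ys arbitrary: xs)
  case (Cons y ys) then show ?case by (metis lsum_Cons list.set_intros)
qed simp

lemma lsum_map: "lsum G f (map g xs) = lsum G (\<lambda>x. f (g x)) xs"
  by (induction xs) auto

context abelian_group
begin

lemma lsum_closed [simp, intro]:
  "(\<And>x. x \<in> set xs \<Longrightarrow> f x \<in> carrier G) \<Longrightarrow> lsum G f xs \<in> carrier G"
  by (induction xs) auto

lemma lsum_append:
  "(\<And>x. x \<in> set xs \<Longrightarrow> f x \<in> carrier G) \<Longrightarrow> (\<And>x. x \<in> set ys \<Longrightarrow> f x \<in> carrier G) \<Longrightarrow>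
    lsum G f (xs @ ys) = lsum G f xs \<oplus> lsum G f ys"
  by (induction xs) (auto simp: a_assoc)

lemma lsum_zero: "lsum G (\<lambda>x. \<zero>) xs = \<zero>"
  by (induction xs) auto

lemma lsum_add:
  "(\<And>x. x \<in> set xs \<Longrightarrow> f x \<in> carrier G) \<Longrightarrow> (\<And>x. x \<in> set xs \<Longrightarrow> g x \<in> carrier G) \<Longrightarrow>
    lsum G (\<lambda>x. f x \<oplus> g x) xs = lsum G f xs \<oplus> lsum G g xs"
proof (induction xs)
  case (Cons x xs)
  then show ?case by (simp add: a_ac lsum_closed)
qed auto

lemma lsum_swap:
  "(\<And>x y. x \<in> set xs \<Longrightarrow> y \<in> set ys \<Longrightarrow> f x y \<in> carrier G) \<Longrightarrow>
    lsum G (\<lambda>x. lsum G (\<lambda>y. f x y) ys) xs = lsum G (\<lambda>y. lsum G (\<lambda>x. f x y) xs) ys"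
proof (induction xs)
  case (Cons x xs)
  then show ?case by (simp add: lsum_add lsum_closed)
qed (simp add: lsum_zero)

lemma lsum_concat:
  "(\<And>x y. x \<in> set xs \<Longrightarrow> y \<in> set (ys x) \<Longrightarrow> f y \<in> carrier G) \<Longrightarrow>
    lsum G f (concat (map ys xs)) = lsum G (\<lambda>x. lsum G f (ys x)) xs"
proof (induction xs)
  case (Cons x xs)
  have "f y \<in> carrier G" if "y \<in> set (concat (map ys xs))" for y
    using that Cons.prems by auto
  then have "lsum G f (ys x @ concat (map ys xs)) = lsum G f (ys x) \<oplus> lsum G f (concat (map ys xs))"
    using Cons.prems by (intro lsum_append) auto
  moreover have "lsum G f (concat (map ys xs)) = lsum G (\<lambda>x. lsum G f (ys x)) xs"
    using Cons.prems by (intro Cons.IH) auto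
  ultimately show ?case by simp
qed auto

lemma minus_eq_zero_iff: "x \<in> carrier G \<Longrightarrow> y \<in> carrier G \<Longrightarrow> x \<ominus> y = \<zero> \<longleftrightarrow> x = y"
  by (metis a_minus_def add.inv_closed add.inv_equality r_neg minus_minus)

end

definition ahom :: "('b, 'm) ring_scheme \<Rightarrow> ('c, 'n) ring_scheme \<Rightarrow> ('b \<Rightarrow> 'c) set" where
  "ahom G G' = {h. (\<forall>x\<in>carrier G. h x \<in> carrier G') \<and>
     (\<forall>x\<in>carrier G. \<forall>y\<in>carrier G. h (x \<oplus>\<^bsub>G\<^esub> y) = h x \<oplus>\<^bsub>G'\<^esub> h y)}"

lemma ahomI:
  "(\<And>x. x \<in> carrier G \<Longrightarrow> h x \<in> carrier G') \<Longrightarrow>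
   (\<And>x y. x \<in> carrier G \<Longrightarrow> y \<in> carrier G \<Longrightarrow> h (x \<oplus>\<^bsub>G\<^esub> y) = h x \<oplus>\<^bsub>G'\<^esub> h y) \<Longrightarrow> h \<in> ahom G G'"
  by (simp add: ahom_def)

lemma ahom_closed: "h \<in> ahom G G' \<Longrightarrow> x \<in> carrier G \<Longrightarrow> h x \<in> carrier G'"
  and ahom_add: "h \<in> ahom G G' \<Longrightarrow> x \<in> carrier G \<Longrightarrow> y \<in> carrier G \<Longrightarrow>
    h (x \<oplus>\<^bsub>G\<^esub> y) = h x \<oplus>\<^bsub>G'\<^esub> h y"
  by (simp_all add: ahom_def)

lemma ahom_comp: "h \<in> ahom G G' \<Longrightarrow> h' \<in> ahom G' G'' \<Longrightarrow> (\<lambda>x. h' (h x)) \<in> ahom G G''"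
  by (auto simp: ahom_def)

lemma ahom_id: "(\<lambda>x. x) \<in> ahom G G"
  by (auto simp: ahom_def)

lemma ahom_zero:
  assumes "abelian_group G" "abelian_group G'" "h \<in> ahom G G'"
  shows "h \<zero>\<^bsub>G\<^esub> = \<zero>\<^bsub>G'\<^esub>"
proof -
  interpret G: abelian_group G by fact
  interpret G': abelian_group G' by fact
  have "h \<zero>\<^bsub>G\<^esub> \<oplus>\<^bsub>G'\<^esub> h \<zero>\<^bsub>G\<^esub> = h \<zero>\<^bsub>G\<^esub>"
    using ahom_add[OF assms(3), of "\<zero>\<^bsub>G\<^esub>" "\<zero>\<^bsub>G\<^esub>"] by simp
  then show ?thesis
    using ahom_closed[OF assms(3), of "\<zero>\<^bsub>G\<^esub>"] G'.add.r_cancel_one' by fastforce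
qed

lemma ahom_minus:
  assumes "abelian_group G" "abelian_group G'" "h \<in> ahom G G'" "x \<in> carrier G"
  shows "h (\<ominus>\<^bsub>G\<^esub> x) = \<ominus>\<^bsub>G'\<^esub> h x"
proof -
  interpret G: abelian_group G by fact
  interpret G': abelian_group G' by fact
  have "h (\<ominus>\<^bsub>G\<^esub> x) \<oplus>\<^bsub>G'\<^esub> h x = \<zero>\<^bsub>G'\<^esub>"
    using ahom_add[OF assms(3), of "\<ominus>\<^bsub>G\<^esub> x" x] assms(4) ahom_zero[OF assms(1-3)]
    by (simp add: G.l_neg)
  then show ?thesis
    using ahom_closed[OF assms(3)] assms(4) by (simp add: G'.minus_equality)
qed

lemma ahom_lsum:
  assumes "abelian_group G" "abelian_group G'" "h \<in> ahom G G'"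
    and "\<And>x. x \<in> set xs \<Longrightarrow> f x \<in> carrier G"
  shows "h (lsum G f xs) = lsum G' (\<lambda>x. h (f x)) xs"
proof -
  interpret G: abelian_group G by fact
  show ?thesis using assms(4)
    by (induction xs) (simp_all add: ahom_zero[OF assms(1-3)] ahom_add[OF assms(3)] G.lsum_closed)
qed

lemma ahom_diff_fun:
  assumes "abelian_group G'" "h \<in> ahom G G'" "h' \<in> ahom G G'" 
  shows "(\<lambda>x. h x \<ominus>\<^bsub>G'\<^esub> h' x) \<in> ahom G G'"
proof -
  interpret G': abelian_group G' by fact
  show ?thesis
    using ahom_closed[OF assms(2)] ahom_closed[OF assms(3)]
    by (intro ahomI) (simp_all add: ahom_add[OF assms(2)] ahom_add[OF assms(3)] a_minus_def
        G'.minus_add G'.a_ac)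
qed

lemma ahom_add_fun:
  assumes "abelian_group G'" "h \<in> ahom G G'" "h' \<in> ahom G G'" 
  shows "(\<lambda>x. h x \<oplus>\<^bsub>G'\<^esub> h' x) \<in> ahom G G'"
proof -
  interpret G': abelian_group G' by fact
  show ?thesis
    using ahom_closed[OF assms(2)] ahom_closed[OF assms(3)]
    by (intro ahomI) (simp_all add: ahom_add[OF assms(2)] ahom_add[OF assms(3)] G'.a_ac)
qed

lemma ahom_lsum_fun:
  assumes "abelian_group G'" "\<And>i. i \<in> set xs \<Longrightarrow> h i \<in> ahom G G'"
  shows "(\<lambda>x. lsum G' (\<lambda>i. h i x) xs) \<in> ahom G G'"
proof -
  interpret G': abelian_group G' by fact
  show ?thesis using assms(2)
  proof (induction xs)
    case Nil then show ?case by (auto intro: ahomI)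
  next
    case (Cons i xs)
    then show ?case
      using ahom_add_fun[OF assms(1), of "h i" G "\<lambda>x. lsum G' (\<lambda>i. h i x) xs"] by simp
  qed
qed


section \<open>Abelian groups with a presentation\<close>

lemma comm_group_cong:
  assumes "comm_group M" "carrier M' = carrier M" "mult M' = mult M" "one M' = one M"
  shows "comm_group M'"
proof -
  interpret comm_group M by fact
  show ?thesis
    by (rule comm_groupI) (use assms in \<open>auto simp: m_ac\<close>)
qed

text \<open>The tensor products over a field and over a subring are both records whose additive group has a
  presentation, but they are records of different types. Stating the three fields that matter
  separately covers both.\<close>

locale presented =
  fixes T :: "(('g \<Rightarrow>\<^sub>0 int) set, 'm) ring_scheme" (structure)
    and S :: "'g set" and X :: "('g \<Rightarrow>\<^sub>0 int) set"
  assumes carrier_T: "carrier T = carrier (pres_group S X)"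
    and add_T: "add T = mult (pres_group S X)"
    and zero_T: "zero T = one (pres_group S X)"
    and rels_keys: "x \<in> X \<Longrightarrow> Poly_Mapping.keys x \<subseteq> S"
begin

abbreviation gen :: "'g \<Rightarrow> ('g \<Rightarrow>\<^sub>0 int) set" where "gen \<equiv> pres_gen S X"
abbreviation "Fr \<equiv> free_Abelian_group S"
abbreviation "N \<equiv> generate Fr X"
abbreviation "cl x \<equiv> N #>\<^bsub>Fr\<^esub> x"

lemma X_sub: "X \<subseteq> carrier Fr" using rels_keys by auto

lemma N_normal: "N \<lhd> Fr"
proof -
  interpret F: comm_group Fr by (rule abelian_free_Abelian_group)
  show ?thesis using X_sub F.generate_is_subgroup F.subgroup_imp_normal by blast
qed

lemma comm_group_add: "comm_group (add_monoid T)"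
proof -
  interpret F: comm_group Fr by (rule abelian_free_Abelian_group)
  interpret N: normal N Fr by (rule N_normal)
  have "comm_group (pres_group S X)"
    unfolding pres_group_def by (rule F.abelian_FactGroup) (rule N.subgroup_axioms)
  then show ?thesis
    by (rule comm_group_cong) (simp_all add: carrier_T add_T zero_T)
qed

lemma abelian_group_T: "abelian_group T"
  by (rule comm_group_abelian_groupI[OF comm_group_add])

sublocale abelian_group T by (rule abelian_group_T)

lemma cl_closed: "x \<in> carrier Fr \<Longrightarrow> cl x \<in> carrier T"
  using carrier_T
  by (auto simp: pres_group_def FactGroup_def RCOSETS_def)

lemma cl_surj: "t \<in> carrier T \<Longrightarrow> \<exists>x\<in>carrier Fr. t = cl x"
  using carrier_T
  by (auto simp: pres_group_def FactGroup_def RCOSETS_def)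

lemma cl_hom: "cl \<in> hom Fr (add_monoid T)"
proof -
  interpret N: normal N Fr by (rule N_normal)
  have "cl \<in> hom Fr (pres_group S X)" unfolding pres_group_def by (rule N.r_coset_hom_Mod)
  then show ?thesis by (simp add: hom_def carrier_T add_T)
qed

lemma cl_group_hom: "group_hom Fr (add_monoid T) cl"
  using cl_hom comm_group_add abelian_free_Abelian_group[of S]
  by (auto simp: group_hom_def group_hom_axioms_def comm_group_def)

lemma cl_diff:
  assumes "x \<in> carrier Fr" "y \<in> carrier Fr"
  shows "cl (x - y) = cl x \<ominus> cl y"
proof -
  interpret F: comm_group Fr by (rule abelian_free_Abelian_group)
  interpret c: group_hom Fr "add_monoid T" cl by (rule cl_group_hom)
  have "cl (x \<otimes>\<^bsub>Fr\<^esub> inv\<^bsub>Fr\<^esub> y) = cl x \<otimes>\<^bsub>add_monoid T\<^esub> inv\<^bsub>add_monoid T\<^esub> cl y"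
    by (simp only: c.hom_mult[OF assms(1) F.inv_closed[OF assms(2)]] c.hom_inv[OF assms(2)])
  then show ?thesis using assms by (simp add: a_minus_def a_inv_def)
qed

lemma cl_rel: "x \<in> X \<Longrightarrow> cl x = \<zero>"
proof -
  assume "x \<in> X"
  then have x: "x \<in> N" by (rule generate.incl)
  interpret F: comm_group Fr by (rule abelian_free_Abelian_group)
  interpret N: normal N Fr by (rule N_normal)
  have "cl x = N" using x N.rcos_const by blast
  also have "N = \<zero>"
    by (simp add: zero_T pres_group_def FactGroup_def)
  finally show ?thesis .
qed

lemma gen_eq: "gen g = cl (frag_of g)"
  by (simp add: pres_gen_def)

lemma gen_closed [simp, intro]: "g \<in> S \<Longrightarrow> gen g \<in> carrier T"
  unfolding gen_eq by (rule cl_closed) simp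

lemma gen_induct [consumes 1, case_names zero gen diff]:
  assumes "t \<in> carrier T"
    and "P \<zero>" and "\<And>g. g \<in> S \<Longrightarrow> P (gen g)"
    and "\<And>t u. t \<in> carrier T \<Longrightarrow> u \<in> carrier T \<Longrightarrow> P t \<Longrightarrow> P u \<Longrightarrow> P (t \<ominus> u)"
  shows "P t"
proof -
  obtain x where x: "x \<in> carrier Fr" "t = cl x" using cl_surj assms(1) by blast
  have "P (cl x)"
  proof (rule free_Abelian_group_induct[of x S "\<lambda>x. P (cl x)"])
    show "Poly_Mapping.keys x \<subseteq> S" using x by simp
    interpret c: group_hom Fr "add_monoid T" cl by (rule cl_group_hom)
    show "P (cl 0)" using c.hom_one assms(2) by simp
  next
    fix x y assume "Poly_Mapping.keys x \<subseteq> S" "Poly_Mapping.keys y \<subseteq> S" "P (cl x)" "P (cl y)"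
    then show "P (cl (x - y))" using cl_closed assms(4) by (simp add: cl_diff)
  next
    fix a assume "a \<in> S"
    then show "P (cl (frag_of a))" using assms(3) gen_eq by metis
  qed
  then show ?thesis using x by simp
qed

text \<open>Biadditivity of a tensor product consists of relations with three terms, balancedness of
  relations with two.\<close>

lemma gen_rel3:
  assumes "frag_of a - frag_of b - frag_of c \<in> X" "a \<in> S" "b \<in> S" "c \<in> S"
  shows "gen a = gen b \<oplus> gen c"
proof -
  have b: "frag_of a - frag_of b \<in> carrier Fr"
    using assms keys_diff[of "frag_of a" "frag_of b"] by auto
  have "\<zero> = cl (frag_of a - frag_of b - frag_of c)" using cl_rel[OF assms(1)] by simp
  also have "\<dots> = gen a \<ominus> gen b \<ominus> gen c"
    using b assms by (simp only: cl_diff frag_of_in_free_Abelian_group gen_eq)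
  finally have "gen a \<ominus> gen b \<ominus> gen c = \<zero>" by simp
  then have "gen a \<ominus> gen b = gen c"
    using assms(2-4) by (simp add: minus_eq_zero_iff)
  then have "gen a = gen c \<oplus> gen b"
    using assms(2-4) by (metis a_minus_def add.inv_solve_right gen_closed)
  then show ?thesis using assms(2-4) by (simp add: a_comm)
qed

lemma gen_rel2:
  assumes "frag_of a - frag_of b \<in> X" "a \<in> S" "b \<in> S"
  shows "gen a = gen b"
proof -
  have "\<zero> = gen a \<ominus> gen b"
    using cl_rel[OF assms(1)] assms(2,3)
    by (simp only: cl_diff frag_of_in_free_Abelian_group gen_eq)
  then show ?thesis using assms minus_eq_zero_iff by (metis gen_closed)
qed

lemma gen_ext:
  assumes "abelian_group G" "h \<in> ahom T G" "h' \<in> ahom T G"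
    and "\<And>g. g \<in> S \<Longrightarrow> h (gen g) = h' (gen g)" and "t \<in> carrier T"
  shows "h t = h' t"
proof -
  have h_diff: "h (t \<ominus> u) = h t \<ominus>\<^bsub>G\<^esub> h u" if "h \<in> ahom T G" "t \<in> carrier T" "u \<in> carrier T" for h t u
    using that by (simp add: a_minus_def ahom_add ahom_minus[OF abelian_group_T assms(1)])
  show ?thesis using assms(5)
  proof (induction rule: gen_induct)
    case zero
    show ?case using assms(2,3) ahom_zero[OF abelian_group_T assms(1)] by metis
  next
    case (gen g) then show ?case by (rule assms(4))
  next
    case (diff t u) then show ?case by (simp add: h_diff[OF assms(2)] h_diff[OF assms(3)])
  qed
qed

lemma pres_lift_ahom:
  assumes G: "abelian_group G"
    and M: "carrier M = carrier G" "mult M = add G" "one M = zero G" and f: "\<And>g. g \<in> S \<Longrightarrow> f g \<in> carrier G"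
    and rel: "\<And>x. x \<in> X \<Longrightarrow>
      (\<exists>a b c. a \<in> S \<and> b \<in> S \<and> c \<in> S \<and> x = frag_of a - frag_of b - frag_of c \<and> f a = f b \<oplus>\<^bsub>G\<^esub> f c) \<or>
      (\<exists>a b. a \<in> S \<and> b \<in> S \<and> x = frag_of a - frag_of b \<and> f a = f b)"
  shows "pres_lift S X M f \<in> ahom T G"
    and "g \<in> S \<Longrightarrow> pres_lift S X M f (gen g) = f g"
proof -
  interpret G: abelian_group G by fact
  interpret F: comm_group Fr by (rule abelian_free_Abelian_group)
  have cM: "comm_group M" by (rule comm_group_cong[OF G.a_comm_group]) (simp_all add: M)
  have R: "\<psi> x = \<one>\<^bsub>M\<^esub>" if \<psi>: "\<psi> \<in> hom Fr M"
      "\<And>g. g \<in> S \<Longrightarrow> \<psi> (frag_of g) = f g" and x: "x \<in> X" for \<psi> x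
  proof -
    interpret p: group_hom Fr M \<psi>
      using \<psi>(1) cM abelian_free_Abelian_group[of S]
      by (auto simp: group_hom_def group_hom_axioms_def comm_group_def)
    have d: "\<psi> (u - v) = \<psi> u \<ominus>\<^bsub>G\<^esub> \<psi> v" if "u \<in> carrier Fr" "v \<in> carrier Fr" for u v
    proof -
      have "\<psi> (u \<otimes>\<^bsub>Fr\<^esub> inv\<^bsub>Fr\<^esub> v) = \<psi> u \<otimes>\<^bsub>M\<^esub> inv\<^bsub>M\<^esub> \<psi> v"
        by (simp only: p.hom_mult[OF that(1) F.inv_closed[OF that(2)]] p.hom_inv[OF that(2)])
      moreover have "inv\<^bsub>Fr\<^esub> v = - v" using that by simp
      ultimately show ?thesis by (simp add: a_minus_def a_inv_def m_inv_def[of M] m_inv_def[of "add_monoid G"] M)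
    qed
    from rel[OF x] show ?thesis
    proof (elim disjE exE conjE)
      fix a b c assume *: "a \<in> S" "b \<in> S" "c \<in> S" "x = frag_of a - frag_of b - frag_of c"
        "f a = f b \<oplus>\<^bsub>G\<^esub> f c"
      have "frag_of a - frag_of b \<in> carrier Fr"
        using * keys_diff[of "frag_of a" "frag_of b"] by auto
      then have "\<psi> x = f a \<ominus>\<^bsub>G\<^esub> f b \<ominus>\<^bsub>G\<^esub> f c"
        using * by (simp only: d frag_of_in_free_Abelian_group \<psi>(2))
      also have "\<dots> = (f b \<oplus>\<^bsub>G\<^esub> f c) \<ominus>\<^bsub>G\<^esub> (f b \<oplus>\<^bsub>G\<^esub> f c)"
        using * f by (simp add: a_minus_def G.minus_add G.a_assoc)
      finally show ?thesis using * f by (simp add: a_minus_def G.r_neg M)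
    next
      fix a b assume *: "a \<in> S" "b \<in> S" "x = frag_of a - frag_of b" "f a = f b"
      then have "\<psi> x = f a \<ominus>\<^bsub>G\<^esub> f b"
        by (simp only: d frag_of_in_free_Abelian_group \<psi>(2))
      then show ?thesis using * f by (simp add: G.minus_eq_zero_iff M)
    qed
  qed
  have fM: "f g \<in> carrier M" if "g \<in> S" for g using that f M by simp
  have L: "pres_lift S X M f \<in> hom (pres_group S X) M"
    "\<And>g. g \<in> S \<Longrightarrow> pres_lift S X M f (gen g) = f g"
    by (rule pres_lift_exists[OF cM]; (rule fM rels_keys R)?; assumption)+
  show "pres_lift S X M f \<in> ahom T G"
    using L(1) f by (simp add: M ahom_def hom_def carrier_T add_T Pi_def)
  show "g \<in> S \<Longrightarrow> pres_lift S X M f (gen g) = f g" using L(2) f M by auto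
qed

end

text \<open>Extending in the first argument is immediate for each generator of the second group. That the
  result extends in the second argument holds for generators \<open>t\<close> of the first group, and the \<open>t\<close> with
  this property form a subgroup.\<close>

lemma presented_pairing:
  assumes T: "presented T S X" and T': "presented T' S' X'" and G: "abelian_group G"
    and l: "\<And>g'. g' \<in> S' \<Longrightarrow> \<exists>h\<in>ahom T G. \<forall>g\<in>S. h (pres_gen S X g) = f g g'"
    and r: "\<And>g. g \<in> S \<Longrightarrow> \<exists>h\<in>ahom T' G. \<forall>g'\<in>S'. h (pres_gen S' X' g') = f g g'"
  shows "\<exists>P. (\<forall>t'\<in>carrier T'. (\<lambda>t. P t t') \<in> ahom T G) \<and> (\<forall>t\<in>carrier T. P t \<in> ahom T' G) \<and>
    (\<forall>g\<in>S. \<forall>g'\<in>S'. P (pres_gen S X g) (pres_gen S' X' g') = f g g')"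
proof -
  interpret T: presented T S X by fact
  interpret T': presented T' S' X' by fact
  interpret G: abelian_group G by fact
  obtain \<phi> where \<phi>: "\<And>g'. g' \<in> S' \<Longrightarrow> \<phi> g' \<in> ahom T G"
      "\<And>g' g. g' \<in> S' \<Longrightarrow> g \<in> S \<Longrightarrow> \<phi> g' (T.gen g) = f g g'"
    using l by metis
  have "\<exists>h\<in>ahom T' G. \<forall>g'\<in>S'. h (T'.gen g') = \<phi> g' t" if "t \<in> carrier T" for t
    using that
  proof (induction rule: T.gen_induct)
    case zero
    have "(\<lambda>t. \<zero>\<^bsub>G\<^esub>) \<in> ahom T' G" by (auto intro: ahomI)
    then show ?case using \<phi>(1) ahom_zero[OF T.abelian_group_T G] by metis
  next
    case (gen g)
    then show ?case using r \<phi>(2) by metis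
  next
    case (diff t u)
    then obtain h h' where h: "h \<in> ahom T' G" "h' \<in> ahom T' G"
        "\<And>g'. g' \<in> S' \<Longrightarrow> h (T'.gen g') = \<phi> g' t" "\<And>g'. g' \<in> S' \<Longrightarrow> h' (T'.gen g') = \<phi> g' u"
      by metis
    show ?case
      by (rule bexI[OF _ ahom_diff_fun[OF G h(1,2)]])
        (use diff h in \<open>auto simp: a_minus_def ahom_add[OF \<phi>(1)] ahom_minus[OF T.abelian_group_T G \<phi>(1)]\<close>)
  qed
  then obtain P where P: "\<And>t. t \<in> carrier T \<Longrightarrow> P t \<in> ahom T' G"
      "\<And>t g'. t \<in> carrier T \<Longrightarrow> g' \<in> S' \<Longrightarrow> P t (T'.gen g') = \<phi> g' t"
    by metis
  have "P (t \<oplus>\<^bsub>T\<^esub> u) t' = P t t' \<oplus>\<^bsub>G\<^esub> P u t'"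
    if "t \<in> carrier T" "u \<in> carrier T" "t' \<in> carrier T'" for t u t'
    by (rule T'.gen_ext[OF G P(1) ahom_add_fun[OF G P(1) P(1)], OF _ _ _ _ that(3)])
      (use that P(2) \<phi>(1) in \<open>auto simp: ahom_add\<close>)
  then have "\<forall>t'\<in>carrier T'. (\<lambda>t. P t t') \<in> ahom T G"
    by (auto intro!: ahomI ahom_closed[OF P(1)])
  then show ?thesis using P \<phi>(2) by (intro exI[of _ P]) auto
qed


section \<open>Tensor products of vector spaces\<close>

text \<open>The target is only an abelian group: tensor powers over \<open>R\<close>, where many of these maps go, carry no
  scalar multiplication. So linearity over \<open>K\<close> is replaced with balancedness.\<close>

definition bilin ::
  "('k, 'z) ring_scheme \<Rightarrow> ('k, 'v, 'x) module_scheme \<Rightarrow> ('k, 'w, 'y) module_scheme \<Rightarrow>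
    ('b, 'm) ring_scheme \<Rightarrow> ('v \<Rightarrow> 'w \<Rightarrow> 'b) \<Rightarrow> bool" where
  "bilin K V W G f \<longleftrightarrow>
     (\<forall>w\<in>carrier W. (\<lambda>v. f v w) \<in> ahom V G) \<and> (\<forall>v\<in>carrier V. f v \<in> ahom W G) \<and>
     (\<forall>c\<in>carrier K. \<forall>v\<in>carrier V. \<forall>w\<in>carrier W. f (c \<odot>\<^bsub>V\<^esub> v) w = f v (c \<odot>\<^bsub>W\<^esub> w))"

lemma bilinI:
  assumes "\<And>w. w \<in> carrier W \<Longrightarrow> (\<lambda>v. f v w) \<in> ahom V G"
    and "\<And>v. v \<in> carrier V \<Longrightarrow> f v \<in> ahom W G"
    and "\<And>c v w. c \<in> carrier K \<Longrightarrow> v \<in> carrier V \<Longrightarrow> w \<in> carrier W \<Longrightarrow>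
      f (c \<odot>\<^bsub>V\<^esub> v) w = f v (c \<odot>\<^bsub>W\<^esub> w)"
  shows "bilin K V W G f"
  using assms by (simp add: bilin_def)

lemma bilinD:
  assumes "bilin K V W G f"
  shows "w \<in> carrier W \<Longrightarrow> (\<lambda>v. f v w) \<in> ahom V G"
    and "v \<in> carrier V \<Longrightarrow> f v \<in> ahom W G"
    and "c \<in> carrier K \<Longrightarrow> v \<in> carrier V \<Longrightarrow> w \<in> carrier W \<Longrightarrow>
      f (c \<odot>\<^bsub>V\<^esub> v) w = f v (c \<odot>\<^bsub>W\<^esub> w)"
    and "v \<in> carrier V \<Longrightarrow> w \<in> carrier W \<Longrightarrow> f v w \<in> carrier G"
  using assms by (auto simp: bilin_def ahom_closed)

lemma bilin_comp:
  assumes "bilin K V W G f" "h \<in> ahom G G'"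
  shows "bilin K V W G' (\<lambda>v w. h (f v w))"
proof (rule bilinI)
  fix w assume "w \<in> carrier W"
  from ahom_comp[OF bilinD(1)[OF assms(1) this] assms(2)]
  show "(\<lambda>v. h (f v w)) \<in> ahom V G'" .
next
  fix v assume "v \<in> carrier V"
  from ahom_comp[OF bilinD(2)[OF assms(1) this] assms(2)]
  show "(\<lambda>w. h (f v w)) \<in> ahom W G'" .
qed (simp add: bilinD(3)[OF assms(1)])

lemma bilin_lsum:
  assumes "abelian_group G" "\<And>i. i \<in> set xs \<Longrightarrow> bilin K V W G (f i)"
  shows "bilin K V W G (\<lambda>v w. lsum G (\<lambda>i. f i v w) xs)"
proof (rule bilinI)
  fix w assume "w \<in> carrier W"
  then show "(\<lambda>v. lsum G (\<lambda>i. f i v w) xs) \<in> ahom V G"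
    using bilinD(1)[OF assms(2)] by (intro ahom_lsum_fun[OF assms(1)])
next
  fix v assume "v \<in> carrier V"
  then show "(\<lambda>w. lsum G (\<lambda>i. f i v w) xs) \<in> ahom W G"
    using bilinD(2)[OF assms(2)] by (intro ahom_lsum_fun[OF assms(1)])
qed (rule lsum_cong, simp_all add: bilinD(3)[OF assms(2)])

lemma bilin_cong:
  assumes "bilin K V W G f" "module K V" "module K W"
    and "\<And>v w. v \<in> carrier V \<Longrightarrow> w \<in> carrier W \<Longrightarrow> f v w = g v w"
  shows "bilin K V W G g"
proof -
  interpret V: module K V by fact
  interpret W: module K W by fact
  show ?thesis
    using assms(1) assms(4)[symmetric] by (auto simp: bilin_def ahom_def)
qed

locale tensor_product =
  fixes K :: "('k, 'z) ring_scheme" and V :: "('k, 'v, 'x) module_scheme"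
    and W :: "('k, 'w, 'y) module_scheme"
  assumes V: "module K V" and W: "module K W"
begin

sublocale V: module K V by (rule V)
sublocale W: module K W by (rule W)

abbreviation "T \<equiv> tensor K V W"
abbreviation "pure \<equiv> pure_tensor K V W"

sublocale T: presented T "tensor_gens V W" "tensor_rels K V W"
proof
  fix x assume "x \<in> tensor_rels K V W"
  then show "Poly_Mapping.keys x \<subseteq> tensor_gens V W"
    unfolding tensor_rels_def tensor_gens_def
    by (auto dest!: subsetD[OF keys_diff])
qed (auto simp: tensor_def)

lemma bilin_pure: "bilin K V W T pure"
proof (rule bilinI)
  fix w assume w: "w \<in> carrier W"
  show "(\<lambda>v. pure v w) \<in> ahom V T"
    unfolding pure_tensor_def
    by (rule ahomI; (rule T.gen_closed T.gen_rel3)?)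
      (use w in \<open>auto simp: tensor_gens_def tensor_rels_def\<close>)
next
  fix v assume v: "v \<in> carrier V"
  show "pure v \<in> ahom W T"
    unfolding pure_tensor_def
    by (rule ahomI; (rule T.gen_closed T.gen_rel3)?)
      (use v in \<open>auto simp: tensor_gens_def tensor_rels_def\<close>)
next
  fix c v w assume *: "c \<in> carrier K" "v \<in> carrier V" "w \<in> carrier W"
  show "pure (c \<odot>\<^bsub>V\<^esub> v) w = pure v (c \<odot>\<^bsub>W\<^esub> w)"
    unfolding pure_tensor_def
    by (rule T.gen_rel2) (use * in \<open>auto simp: tensor_gens_def tensor_rels_def\<close>)
qed

lemmas pure_closed [simp, intro] = bilinD(4)[OF bilin_pure]

lemma pres_lift_bilin:
  assumes "abelian_group G" "bilin K V W G f"
    and "carrier M = carrier G" "mult M = add G" "one M = zero G"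
  shows "pres_lift (tensor_gens V W) (tensor_rels K V W) M (\<lambda>(v, w). f v w) \<in> ahom T G"
    and "v \<in> carrier V \<Longrightarrow> w \<in> carrier W \<Longrightarrow>
      pres_lift (tensor_gens V W) (tensor_rels K V W) M (\<lambda>(v, w). f v w) (pure v w) = f v w"
proof -
  have rel: "(\<exists>a b c. a \<in> tensor_gens V W \<and> b \<in> tensor_gens V W \<and> c \<in> tensor_gens V W \<and>
      x = frag_of a - frag_of b - frag_of c \<and>
      (case a of (v, w) \<Rightarrow> f v w) = (case b of (v, w) \<Rightarrow> f v w) \<oplus>\<^bsub>G\<^esub> (case c of (v, w) \<Rightarrow> f v w)) \<or>
      (\<exists>a b. a \<in> tensor_gens V W \<and> b \<in> tensor_gens V W \<and> x = frag_of a - frag_of b \<and>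
      (case a of (v, w) \<Rightarrow> f v w) = (case b of (v, w) \<Rightarrow> f v w))"
    if x: "x \<in> tensor_rels K V W" for x
    using x unfolding tensor_rels_def
  proof (elim UnE CollectE exE conjE)
    fix v v' w assume *: "x = frag_of (v \<oplus>\<^bsub>V\<^esub> v', w) - frag_of (v, w) - frag_of (v', w)"
      "v \<in> carrier V" "v' \<in> carrier V" "w \<in> carrier W"
    show ?thesis
      by (rule disjI1, rule exI[of _ "(v \<oplus>\<^bsub>V\<^esub> v', w)"], rule exI[of _ "(v, w)"], rule exI[of _ "(v', w)"])
        (use * in \<open>simp add: tensor_gens_def ahom_add[OF bilinD(1)[OF assms(2)]]\<close>)
  next
    fix v w w' assume *: "x = frag_of (v, w \<oplus>\<^bsub>W\<^esub> w') - frag_of (v, w) - frag_of (v, w')"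
      "v \<in> carrier V" "w \<in> carrier W" "w' \<in> carrier W"
    show ?thesis
      by (rule disjI1, rule exI[of _ "(v, w \<oplus>\<^bsub>W\<^esub> w')"], rule exI[of _ "(v, w)"], rule exI[of _ "(v, w')"])
        (use * in \<open>simp add: tensor_gens_def ahom_add[OF bilinD(2)[OF assms(2)]]\<close>)
  next
    fix c v w assume *: "x = frag_of (c \<odot>\<^bsub>V\<^esub> v, w) - frag_of (v, c \<odot>\<^bsub>W\<^esub> w)"
      "c \<in> carrier K" "v \<in> carrier V" "w \<in> carrier W"
    show ?thesis
      by (rule disjI2, rule exI[of _ "(c \<odot>\<^bsub>V\<^esub> v, w)"], rule exI[of _ "(v, c \<odot>\<^bsub>W\<^esub> w)"])
        (use * in \<open>simp add: tensor_gens_def bilinD(3)[OF assms(2)]\<close>)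
  qed
  have cl: "(case g of (v, w) \<Rightarrow> f v w) \<in> carrier G" if "g \<in> tensor_gens V W" for g
    using that bilinD(4)[OF assms(2)] by (auto simp: tensor_gens_def)
  note L = T.pres_lift_ahom[of G M "\<lambda>(v, w). f v w", OF assms(1,3-5) cl rel]
  show "pres_lift (tensor_gens V W) (tensor_rels K V W) M (\<lambda>(v, w). f v w) \<in> ahom T G"
    by (rule L(1))
  show "v \<in> carrier V \<Longrightarrow> w \<in> carrier W \<Longrightarrow>
      pres_lift (tensor_gens V W) (tensor_rels K V W) M (\<lambda>(v, w). f v w) (pure v w) = f v w"
    using L(2)[of "(v, w)"] by (simp add: pure_tensor_def tensor_gens_def)
qed

lemma tensor_lift_ahom:
  "abelian_group G \<Longrightarrow> bilin K V W G f \<Longrightarrow> tensor_lift K V W G f \<in> ahom T G"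
  and tensor_lift_pure:
  "abelian_group G \<Longrightarrow> bilin K V W G f \<Longrightarrow> v \<in> carrier V \<Longrightarrow> w \<in> carrier W \<Longrightarrow>
    tensor_lift K V W G f (pure v w) = f v w"
  unfolding tensor_lift_def by (simp_all add: pres_lift_bilin)

lemma tensor_ext:
  assumes "abelian_group G" "h \<in> ahom T G" "h' \<in> ahom T G"
    and "\<And>v w. v \<in> carrier V \<Longrightarrow> w \<in> carrier W \<Longrightarrow> h (pure v w) = h' (pure v w)" and "t \<in> carrier T"
  shows "h t = h' t"
  by (rule T.gen_ext[OF assms(1-3) _ assms(5)])
    (use assms(4) in \<open>auto simp: tensor_gens_def pure_tensor_def\<close>)

lemma pure_minus: "v \<in> carrier V \<Longrightarrow> w \<in> carrier W \<Longrightarrow> pure v (\<ominus>\<^bsub>W\<^esub> w) = \<ominus>\<^bsub>T\<^esub> pure v w"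
  by (rule ahom_minus[OF W.abelian_group_axioms T.abelian_group_T bilinD(2)[OF bilin_pure]])

lemma lsum_pure_minus:
  "set ps \<subseteq> carrier V \<times> carrier W \<Longrightarrow>
    \<ominus>\<^bsub>T\<^esub> lsum T (\<lambda>(v, w). pure v w) ps = lsum T (\<lambda>(v, w). pure v w) (map (\<lambda>(v, w). (v, \<ominus>\<^bsub>W\<^esub> w)) ps)"
proof (induction ps)
  case (Cons p ps)
  moreover have "lsum T (\<lambda>(v, w). pure v w) ps \<in> carrier T"
    using Cons.prems by (intro T.lsum_closed) auto
  ultimately show ?case
    by (cases p) (simp add: pure_minus T.minus_add)
qed simp

text \<open>Negative multiples of generators are absorbed into the second factor.\<close>

lemma tensor_list:
  assumes "t \<in> carrier T"
  shows "\<exists>ps. set ps \<subseteq> carrier V \<times> carrier W \<and> t = lsum T (\<lambda>(v, w). pure v w) ps"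
  using assms
proof (induction rule: T.gen_induct)
  case zero
  show ?case by (rule exI[of _ "[]"]) simp
next
  case (gen g)
  then obtain v w where g: "g = (v, w)" "v \<in> carrier V" "w \<in> carrier W"
    by (auto simp: tensor_gens_def)
  then have "T.gen g = lsum T (\<lambda>(v, w). pure v w) [g]"
    using pure_closed[of v w] by (simp add: pure_tensor_def)
  then show ?case using g by (intro exI[of _ "[g]"]) auto
next
  case (diff t u)
  then obtain ps qs where ps: "set ps \<subseteq> carrier V \<times> carrier W" "t = lsum T (\<lambda>(v, w). pure v w) ps"
    and qs: "set qs \<subseteq> carrier V \<times> carrier W" "u = lsum T (\<lambda>(v, w). pure v w) qs" by blast
  have "lsum T (\<lambda>(v, w). pure v w) (ps @ map (\<lambda>(v, w). (v, \<ominus>\<^bsub>W\<^esub> w)) qs) = t \<ominus>\<^bsub>T\<^esub> u"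
    using ps qs by (subst T.lsum_append) (auto simp: a_minus_def lsum_pure_minus)
  then show ?case
    using ps qs by (intro exI[of _ "ps @ map (\<lambda>(v, w). (v, \<ominus>\<^bsub>W\<^esub> w)) qs"]) auto
qed

lemma bilin_smult:
  assumes c: "c \<in> carrier K" shows "bilin K V W T (\<lambda>v w. pure (c \<odot>\<^bsub>V\<^esub> v) w)"
proof (rule bilinI)
  fix w assume w: "w \<in> carrier W"
  show "(\<lambda>v. pure (c \<odot>\<^bsub>V\<^esub> v) w) \<in> ahom V T"
    using c w by (auto intro!: ahomI simp: V.smult_r_distr ahom_add[OF bilinD(1)[OF bilin_pure]])
next
  fix v assume v: "v \<in> carrier V"
  show "pure (c \<odot>\<^bsub>V\<^esub> v) \<in> ahom W T" using c v by (intro bilinD(2)[OF bilin_pure]) auto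
next
  fix d v w assume *: "d \<in> carrier K" "v \<in> carrier V" "w \<in> carrier W"
  have "c \<odot>\<^bsub>V\<^esub> (d \<odot>\<^bsub>V\<^esub> v) = d \<odot>\<^bsub>V\<^esub> (c \<odot>\<^bsub>V\<^esub> v)"
    using * c by (simp add: V.smult_assoc1[symmetric] V.R.m_comm)
  then show "pure (c \<odot>\<^bsub>V\<^esub> (d \<odot>\<^bsub>V\<^esub> v)) w = pure (c \<odot>\<^bsub>V\<^esub> v) (d \<odot>\<^bsub>W\<^esub> w)"
    using * c by (simp add: bilinD(3)[OF bilin_pure])
qed

lemma smult_tensor_eq:
  "smult T c = pres_lift (tensor_gens V W) (tensor_rels K V W) (tensor_group K V W)
     (\<lambda>(v, w). pure_tensor K V W (c \<odot>\<^bsub>V\<^esub> v) w)"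
  by (simp add: tensor_def)

lemma smult_tensor_ahom: "c \<in> carrier K \<Longrightarrow> smult T c \<in> ahom T T"
  and smult_pure: "c \<in> carrier K \<Longrightarrow> v \<in> carrier V \<Longrightarrow> w \<in> carrier W \<Longrightarrow>
    c \<odot>\<^bsub>T\<^esub> pure v w = pure (c \<odot>\<^bsub>V\<^esub> v) w"
  unfolding smult_tensor_eq
  by (simp_all add: pres_lift_bilin[OF T.abelian_group_T bilin_smult] T.carrier_T T.add_T T.zero_T)

lemma module_tensor: "module K T"
proof (rule moduleI)
  show "cring K" by (rule V.R.is_cring)
  show "abelian_group T" by (rule T.abelian_group_T)
  note sa = smult_tensor_ahom
  fix a b x y assume a: "a \<in> carrier K" and b: "b \<in> carrier K" and x: "x \<in> carrier T" and y: "y \<in> carrier T"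
  show "a \<odot>\<^bsub>T\<^esub> x \<in> carrier T" using a x by (rule ahom_closed[OF sa])
  show "a \<odot>\<^bsub>T\<^esub> (x \<oplus>\<^bsub>T\<^esub> y) = a \<odot>\<^bsub>T\<^esub> x \<oplus>\<^bsub>T\<^esub> a \<odot>\<^bsub>T\<^esub> y" using a x y by (simp add: ahom_add[OF sa])
  show "(a \<oplus>\<^bsub>K\<^esub> b) \<odot>\<^bsub>T\<^esub> x = a \<odot>\<^bsub>T\<^esub> x \<oplus>\<^bsub>T\<^esub> b \<odot>\<^bsub>T\<^esub> x"
    by (rule tensor_ext[OF T.abelian_group_T sa ahom_add_fun[OF T.abelian_group_T sa sa]])
      (use a b x in \<open>auto simp: smult_pure V.smult_l_distr ahom_add[OF bilinD(1)[OF bilin_pure]]\<close>)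
  show "(a \<otimes>\<^bsub>K\<^esub> b) \<odot>\<^bsub>T\<^esub> x = a \<odot>\<^bsub>T\<^esub> (b \<odot>\<^bsub>T\<^esub> x)"
    by (rule tensor_ext[OF T.abelian_group_T sa ahom_comp[OF sa sa]])
      (use a b x in \<open>auto simp: smult_pure V.smult_assoc1\<close>)
next
  fix x assume x: "x \<in> carrier T"
  show "\<one>\<^bsub>K\<^esub> \<odot>\<^bsub>T\<^esub> x = x"
    by (rule tensor_ext[OF T.abelian_group_T smult_tensor_ahom ahom_id])
      (use x in \<open>auto simp: smult_pure\<close>)
qed

end


section \<open>Tensor powers over a subring\<close>

text \<open>The maps on lists that factor through the tensor power.\<close>

definition multiadd ::
  "('a, 'x) ring_scheme \<Rightarrow> 'a set \<Rightarrow> nat \<Rightarrow> ('b, 'm) ring_scheme \<Rightarrow> ('a list \<Rightarrow> 'b) \<Rightarrow> bool" where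
  "multiadd A B n G f \<longleftrightarrow>
     (\<forall>xs\<in>power_gens A n. f xs \<in> carrier G) \<and>
     (\<forall>xs\<in>power_gens A n. \<forall>i<n. \<forall>a\<in>carrier A. \<forall>a'\<in>carrier A.
        f (xs[i := a \<oplus>\<^bsub>A\<^esub> a']) = f (xs[i := a]) \<oplus>\<^bsub>G\<^esub> f (xs[i := a'])) \<and>
     (\<forall>xs\<in>power_gens A n. \<forall>i. Suc i < n \<longrightarrow> (\<forall>b\<in>B.
        f (xs[i := xs ! i \<otimes>\<^bsub>A\<^esub> b]) = f (xs[Suc i := b \<otimes>\<^bsub>A\<^esub> xs ! Suc i])))"

lemma multiaddI:
  assumes "\<And>xs. xs \<in> power_gens A n \<Longrightarrow> f xs \<in> carrier G"
    and "\<And>xs i a a'. xs \<in> power_gens A n \<Longrightarrow> i < n \<Longrightarrow> a \<in> carrier A \<Longrightarrow> a' \<in> carrier A \<Longrightarrow>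
        f (xs[i := a \<oplus>\<^bsub>A\<^esub> a']) = f (xs[i := a]) \<oplus>\<^bsub>G\<^esub> f (xs[i := a'])"
    and "\<And>xs i b. xs \<in> power_gens A n \<Longrightarrow> Suc i < n \<Longrightarrow> b \<in> B \<Longrightarrow>
        f (xs[i := xs ! i \<otimes>\<^bsub>A\<^esub> b]) = f (xs[Suc i := b \<otimes>\<^bsub>A\<^esub> xs ! Suc i])"
  shows "multiadd A B n G f"
  using assms by (simp add: multiadd_def)

lemma multiaddD:
  assumes "multiadd A B n G f"
  shows "xs \<in> power_gens A n \<Longrightarrow> f xs \<in> carrier G"
    and "xs \<in> power_gens A n \<Longrightarrow> i < n \<Longrightarrow> a \<in> carrier A \<Longrightarrow> a' \<in> carrier A \<Longrightarrow>
        f (xs[i := a \<oplus>\<^bsub>A\<^esub> a']) = f (xs[i := a]) \<oplus>\<^bsub>G\<^esub> f (xs[i := a'])"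
    and "xs \<in> power_gens A n \<Longrightarrow> Suc i < n \<Longrightarrow> b \<in> B \<Longrightarrow>
        f (xs[i := xs ! i \<otimes>\<^bsub>A\<^esub> b]) = f (xs[Suc i := b \<otimes>\<^bsub>A\<^esub> xs ! Suc i])"
  using assms by (simp_all add: multiadd_def)

lemma power_gens_length: "xs \<in> power_gens A n \<Longrightarrow> length xs = n"
  by (simp add: power_gens_def)

lemma power_gens_nth: "xs \<in> power_gens A n \<Longrightarrow> i < n \<Longrightarrow> xs ! i \<in> carrier A"
  by (auto simp: power_gens_def)

lemma power_gens_update: "xs \<in> power_gens A n \<Longrightarrow> a \<in> carrier A \<Longrightarrow> xs[i := a] \<in> power_gens A n"
  by (auto simp: power_gens_def dest: subsetD[OF set_update_subset_insert])

lemma power_gens_Cons: "x # xs \<in> power_gens A (Suc n) \<longleftrightarrow> x \<in> carrier A \<and> xs \<in> power_gens A n"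
  by (auto simp: power_gens_def)

lemma power_gens_snoc: "xs @ [x] \<in> power_gens A (Suc n) \<longleftrightarrow> x \<in> carrier A \<and> xs \<in> power_gens A n"
  by (auto simp: power_gens_def)

text \<open>What a tensor power of \<^term>\<open>A\<close> over \<^term>\<open>B\<close> needs as a bimodule over \<^term>\<open>S\<close>: the additive group
  of \<^term>\<open>A\<close> with the two actions of \<^term>\<open>S\<close>, which commute. For the smash product both \<^term>\<open>S\<close> and
  \<^term>\<open>B\<close> are the copy of \<open>H\<close> in it.\<close>

locale acted_ring =
  fixes A :: "('a, 'x) ring_scheme" and S B :: "'a set"
  assumes abelian_A: "abelian_group A" and BS: "B \<subseteq> S" 
    and lmult_ahom: "s \<in> S \<Longrightarrow> (\<lambda>a. s \<otimes>\<^bsub>A\<^esub> a) \<in> ahom A A"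
    and rmult_ahom: "s \<in> S \<Longrightarrow> (\<lambda>a. a \<otimes>\<^bsub>A\<^esub> s) \<in> ahom A A"
    and assoc: "s \<in> S \<Longrightarrow> t \<in> S \<Longrightarrow> a \<in> carrier A \<Longrightarrow>
      (s \<otimes>\<^bsub>A\<^esub> a) \<otimes>\<^bsub>A\<^esub> t = s \<otimes>\<^bsub>A\<^esub> (a \<otimes>\<^bsub>A\<^esub> t)"
begin

sublocale A: abelian_group A by (rule abelian_A)

lemma lmult_closed [simp]: "s \<in> S \<Longrightarrow> a \<in> carrier A \<Longrightarrow> s \<otimes>\<^bsub>A\<^esub> a \<in> carrier A"
  and rmult_closed [simp]: "s \<in> S \<Longrightarrow> a \<in> carrier A \<Longrightarrow> a \<otimes>\<^bsub>A\<^esub> s \<in> carrier A"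
  using ahom_closed[OF lmult_ahom] ahom_closed[OF rmult_ahom] by auto

lemma B_in_S [simp]: "b \<in> B \<Longrightarrow> b \<in> S" using BS by auto

lemma presented_power: "presented (tensor_power A B n) (power_gens A n) (power_rels A B n)"
proof
  fix x assume "x \<in> power_rels A B n"
  then show "Poly_Mapping.keys x \<subseteq> power_gens A n"
    unfolding power_rels_def
    by (auto dest!: subsetD[OF keys_diff] intro!: power_gens_update simp: power_gens_nth)
qed (auto simp: tensor_power_def)

abbreviation "pg n \<equiv> pres_gen (power_gens A n) (power_rels A B n)"

lemma abelian_power: "abelian_group (tensor_power A B n)"
  by (rule presented.abelian_group_T[OF presented_power])

lemma pg_closed: "xs \<in> power_gens A n \<Longrightarrow> pg n xs \<in> carrier (tensor_power A B n)"
  by (rule presented.gen_closed[OF presented_power])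

lemma multiadd_pg: "multiadd A B n (tensor_power A B n) (pg n)"
proof (rule multiaddI)
  interpret presented "tensor_power A B n" "power_gens A n" "power_rels A B n" by (rule presented_power)
  fix xs i assume xs: "xs \<in> power_gens A n"
  show "pg n xs \<in> carrier (tensor_power A B n)" using xs by (rule pg_closed)
  show "pg n (xs[i := a \<oplus>\<^bsub>A\<^esub> a']) = pg n (xs[i := a]) \<oplus>\<^bsub>tensor_power A B n\<^esub> pg n (xs[i := a'])"
    if "i < n" "a \<in> carrier A" "a' \<in> carrier A" for a a'
    by (rule gen_rel3) (use xs that in \<open>auto simp: power_rels_def intro!: power_gens_update\<close>)
  show "pg n (xs[i := xs ! i \<otimes>\<^bsub>A\<^esub> b]) = pg n (xs[Suc i := b \<otimes>\<^bsub>A\<^esub> xs ! Suc i])"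
    if "Suc i < n" "b \<in> B" for b
    by (rule gen_rel2) (use xs that in \<open>auto simp: power_rels_def power_gens_nth intro!: power_gens_update\<close>)
qed

lemma pres_lift_multiadd:
  assumes "abelian_group G" "multiadd A B n G f"
    and "carrier M = carrier G" "mult M = add G" "one M = zero G"
  shows "pres_lift (power_gens A n) (power_rels A B n) M f \<in> ahom (tensor_power A B n) G"
    and "xs \<in> power_gens A n \<Longrightarrow> pres_lift (power_gens A n) (power_rels A B n) M f (pg n xs) = f xs"
proof -
  interpret presented "tensor_power A B n" "power_gens A n" "power_rels A B n" by (rule presented_power)
  have rel: "(\<exists>a b c. a \<in> power_gens A n \<and> b \<in> power_gens A n \<and> c \<in> power_gens A n \<and>
      x = frag_of a - frag_of b - frag_of c \<and> f a = f b \<oplus>\<^bsub>G\<^esub> f c) \<or>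
      (\<exists>a b. a \<in> power_gens A n \<and> b \<in> power_gens A n \<and> x = frag_of a - frag_of b \<and> f a = f b)"
    if x: "x \<in> power_rels A B n" for x
    using x unfolding power_rels_def
  proof (elim UnE CollectE exE conjE)
    fix xs i a a' assume *: "x = frag_of (xs[i := a \<oplus>\<^bsub>A\<^esub> a']) - frag_of (xs[i := a]) - frag_of (xs[i := a'])"
      "xs \<in> power_gens A n" "i < n" "a \<in> carrier A" "a' \<in> carrier A"
    show ?thesis
      by (rule disjI1, rule exI[of _ "xs[i := a \<oplus>\<^bsub>A\<^esub> a']"], rule exI[of _ "xs[i := a]"], rule exI[of _ "xs[i := a']"])
        (use * in \<open>simp add: power_gens_update multiaddD(2)[OF assms(2)]\<close>)
  next
    fix xs i b assume *: "x = frag_of (xs[i := xs ! i \<otimes>\<^bsub>A\<^esub> b]) - frag_of (xs[Suc i := b \<otimes>\<^bsub>A\<^esub> xs ! Suc i])"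
      "xs \<in> power_gens A n" "Suc i < n" "b \<in> B"
    moreover have "b \<in> S" using * BS by auto
    ultimately show ?thesis
      by (intro disjI2 exI[of _ "xs[i := xs ! i \<otimes>\<^bsub>A\<^esub> b]"] exI[of _ "xs[Suc i := b \<otimes>\<^bsub>A\<^esub> xs ! Suc i]"])
        (simp add: power_gens_update power_gens_nth multiaddD(3)[OF assms(2)])
  qed
  note L = pres_lift_ahom[of G M f, OF assms(1,3-5) multiaddD(1)[OF assms(2)] rel]
  show "pres_lift (power_gens A n) (power_rels A B n) M f \<in> ahom (tensor_power A B n) G"
    and "xs \<in> power_gens A n \<Longrightarrow> pres_lift (power_gens A n) (power_rels A B n) M f (pg n xs) = f xs"
    by (auto intro: L)
qed

lemma multiadd_extend:
  assumes "abelian_group G" "multiadd A B n G f"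
  shows "\<exists>h\<in>ahom (tensor_power A B n) G. \<forall>xs\<in>power_gens A n. h (pg n xs) = f xs"
  by (rule bexI[OF _ pres_lift_multiadd(1)[OF assms, of "add_monoid G"]])
    (use pres_lift_multiadd(2)[OF assms, of "add_monoid G"] in auto)

lemma power_ext:
  assumes "abelian_group G" "h \<in> ahom (tensor_power A B n) G" "h' \<in> ahom (tensor_power A B n) G"
    and "\<And>xs. xs \<in> power_gens A n \<Longrightarrow> h (pg n xs) = h' (pg n xs)" and "t \<in> carrier (tensor_power A B n)"
  shows "h t = h' t"
  by (rule presented.gen_ext[OF presented_power assms])

text \<open>A map acting on the factor at position \<open>j\<close> is compatible with the balancing relations when it commutes
  with the multiplications at the tensor signs next to \<open>j\<close>. At each end of the list there is no sign on one side,
  which is why left multiplication of the first factor and right multiplication of the last one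
  are allowed.\<close>

lemma multiadd_update:
  assumes \<phi>: "\<phi> \<in> ahom A A" and j: "j < n"
    and l: "\<And>a b. j > 0 \<Longrightarrow> a \<in> carrier A \<Longrightarrow> b \<in> B \<Longrightarrow> \<phi> (b \<otimes>\<^bsub>A\<^esub> a) = b \<otimes>\<^bsub>A\<^esub> \<phi> a"
    and r: "\<And>a b. Suc j < n \<Longrightarrow> a \<in> carrier A \<Longrightarrow> b \<in> B \<Longrightarrow> \<phi> (a \<otimes>\<^bsub>A\<^esub> b) = \<phi> a \<otimes>\<^bsub>A\<^esub> b"
  shows "multiadd A B n (tensor_power A B n) (\<lambda>xs. pg n (xs[j := \<phi> (xs ! j)]))"
proof (rule multiaddI)
  fix xs i assume xs: "xs \<in> power_gens A n"
  note mp = multiaddD[OF multiadd_pg]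
  have len: "length xs = n" using xs by (rule power_gens_length)
  have xj: "xs ! j \<in> carrier A" using xs j by (rule power_gens_nth)
  have \<phi>xj: "\<phi> (xs ! j) \<in> carrier A" using ahom_closed[OF \<phi> xj] .
  have ys: "xs[j := \<phi> (xs ! j)] \<in> power_gens A n" using xs \<phi>xj by (rule power_gens_update)
  show "pg n (xs[j := \<phi> (xs ! j)]) \<in> carrier (tensor_power A B n)" using ys by (rule pg_closed)
  show "pg n (xs[i := a \<oplus>\<^bsub>A\<^esub> a', j := \<phi> (xs[i := a \<oplus>\<^bsub>A\<^esub> a'] ! j)]) =
      pg n (xs[i := a, j := \<phi> (xs[i := a] ! j)]) \<oplus>\<^bsub>tensor_power A B n\<^esub>
      pg n (xs[i := a', j := \<phi> (xs[i := a'] ! j)])"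
    if "i < n" "a \<in> carrier A" "a' \<in> carrier A" for a a'
    using that xs len ys
    by (cases "i = j") (simp_all add: mp ahom_add[OF \<phi>] ahom_closed[OF \<phi>] list_update_swap[of i j] \<phi>xj)
  show "pg n (xs[i := xs ! i \<otimes>\<^bsub>A\<^esub> b, j := \<phi> (xs[i := xs ! i \<otimes>\<^bsub>A\<^esub> b] ! j)]) =
      pg n (xs[Suc i := b \<otimes>\<^bsub>A\<^esub> xs ! Suc i, j := \<phi> (xs[Suc i := b \<otimes>\<^bsub>A\<^esub> xs ! Suc i] ! j)])"
    if i: "Suc i < n" and b: "b \<in> B" for b
  proof -
    have swap: "xs[k := u, j := v] = xs[j := v, k := u]" if "k \<noteq> j" for k u v
      using that by (rule list_update_swap)
    consider "i = j" | "Suc i = j" | "i \<noteq> j" "Suc i \<noteq> j" by blast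
    then show ?thesis
    proof cases
      case 1
      then show ?thesis using mp(3)[OF ys i b] r[OF _ xj b] i j len by (simp add: swap)
    next
      case 2
      then have "i \<noteq> j" by simp
      from swap[OF this] 2 show ?thesis using mp(3)[OF ys i b] l[OF _ xj b] j len by simp
    next
      case 3
      then show ?thesis using mp(3)[OF ys i b] len by (simp add: swap)
    qed
  qed
qed

lemma multiadd_lact:
  "s \<in> S \<Longrightarrow> n > 0 \<Longrightarrow> multiadd A B n (tensor_power A B n) (\<lambda>xs. pg n (xs[0 := s \<otimes>\<^bsub>A\<^esub> xs ! 0]))"
  by (rule multiadd_update[OF lmult_ahom]) (simp_all add: assoc)

lemma multiadd_ract:
  "s \<in> S \<Longrightarrow> n > 0 \<Longrightarrow> multiadd A B n (tensor_power A B n) (\<lambda>xs. pg n (xs[n - 1 := xs ! (n - 1) \<otimes>\<^bsub>A\<^esub> s]))"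
  by (rule multiadd_update[OF rmult_ahom]) (simp_all add: assoc)

lemma lact_power_eq: "lact (tensor_power A B n) s =
   pres_lift (power_gens A n) (power_rels A B n) (power_group A B n)
        (\<lambda>xs. pg n (xs[0 := s \<otimes>\<^bsub>A\<^esub> xs ! 0]))"
  and ract_power_eq: "(\<lambda>v. ract (tensor_power A B n) v s) =
   pres_lift (power_gens A n) (power_rels A B n) (power_group A B n)
        (\<lambda>xs. pg n (xs[n - 1 := xs ! (n - 1) \<otimes>\<^bsub>A\<^esub> s]))"
  by (simp_all add: tensor_power_def)

lemma power_group_eqs:
  "carrier (power_group A B n) = carrier (tensor_power A B n)"
  "mult (power_group A B n) = add (tensor_power A B n)"
  "one (power_group A B n) = zero (tensor_power A B n)"
  by (simp_all add: tensor_power_def)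

lemma lact_ahom: "s \<in> S \<Longrightarrow> n > 0 \<Longrightarrow>
    lact (tensor_power A B n) s \<in> ahom (tensor_power A B n) (tensor_power A B n)"
  and lact_pg: "s \<in> S \<Longrightarrow> n > 0 \<Longrightarrow> xs \<in> power_gens A n \<Longrightarrow>
    lact (tensor_power A B n) s (pg n xs) = pg n (xs[0 := s \<otimes>\<^bsub>A\<^esub> xs ! 0])"
  unfolding lact_power_eq
  by (simp_all only: pres_lift_multiadd[OF abelian_power multiadd_lact power_group_eqs])

lemma ract_ahom: "s \<in> S \<Longrightarrow> n > 0 \<Longrightarrow>
    (\<lambda>v. ract (tensor_power A B n) v s) \<in> ahom (tensor_power A B n) (tensor_power A B n)"
  and ract_pg: "s \<in> S \<Longrightarrow> n > 0 \<Longrightarrow> xs \<in> power_gens A n \<Longrightarrow>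
    ract (tensor_power A B n) (pg n xs) s = pg n (xs[n - 1 := xs ! (n - 1) \<otimes>\<^bsub>A\<^esub> s])"
  using pres_lift_multiadd[OF abelian_power multiadd_ract power_group_eqs]
  unfolding ract_power_eq ract_power_eq[THEN fun_cong] by auto

end


section \<open>Similarity in terms of bimodule homomorphisms\<close>

definition bimod :: "'c set \<Rightarrow> ('m, 'x) ring_scheme \<Rightarrow> ('c \<Rightarrow> 'm \<Rightarrow> 'm) \<Rightarrow> ('c \<Rightarrow> 'm \<Rightarrow> 'm) \<Rightarrow> bool" where
  "bimod C V l r \<longleftrightarrow> abelian_group V \<and> (\<forall>c\<in>C. l c \<in> ahom V V \<and> r c \<in> ahom V V)"

definition bhom ::
  "'c set \<Rightarrow> ('m, 'x) ring_scheme \<Rightarrow> ('c \<Rightarrow> 'm \<Rightarrow> 'm) \<Rightarrow> ('c \<Rightarrow> 'm \<Rightarrow> 'm) \<Rightarrow>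
    ('n, 'y) ring_scheme \<Rightarrow> ('c \<Rightarrow> 'n \<Rightarrow> 'n) \<Rightarrow> ('c \<Rightarrow> 'n \<Rightarrow> 'n) \<Rightarrow> ('m \<Rightarrow> 'n) set" where
  "bhom C V l r W l' r' =
     {f \<in> ahom V W. \<forall>c\<in>C. \<forall>v\<in>carrier V. f (l c v) = l' c (f v) \<and> f (r c v) = r' c (f v)}"

text \<open>\<open>V\<close> is a direct summand of \<open>W\<^sup>p\<close> iff the identity of \<open>V\<close> is a sum of \<open>p\<close> composites \<open>V \<rightarrow> W \<rightarrow> V\<close>. Unlike
  direct summands, such a family can be transposed. It is nonempty since \<open>p\<close> is positive.\<close>

definition retracts ::
  "'c set \<Rightarrow> ('m, 'x) ring_scheme \<Rightarrow> ('c \<Rightarrow> 'm \<Rightarrow> 'm) \<Rightarrow> ('c \<Rightarrow> 'm \<Rightarrow> 'm) \<Rightarrow>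
    ('n, 'y) ring_scheme \<Rightarrow> ('c \<Rightarrow> 'n \<Rightarrow> 'n) \<Rightarrow> ('c \<Rightarrow> 'n \<Rightarrow> 'n) \<Rightarrow> bool" where
  "retracts C V l r W l' r' \<longleftrightarrow>
     (\<exists>fs. fs \<noteq> [] \<and> (\<forall>(f, g)\<in>set fs. f \<in> bhom C V l r W l' r' \<and> g \<in> bhom C W l' r' V l r) \<and>
        (\<forall>v\<in>carrier V. lsum V (\<lambda>(f, g). g (f v)) fs = v))"

lemma bhomD:
  assumes "f \<in> bhom C V l r W l' r'"
  shows "f \<in> ahom V W" "v \<in> carrier V \<Longrightarrow> f v \<in> carrier W"
    and "c \<in> C \<Longrightarrow> v \<in> carrier V \<Longrightarrow> f (l c v) = l' c (f v)"
    and "c \<in> C \<Longrightarrow> v \<in> carrier V \<Longrightarrow> f (r c v) = r' c (f v)"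
  using assms by (auto simp: bhom_def ahom_closed)

lemma bhomI:
  assumes "f \<in> ahom V W"
    and "\<And>c v. c \<in> C \<Longrightarrow> v \<in> carrier V \<Longrightarrow> f (l c v) = l' c (f v)"
    and "\<And>c v. c \<in> C \<Longrightarrow> v \<in> carrier V \<Longrightarrow> f (r c v) = r' c (f v)"
  shows "f \<in> bhom C V l r W l' r'"
  using assms by (auto simp: bhom_def)

lemma bimodD:
  assumes "bimod C V l r"
  shows "abelian_group V" "c \<in> C \<Longrightarrow> l c \<in> ahom V V" "c \<in> C \<Longrightarrow> r c \<in> ahom V V"
    "c \<in> C \<Longrightarrow> v \<in> carrier V \<Longrightarrow> l c v \<in> carrier V" "c \<in> C \<Longrightarrow> v \<in> carrier V \<Longrightarrow> r c v \<in> carrier V"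
  using assms by (auto simp: bimod_def ahom_closed)

lemma bhom_comp:
  assumes "f \<in> bhom C V l r W l' r'" "g \<in> bhom C W l' r' U l'' r''"
  shows "(\<lambda>v. g (f v)) \<in> bhom C V l r U l'' r''"
  using assms by (auto simp: bhom_def ahom_closed intro: ahom_comp)

lemma retracts_flip: "retracts C V r l W r' l' \<longleftrightarrow> retracts C V l r W l' r'"
proof -
  have "bhom C V r l W r' l' = bhom C V l r W l' r'" "bhom C W r' l' V r l = bhom C W l' r' V l r"
    by (auto simp: bhom_def)
  then show ?thesis by (simp add: retracts_def)
qed

lemma retracts_reindex:
  "retracts (e ` C) V l r W l' r' \<longleftrightarrow>
   retracts C V (\<lambda>c. l (e c)) (\<lambda>c. r (e c)) W (\<lambda>c. l' (e c)) (\<lambda>c. r' (e c))"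
  by (simp add: retracts_def bhom_def)

text \<open>The same notions for the records of type \<open>bimodule\<close>, whose right action takes the scalar
  last.\<close>

abbreviation (input) "rbimod S V \<equiv> bimod S V (lact V) (\<lambda>s v. ract V v s)"
abbreviation (input) "rhom S V W \<equiv> bhom S V (lact V) (\<lambda>s v. ract V v s) W (lact W) (\<lambda>s v. ract W v s)"
abbreviation (input) "rretracts S V W \<equiv>
  retracts S V (lact V) (\<lambda>s v. ract V v s) W (lact W) (\<lambda>s v. ract W v s)"

lemma carrier_bimodule_power: "carrier (bimodule_power p W) = {..<p} \<rightarrow>\<^sub>E carrier W"
  and add_bimodule_power: "add (bimodule_power p W) v w = (\<lambda>i\<in>{..<p}. v i \<oplus>\<^bsub>W\<^esub> w i)"
  and zero_bimodule_power: "zero (bimodule_power p W) = (\<lambda>i\<in>{..<p}. \<zero>\<^bsub>W\<^esub>)"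
  and lact_bimodule_power: "lact (bimodule_power p W) s v = (\<lambda>i\<in>{..<p}. lact W s (v i))"
  and ract_bimodule_power: "ract (bimodule_power p W) v s = (\<lambda>i\<in>{..<p}. ract W (v i) s)"
  by (simp_all add: bimodule_power_def)

lemmas bimodule_power_simps = carrier_bimodule_power add_bimodule_power zero_bimodule_power
  lact_bimodule_power ract_bimodule_power

lemma bimod_bimodule_power:
  assumes "rbimod S W"
  shows "rbimod S (bimodule_power p W)"
proof -
  interpret W: abelian_group W by (rule bimodD[OF assms])
  have "abelian_group (bimodule_power p W)"
  proof (rule abelian_groupI)
    fix x assume x: "x \<in> carrier (bimodule_power p W)"
    show "\<exists>y\<in>carrier (bimodule_power p W). y \<oplus>\<^bsub>bimodule_power p W\<^esub> x = \<zero>\<^bsub>bimodule_power p W\<^esub>"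
      by (rule bexI[of _ "\<lambda>i\<in>{..<p}. \<ominus>\<^bsub>W\<^esub> x i"])
        (use x in \<open>auto simp: bimodule_power_simps W.l_neg PiE_def Pi_def intro!: restrict_ext\<close>)
    show "\<zero>\<^bsub>bimodule_power p W\<^esub> \<oplus>\<^bsub>bimodule_power p W\<^esub> x = x"
      using x by (auto simp: bimodule_power_simps PiE_def Pi_def extensional_def)
  qed (auto simp: bimodule_power_simps PiE_def Pi_def W.a_ac intro!: restrict_ext)
  moreover have "lact (bimodule_power p W) s \<in> ahom (bimodule_power p W) (bimodule_power p W)"
    "(\<lambda>v. ract (bimodule_power p W) v s) \<in> ahom (bimodule_power p W) (bimodule_power p W)" if "s \<in> S" for s
    using that bimodD(2,3)[OF assms that]
    by (auto simp: ahom_def bimodule_power_simps PiE_def Pi_def intro!: restrict_ext)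
  ultimately show ?thesis by (simp add: bimod_def)
qed

text \<open>The maps \<open>V \<rightarrow> W\<close> are the coordinates of the embedding \<open>f\<close>; the maps \<open>W \<rightarrow> V\<close> are the \<open>p\<close> inclusions
  of \<open>W\<close> into \<open>W\<^sup>p\<close>, followed by the projection \<open>\<pi>\<close> along the complement and the inverse of \<open>f\<close>.\<close>

lemma divides_power_imp_retracts:
  assumes V: "rbimod S V" and W: "rbimod S W"
    and dp: "divides_power S V W"
  shows "rretracts S V W"
proof -
  interpret V: abelian_group V by (rule bimodD[OF V])
  interpret W: abelian_group W by (rule bimodD[OF W])
  obtain p N f N' where p: "p > 0" and N: "subbimodule S N (bimodule_power p W)"
    and f: "f \<in> bimodule_iso S V ((bimodule_power p W)\<lparr>carrier := N\<rparr>)"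
    and N': "subbimodule S N' (bimodule_power p W)"
    and NN: "N \<inter> N' = {\<zero>\<^bsub>bimodule_power p W\<^esub>}"
    and sum: "N <+>\<^bsub>bimodule_power p W\<^esub> N' = carrier (bimodule_power p W)"
    using dp unfolding divides_power_def direct_summand_def by blast
  let ?P = "bimodule_power p W"
  note P = bimod_bimodule_power[OF W, of p]
  interpret P: abelian_group ?P by (rule bimodD[OF P])
  have sgN: "subgroup N (add_monoid ?P)" and sgN': "subgroup N' (add_monoid ?P)"
    and actN: "\<And>s v. s \<in> S \<Longrightarrow> v \<in> N \<Longrightarrow> lact ?P s v \<in> N \<and> ract ?P v s \<in> N"
    and actN': "\<And>s v. s \<in> S \<Longrightarrow> v \<in> N' \<Longrightarrow> lact ?P s v \<in> N' \<and> ract ?P v s \<in> N'"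
    using N N' by (auto simp: subbimodule_def)
  note N_cl = subgroup.m_closed[OF sgN, simplified] subgroup.subset[OF sgN, simplified]
  note N'_cl = subgroup.m_closed[OF sgN', simplified] subgroup.subset[OF sgN', simplified]
  have N_neg: "\<ominus>\<^bsub>?P\<^esub> v \<in> N" if "v \<in> N" for v
    using subgroup.m_inv_closed[OF sgN that] by (simp add: a_inv_def)
  have N'_neg: "\<ominus>\<^bsub>?P\<^esub> v \<in> N'" if "v \<in> N'" for v
    using subgroup.m_inv_closed[OF sgN' that] by (simp add: a_inv_def)
  have "\<exists>n\<in>N. \<exists>n'\<in>N'. w = n \<oplus>\<^bsub>?P\<^esub> n'" if "w \<in> carrier ?P" for w
    using that unfolding sum[symmetric] set_add_def' by blast
  then obtain \<pi> \<pi>' where \<pi>: "\<And>w. w \<in> carrier ?P \<Longrightarrow> \<pi> w \<in> N" "\<And>w. w \<in> carrier ?P \<Longrightarrow> \<pi>' w \<in> N'"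
      "\<And>w. w \<in> carrier ?P \<Longrightarrow> w = \<pi> w \<oplus>\<^bsub>?P\<^esub> \<pi>' w" by metis
  \<comment> \<open>Uniqueness of the decomposition makes \<open>\<pi>\<close> a bimodule homomorphism.\<close>
  have uniq: "\<pi> w = n" if w: "w \<in> carrier ?P" and "n \<in> N" "n' \<in> N'" "w = n \<oplus>\<^bsub>?P\<^esub> n'" for w n n'
  proof -
    have c: "\<pi> w \<in> carrier ?P" "n \<in> carrier ?P" "\<pi>' w \<in> carrier ?P" "n' \<in> carrier ?P"
      using \<pi>(1,2)[OF w] that N_cl(2) N'_cl(2) by auto
    have "\<pi> w \<oplus>\<^bsub>?P\<^esub> \<ominus>\<^bsub>?P\<^esub> n = (\<pi> w \<oplus>\<^bsub>?P\<^esub> \<pi>' w) \<oplus>\<^bsub>?P\<^esub> (\<ominus>\<^bsub>?P\<^esub> \<pi>' w \<oplus>\<^bsub>?P\<^esub> \<ominus>\<^bsub>?P\<^esub> n)"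
      using c by (simp add: P.a_assoc P.r_neg2)
    also have "\<dots> = (n' \<oplus>\<^bsub>?P\<^esub> n) \<oplus>\<^bsub>?P\<^esub> (\<ominus>\<^bsub>?P\<^esub> n \<oplus>\<^bsub>?P\<^esub> \<ominus>\<^bsub>?P\<^esub> \<pi>' w)"
      using c \<pi>(3)[OF w] that(4) by (metis P.a_comm P.a_inv_closed)
    also have "\<dots> = n' \<oplus>\<^bsub>?P\<^esub> \<ominus>\<^bsub>?P\<^esub> \<pi>' w"
      using c by (simp add: P.a_assoc P.r_neg2)
    finally have eq: "\<pi> w \<oplus>\<^bsub>?P\<^esub> \<ominus>\<^bsub>?P\<^esub> n = n' \<oplus>\<^bsub>?P\<^esub> \<ominus>\<^bsub>?P\<^esub> \<pi>' w" .
    have "\<pi> w \<oplus>\<^bsub>?P\<^esub> \<ominus>\<^bsub>?P\<^esub> n \<in> N" "n' \<oplus>\<^bsub>?P\<^esub> \<ominus>\<^bsub>?P\<^esub> \<pi>' w \<in> N'"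
      using \<pi>(1,2)[OF w] that N_neg N'_neg N_cl(1) N'_cl(1) by auto
    then have "\<pi> w \<oplus>\<^bsub>?P\<^esub> \<ominus>\<^bsub>?P\<^esub> n = \<zero>\<^bsub>?P\<^esub>" using NN eq by auto
    then show ?thesis using c P.minus_eq_zero_iff[of "\<pi> w" n] by (simp add: a_minus_def)
  qed
  have \<pi>_add: "\<pi> (v \<oplus>\<^bsub>?P\<^esub> w) = \<pi> v \<oplus>\<^bsub>?P\<^esub> \<pi> w" if vw: "v \<in> carrier ?P" "w \<in> carrier ?P" for v w
  proof (rule uniq)
    have c: "\<pi> w \<in> carrier ?P" "\<pi>' w \<in> carrier ?P" "\<pi> v \<in> carrier ?P" "\<pi>' v \<in> carrier ?P"
      using \<pi>(1,2) that N_cl(2) N'_cl(2) by auto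
    have "v \<oplus>\<^bsub>?P\<^esub> w = (\<pi> v \<oplus>\<^bsub>?P\<^esub> \<pi>' v) \<oplus>\<^bsub>?P\<^esub> (\<pi> w \<oplus>\<^bsub>?P\<^esub> \<pi>' w)" using \<pi>(3) vw by metis
    also have "\<dots> = (\<pi> v \<oplus>\<^bsub>?P\<^esub> \<pi> w) \<oplus>\<^bsub>?P\<^esub> (\<pi>' v \<oplus>\<^bsub>?P\<^esub> \<pi>' w)" using c by (simp add: P.a_ac)
    finally show "v \<oplus>\<^bsub>?P\<^esub> w = (\<pi> v \<oplus>\<^bsub>?P\<^esub> \<pi> w) \<oplus>\<^bsub>?P\<^esub> (\<pi>' v \<oplus>\<^bsub>?P\<^esub> \<pi>' w)" .
  qed (use vw \<pi> N_cl(1) N'_cl(1) in auto)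
  have \<pi>_act: "\<pi> (lact ?P s w) = lact ?P s (\<pi> w)" "\<pi> (ract ?P w s) = ract ?P (\<pi> w) s"
    if s: "s \<in> S" and w: "w \<in> carrier ?P" for s w
  proof -
    have c: "\<pi> w \<in> carrier ?P" "\<pi>' w \<in> carrier ?P" using \<pi>(1,2)[OF w] N_cl(2) N'_cl(2) by auto
    show "\<pi> (lact ?P s w) = lact ?P s (\<pi> w)"
    proof (rule uniq)
      show "lact ?P s w = lact ?P s (\<pi> w) \<oplus>\<^bsub>?P\<^esub> lact ?P s (\<pi>' w)"
        using \<pi>(3)[OF w] ahom_add[OF bimodD(2)[OF P s] c] by simp
    qed (use actN[OF s] actN'[OF s] \<pi>(1,2)[OF w] bimodD(4)[OF P s w] in auto)
    show "\<pi> (ract ?P w s) = ract ?P (\<pi> w) s"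
    proof (rule uniq)
      show "ract ?P w s = ract ?P (\<pi> w) s \<oplus>\<^bsub>?P\<^esub> ract ?P (\<pi>' w) s"
        using \<pi>(3)[OF w] ahom_add[OF bimodD(3)[OF P s] c] by simp
    qed (use actN[OF s] actN'[OF s] \<pi>(1,2)[OF w] bimodD(5)[OF P s w] in auto)
  qed
  have \<pi>_N: "\<pi> w = w" if "w \<in> N" for w
  proof (rule uniq)
    show "\<zero>\<^bsub>?P\<^esub> \<in> N'" using NN by auto
  qed (use that N_cl(2) in auto)
  have f_bij: "bij_betw f (carrier V) N" and f_hom: "f \<in> ahom V ?P"
    and f_act: "\<And>s v. s \<in> S \<Longrightarrow> v \<in> carrier V \<Longrightarrow> f (lact V s v) = lact ?P s (f v)"
      "\<And>s v. s \<in> S \<Longrightarrow> v \<in> carrier V \<Longrightarrow> f (ract V v s) = ract ?P (f v) s"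
    using f N_cl(2) by (auto simp: bimodule_iso_def iso_def hom_def ahom_def bimodule_power_def Pi_def)
  define k where "k = inv_into (carrier V) f"
  have k: "\<And>v. v \<in> carrier V \<Longrightarrow> k (f v) = v" "\<And>w. w \<in> N \<Longrightarrow> k w \<in> carrier V" "\<And>w. w \<in> N \<Longrightarrow> f (k w) = w"
    using f_bij unfolding k_def bij_betw_def by (auto simp: inv_into_into f_inv_into_f)
  have k_add: "k (v \<oplus>\<^bsub>?P\<^esub> w) = k v \<oplus>\<^bsub>V\<^esub> k w" if "v \<in> N" "w \<in> N" for v w
  proof -
    have "f (k v \<oplus>\<^bsub>V\<^esub> k w) = v \<oplus>\<^bsub>?P\<^esub> w" using k that by (simp add: ahom_add[OF f_hom])
    then show ?thesis using k(1)[of "k v \<oplus>\<^bsub>V\<^esub> k w"] k(2)[OF that(1)] k(2)[OF that(2)] by simp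
  qed
  have k_act: "k (lact ?P s w) = lact V s (k w)" "k (ract ?P w s) = ract V (k w) s"
    if "s \<in> S" "w \<in> N" for s w
    using k(2)[OF that(2)] k(3)[OF that(2)] k(1) f_act[OF that(1)] bimodD(4,5)[OF V that(1)] by metis+
  define single where "single i x = (\<lambda>j\<in>{..<p}. if j = i then x else \<zero>\<^bsub>W\<^esub>)" for i x
  have single_closed: "single i x \<in> carrier ?P" if "x \<in> carrier W" for i x
    using that by (auto simp: single_def bimodule_power_simps)
  have single_add: "single i (x \<oplus>\<^bsub>W\<^esub> y) = single i x \<oplus>\<^bsub>?P\<^esub> single i y"
    if "x \<in> carrier W" "y \<in> carrier W" for i x y
    using that by (auto simp: single_def bimodule_power_simps intro!: restrict_ext)
  have act0: "lact W s \<zero>\<^bsub>W\<^esub> = \<zero>\<^bsub>W\<^esub>" "ract W \<zero>\<^bsub>W\<^esub> s = \<zero>\<^bsub>W\<^esub>" if "s \<in> S" for s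
    using ahom_zero[OF W.abelian_group_axioms W.abelian_group_axioms bimodD(2)[OF W that]]
      ahom_zero[OF W.abelian_group_axioms W.abelian_group_axioms bimodD(3)[OF W that]] by auto
  have single_act: "single i (lact W s x) = lact ?P s (single i x)"
    "single i (ract W x s) = ract ?P (single i x) s" if "s \<in> S" for i s x
    using that act0 by (auto simp: single_def bimodule_power_simps intro!: restrict_ext)
  define fs where "fs = map (\<lambda>i. (\<lambda>v. f v i, \<lambda>x. k (\<pi> (single i x)))) [0..<p]"
  have sum_single: "lsum ?P (\<lambda>i. single i (w i)) [0..<q] = (\<lambda>j\<in>{..<p}. if j < q then w j else \<zero>\<^bsub>W\<^esub>)"
    if w: "w \<in> carrier ?P" and "q \<le> p" for w q
    using that(2)
  proof (induction q)
    case 0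
    then show ?case by (simp add: zero_bimodule_power)
  next
    case (Suc q)
    have wc: "w i \<in> carrier W" if "i < p" for i using w that by (auto simp: carrier_bimodule_power)
    have sq: "single q (w q) \<in> carrier ?P" using Suc.prems by (intro single_closed wc) auto
    have "lsum ?P (\<lambda>i. single i (w i)) ([0..<q] @ [q]) =
        lsum ?P (\<lambda>i. single i (w i)) [0..<q] \<oplus>\<^bsub>?P\<^esub> single q (w q)"
      using Suc.prems by (subst P.lsum_append) (auto intro!: single_closed wc simp: sq)
    then show ?case using Suc wc
      by (auto simp: single_closed add_bimodule_power, auto simp: single_def intro!: restrict_ext)
  qed
  have "f' \<in> rhom S V W \<and>
      g' \<in> rhom S W V" if fg: "(f', g') \<in> set fs" for f' g'
  proof -
    obtain i where i: "i < p" "f' = (\<lambda>v. f v i)" "g' = (\<lambda>x. k (\<pi> (single i x)))"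
      using fg by (auto simp: fs_def)
    have fc: "f v \<in> carrier ?P" if "v \<in> carrier V" for v using f_hom that by (rule ahom_closed)
    have "f' \<in> rhom S V W"
      unfolding i(2)
      using i(1) fc by (intro bhomI ahomI)
        (simp_all add: f_act ahom_add[OF f_hom] bimodule_power_simps PiE_def Pi_def)
    moreover have "g' \<in> rhom S W V"
      unfolding i(3)
      by (intro bhomI ahomI)
        (simp_all add: single_closed single_add single_act \<pi> \<pi>_add \<pi>_act k k_add k_act)
    ultimately show ?thesis by blast
  qed
  moreover have "lsum V (\<lambda>(f, g). g (f v)) fs = v" if v: "v \<in> carrier V" for v
  proof -
    have fv: "f v \<in> carrier ?P" using f_hom v by (rule ahom_closed)
    have k\<pi>: "(\<lambda>w. k (\<pi> w)) \<in> ahom ?P V" by (rule ahomI) (simp_all add: \<pi> \<pi>_add k k_add)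
    have "lsum V (\<lambda>(f, g). g (f v)) fs = lsum V (\<lambda>i. k (\<pi> (single i (f v i)))) [0..<p]"
      by (simp add: fs_def lsum_map)
    also have "\<dots> = k (\<pi> (lsum ?P (\<lambda>i. single i (f v i)) [0..<p]))"
      by (rule ahom_lsum[OF P.abelian_group_axioms V.abelian_group_axioms k\<pi>, symmetric,
            where f = "\<lambda>i. single i (f v i)" and xs = "[0..<p]"])
        (rule single_closed, use fv in \<open>auto simp: carrier_bimodule_power\<close>)
    also have "lsum ?P (\<lambda>i. single i (f v i)) [0..<p] = f v"
      using fv by (subst sum_single) (auto simp: carrier_bimodule_power PiE_def extensional_def)
    also have "k (\<pi> (f v)) = v"
      using v f_bij by (simp add: \<pi>_N k bij_betw_apply)
    finally show ?thesis .
  qed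
  moreover have "fs \<noteq> []" using p by (simp add: fs_def)
  ultimately show ?thesis unfolding retracts_def by (intro exI[of _ fs]) auto
qed

text \<open>The image of \<open>F = (f\<^sub>1, \<dots>, f\<^sub>p)\<close> is complemented by the kernel of \<open>Gm = g\<^sub>1 + \<dots> + g\<^sub>p\<close>, because
  \<open>Gm\<close> is a left inverse of \<open>F\<close>.\<close>

lemma retracts_imp_divides_power:
  assumes V: "rbimod S V" and W: "rbimod S W"
    and re: "rretracts S V W"
  shows "divides_power S V W"
proof -
  interpret V: abelian_group V by (rule bimodD[OF V])
  interpret W: abelian_group W by (rule bimodD[OF W])
  obtain fs where fs: "fs \<noteq> []" "\<And>i. i < length fs \<Longrightarrow>
        fst (fs ! i) \<in> rhom S V W \<and>
        snd (fs ! i) \<in> rhom S W V"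
      "\<And>v. v \<in> carrier V \<Longrightarrow> lsum V (\<lambda>(f, g). g (f v)) fs = v"
  proof -
    obtain fs where fs: "fs \<noteq> []"
        "\<And>x. x \<in> set fs \<Longrightarrow> fst x \<in> rhom S V W \<and>
          snd x \<in> rhom S W V"
        "\<And>v. v \<in> carrier V \<Longrightarrow> lsum V (\<lambda>(f, g). g (f v)) fs = v"
      using re unfolding retracts_def by (auto simp: case_prod_beta)
    show thesis by (rule that[OF fs(1) _ fs(3)]) (use fs(2) in auto)
  qed
  define p where "p = length fs"
  let ?P = "bimodule_power p W"
  note P = bimod_bimodule_power[OF W, of p]
  interpret P: abelian_group ?P by (rule bimodD[OF P])
  define F where "F v = (\<lambda>i\<in>{..<p}. fst (fs ! i) v)" for v
  define Gm where "Gm w = lsum V (\<lambda>i. snd (fs ! i) (w i)) [0..<p]" for w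
  have F: "F \<in> rhom S V ?P"
    using bhomD[OF conjunct1[OF fs(2)]]
    by (intro bhomI ahomI)
      (auto simp: F_def bimodule_power_simps p_def ahom_add[OF bhomD(1)[OF conjunct1[OF fs(2)]]]
        intro!: restrict_ext)
  have proj: "(\<lambda>w. w i) \<in> rhom S ?P W" if "i < p" for i
    using that by (intro bhomI ahomI) (auto simp: bimodule_power_simps)
  have gi: "(\<lambda>w. snd (fs ! i) (w i)) \<in> rhom S ?P V"
    if "i < p" for i
    using bhom_comp[OF proj[OF that] conjunct2[OF fs(2)]] that by (simp add: p_def)
  have G: "Gm \<in> rhom S ?P V"
    unfolding Gm_def
  proof (rule bhomI)
    show "(\<lambda>w. lsum V (\<lambda>i. snd (fs ! i) (w i)) [0..<p]) \<in> ahom ?P V"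
      by (rule ahom_lsum_fun[OF V.abelian_group_axioms]) (use bhomD(1)[OF gi] in auto)
  next
    fix s w assume s: "s \<in> S" and w: "w \<in> carrier ?P"
    have c: "\<And>i. i \<in> set [0..<p] \<Longrightarrow> snd (fs ! i) (w i) \<in> carrier V"
      using bhomD(2)[OF gi w] by auto
    show "lsum V (\<lambda>i. snd (fs ! i) (lact ?P s w i)) [0..<p] = lact V s (lsum V (\<lambda>i. snd (fs ! i) (w i)) [0..<p])"
      using bhomD(3)[OF gi s w]
      by (subst ahom_lsum[OF V.abelian_group_axioms V.abelian_group_axioms bimodD(2)[OF V s] c])
        (auto intro!: lsum_cong)
    show "lsum V (\<lambda>i. snd (fs ! i) (ract ?P w s i)) [0..<p] = ract V (lsum V (\<lambda>i. snd (fs ! i) (w i)) [0..<p]) s"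
      using bhomD(4)[OF gi s w]
      by (subst ahom_lsum[OF V.abelian_group_axioms V.abelian_group_axioms bimodD(3)[OF V s] c])
        (auto intro!: lsum_cong)
  qed
  have GF: "Gm (F v) = v" if v: "v \<in> carrier V" for v
  proof -
    have "Gm (F v) = lsum V (\<lambda>(f, g). g (f v)) (map ((!) fs) [0..<p])"
      unfolding Gm_def lsum_map by (rule lsum_cong) (auto simp: F_def case_prod_beta)
    then show ?thesis using fs(3)[OF v] by (simp add: p_def map_nth)
  qed
  let ?N = "F ` carrier V" and ?N' = "{w \<in> carrier ?P. Gm w = \<zero>\<^bsub>V\<^esub>}"
  note Fa = bhomD(1)[OF F] and Ga = bhomD(1)[OF G]
  note Fc = bhomD(2)[OF F] and Gc = bhomD(2)[OF G]
  have F0: "F \<zero>\<^bsub>V\<^esub> = \<zero>\<^bsub>?P\<^esub>" by (rule ahom_zero[OF V.abelian_group_axioms P.abelian_group_axioms Fa])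
  have G0: "Gm \<zero>\<^bsub>?P\<^esub> = \<zero>\<^bsub>V\<^esub>" by (rule ahom_zero[OF P.abelian_group_axioms V.abelian_group_axioms Ga])
  note Fm = ahom_minus[OF V.abelian_group_axioms P.abelian_group_axioms Fa]
  note Gmi = ahom_minus[OF P.abelian_group_axioms V.abelian_group_axioms Ga]
  have zN: "\<zero>\<^bsub>?P\<^esub> \<in> ?N" by (rule image_eqI[of _ _ "\<zero>\<^bsub>V\<^esub>"]) (simp_all add: F0)
  have "subgroup ?N (add_monoid ?P)"
  proof
    fix x y assume xy: "x \<in> ?N" "y \<in> ?N"
    show "x \<otimes>\<^bsub>add_monoid ?P\<^esub> y \<in> ?N"
      using xy by (auto simp: ahom_add[OF Fa, symmetric])
    show "inv\<^bsub>add_monoid ?P\<^esub> x \<in> ?N"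
      using xy by (auto simp: a_inv_def[symmetric] Fm[symmetric])
  qed (use Fc zN in auto)
  then have subN: "subbimodule S ?N ?P"
    using bhomD(3,4)[OF F, symmetric] bimodD(4,5)[OF V] by (auto simp: subbimodule_def)
  have "subgroup ?N' (add_monoid ?P)"
  proof
    fix x y assume xy: "x \<in> ?N'" "y \<in> ?N'"
    show "x \<otimes>\<^bsub>add_monoid ?P\<^esub> y \<in> ?N'"
      using xy by (simp add: ahom_add[OF Ga])
    show "inv\<^bsub>add_monoid ?P\<^esub> x \<in> ?N'"
      using xy by (simp add: a_inv_def[symmetric] Gmi)
  qed (auto simp: G0)
  moreover have "lact V s \<zero>\<^bsub>V\<^esub> = \<zero>\<^bsub>V\<^esub>" "ract V \<zero>\<^bsub>V\<^esub> s = \<zero>\<^bsub>V\<^esub>" if "s \<in> S" for s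
    using ahom_zero[OF V.abelian_group_axioms V.abelian_group_axioms bimodD(2)[OF V that]]
      ahom_zero[OF V.abelian_group_axioms V.abelian_group_axioms bimodD(3)[OF V that]] by auto
  ultimately have subN': "subbimodule S ?N' ?P"
    using bhomD(3,4)[OF G] bimodD(4,5)[OF P] by (auto simp: subbimodule_def)
  have int: "?N \<inter> ?N' = {\<zero>\<^bsub>?P\<^esub>}"
    using zN G0 by (auto simp: GF F0)
  have sum: "?N <+>\<^bsub>?P\<^esub> ?N' = carrier ?P"
  proof
    show "?N <+>\<^bsub>?P\<^esub> ?N' \<subseteq> carrier ?P" using Fc by (auto simp: set_add_def')
    show "carrier ?P \<subseteq> ?N <+>\<^bsub>?P\<^esub> ?N'"
    proof
      fix w assume w: "w \<in> carrier ?P"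
      let ?n' = "w \<oplus>\<^bsub>?P\<^esub> \<ominus>\<^bsub>?P\<^esub> F (Gm w)"
      have "?n' \<in> ?N'" using w Fc Gc by (simp add: ahom_add[OF Ga] Gmi GF V.r_neg)
      moreover have "w = F (Gm w) \<oplus>\<^bsub>?P\<^esub> ?n'"
        using w Fc Gc by (simp add: P.a_lcomm[of "F (Gm w)" w] P.r_neg)
      moreover have "F (Gm w) \<in> ?N" using w Gc by auto
      ultimately show "w \<in> ?N <+>\<^bsub>?P\<^esub> ?N'" unfolding set_add_def' by blast
    qed
  qed
  have "inj_on F (carrier V)" using GF by (metis inj_onI)
  then have "F \<in> bimodule_iso S V (?P\<lparr>carrier := ?N\<rparr>)"
    using bhomD(3,4)[OF F] by (auto simp: bimodule_iso_def iso_def hom_def bij_betw_def ahom_add[OF Fa])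
  moreover have "p > 0" using fs(1) by (simp add: p_def)
  ultimately show ?thesis
    unfolding divides_power_def direct_summand_def using subN subN' int sum by blast
qed

lemma divides_power_iff_retracts:
  assumes "rbimod S V" and "rbimod S W"
  shows "divides_power S V W \<longleftrightarrow> rretracts S V W"
  using divides_power_imp_retracts[OF assms] retracts_imp_divides_power[OF assms] by blast


section \<open>Dual pairs of bimodules\<close>

text \<open>\<open>M\<close> and \<open>N\<close> are dual to each other over the ring with additive group \<open>G\<close> and product \<open>mul\<close>: \<open>P\<close> is a
  pairing of bimodules and \<open>L\<close> lists dual bases, which express projectivity and identify each of the
  two with the dual of the other. Product and actions are plain functions so that exchanging
  \<open>M\<close> and \<open>N\<close> while reversing the product gives an instance again (\<open>mirror\<close>).\<close>

locale dual_pair =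
  fixes G :: "('c, 'z) ring_scheme" and mul :: "'c \<Rightarrow> 'c \<Rightarrow> 'c"
    and M :: "('m, 'x) ring_scheme" and lM rM :: "'c \<Rightarrow> 'm \<Rightarrow> 'm"
    and N :: "('n, 'y) ring_scheme" and lN rN :: "'c \<Rightarrow> 'n \<Rightarrow> 'n"
    and P :: "'m \<Rightarrow> 'n \<Rightarrow> 'c" and L :: "('m \<times> 'n) list"
  assumes G: "abelian_group G" and M: "bimod (carrier G) M lM rM" and N: "bimod (carrier G) N lN rN"
    and Pl: "n \<in> carrier N \<Longrightarrow> (\<lambda>m. P m n) \<in> ahom M G"
    and Pr: "m \<in> carrier M \<Longrightarrow> P m \<in> ahom N G"
    and P_lM: "c \<in> carrier G \<Longrightarrow> m \<in> carrier M \<Longrightarrow> n \<in> carrier N \<Longrightarrow> P (lM c m) n = mul c (P m n)"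
    and P_rN: "c \<in> carrier G \<Longrightarrow> m \<in> carrier M \<Longrightarrow> n \<in> carrier N \<Longrightarrow> P m (rN c n) = mul (P m n) c"
    and P_mid: "c \<in> carrier G \<Longrightarrow> m \<in> carrier M \<Longrightarrow> n \<in> carrier N \<Longrightarrow> P (rM c m) n = P m (lN c n)"
    and L: "set L \<subseteq> carrier M \<times> carrier N"
    and dualM: "m \<in> carrier M \<Longrightarrow> lsum M (\<lambda>(a, b). lM (P m b) a) L = m"
    and dualN: "n \<in> carrier N \<Longrightarrow> lsum N (\<lambda>(a, b). rN (P a n) b) L = n"
begin

lemma P_closed [simp]: "m \<in> carrier M \<Longrightarrow> n \<in> carrier N \<Longrightarrow> P m n \<in> carrier G"
  using ahom_closed[OF Pr] .

text \<open>The dual basis formula expresses \<open>n\<close> through the values \<open>P a n\<close>.\<close>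

lemma nondegenerate:
  assumes "n \<in> carrier N" "n' \<in> carrier N" "\<And>m. m \<in> carrier M \<Longrightarrow> P m n = P m n'"
  shows "n = n'"
proof -
  have "lsum N (\<lambda>(a, b). rN (P a n) b) L = lsum N (\<lambda>(a, b). rN (P a n') b) L"
    using L assms(3) by (intro lsum_cong) auto
  then show ?thesis using dualN assms(1,2) by simp
qed

lemma mirror: "dual_pair G (\<lambda>x y. mul y x) N rN lN M rM lM (\<lambda>n m. P m n) (map prod.swap L)"
proof (rule dual_pair.intro)
  show "bimod (carrier G) N rN lN" "bimod (carrier G) M rM lM"
    using M N by (auto simp: bimod_def)
  show "set (map prod.swap L) \<subseteq> carrier N \<times> carrier M" using L by auto
  show "lsum N (\<lambda>(a, b). rN (P b n) a) (map prod.swap L) = n" if "n \<in> carrier N" for n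
    using dualN[OF that] by (simp add: lsum_map split_def)
  show "lsum M (\<lambda>(a, b). lM (P m a) b) (map prod.swap L) = m" if "m \<in> carrier M" for m
    using dualM[OF that] by (simp add: lsum_map split_def)
qed (auto simp: P_lM P_rN P_mid Pl Pr G)

end

text \<open>The transpose is \<open>t(n) = \<Sum> b \<cdot> P'(f a, n)\<close>, summed over the dual bases \<open>(a, b)\<close> of \<open>M\<close> and \<open>N\<close>; by
  nondegeneracy the adjunction formula already forces it to be a bimodule homomorphism.\<close>

lemma dual_pair_transpose:
  assumes dp: "dual_pair G mul M lM rM N lN rN P L" and dp': "dual_pair G mul M' lM' rM' N' lN' rN' P' L'"
    and f: "f \<in> bhom (carrier G) M lM rM M' lM' rM'"
  shows "\<exists>t. t \<in> bhom (carrier G) N' lN' rN' N lN rN \<and>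
      (\<forall>m\<in>carrier M. \<forall>n\<in>carrier N'. P m (t n) = P' (f m) n)"
proof -
  interpret D: dual_pair G mul M lM rM N lN rN P L by fact
  interpret D': dual_pair G mul M' lM' rM' N' lN' rN' P' L' by fact
  interpret G: abelian_group G by (rule D.G)
  interpret M: abelian_group M by (rule bimodD[OF D.M])
  interpret N: abelian_group N by (rule bimodD[OF D.N])
  interpret M': abelian_group M' by (rule bimodD[OF D'.M])
  interpret N': abelian_group N' by (rule bimodD[OF D'.N])
  note fc = bhomD(2)[OF f]
  define t where "t n = lsum N (\<lambda>(a, b). rN (P' (f a) n) b) L" for n
  have tc: "t n \<in> carrier N" if "n \<in> carrier N'" for n
    unfolding t_def using that
    by (intro N.lsum_closed) (auto dest!: subsetD[OF D.L] intro!: D'.P_closed D.P_closed bimodD(5)[OF D.N] fc)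
  have adj: "P m (t n) = P' (f m) n" if m: "m \<in> carrier M" and n: "n \<in> carrier N'" for m n
  proof -
    have "P m (t n) = lsum G (\<lambda>x. P m ((\<lambda>(a, b). rN (P' (f a) n) b) x)) L"
      unfolding t_def using n
      by (intro ahom_lsum[OF N.abelian_group_axioms G.abelian_group_axioms D.Pr[OF m]])
        (auto dest!: subsetD[OF D.L] intro!: D'.P_closed D.P_closed bimodD(5)[OF D.N] fc)
    also have "\<dots> = lsum G (\<lambda>x. P' (f ((\<lambda>(a, b). lM (P m b) a) x)) n) L"
      using m n by (intro lsum_cong) (auto dest!: subsetD[OF D.L] simp: D.P_rN D'.P_lM fc bhomD(3)[OF f])
    also have "\<dots> = P' (f (lsum M (\<lambda>(a, b). lM (P m b) a) L)) n"
      using m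
      by (intro ahom_lsum[OF M.abelian_group_axioms G.abelian_group_axioms
            ahom_comp[OF bhomD(1)[OF f] D'.Pl[OF n]], symmetric])
        (auto dest!: subsetD[OF D.L] intro!: D'.P_closed D.P_closed bimodD(4)[OF D.M])
    finally show ?thesis using D.dualM[OF m] by simp
  qed
  have "t \<in> bhom (carrier G) N' lN' rN' N lN rN"
  proof (intro bhomI ahomI tc)
    fix x y assume xy: "x \<in> carrier N'" "y \<in> carrier N'"
    show "t (x \<oplus>\<^bsub>N'\<^esub> y) = t x \<oplus>\<^bsub>N\<^esub> t y"
      by (rule D.nondegenerate) (use xy in \<open>auto simp: tc adj ahom_add[OF D.Pr] ahom_add[OF D'.Pr] fc\<close>)
  next
    fix c n assume cn: "c \<in> carrier G" "n \<in> carrier N'"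
    note c = bimodD(4,5)[OF D.N cn(1)] bimodD(4,5)[OF D.M cn(1)] bimodD(4,5)[OF D'.N cn(1)] bimodD(4,5)[OF D'.M cn(1)]
    show "t (lN' c n) = lN c (t n)"
      by (rule D.nondegenerate)
        (use cn in \<open>auto simp: c tc adj fc D.P_mid[symmetric] D'.P_mid[symmetric] bhomD(4)[OF f]\<close>)
    show "t (rN' c n) = rN c (t n)"
      by (rule D.nondegenerate) (use cn in \<open>auto simp: c tc adj fc D.P_rN D'.P_rN\<close>)
  qed
  then show ?thesis using adj by blast
qed

text \<open>Transposition is contravariant. It turns composites \<open>M \<rightarrow> M' \<rightarrow> M\<close> into composites \<open>N \<rightarrow> N' \<rightarrow> N\<close>, and
  identities into identities.\<close>

lemma dual_pair_retracts:
  assumes dp: "dual_pair G mul M lM rM N lN rN P L" and dp': "dual_pair G mul M' lM' rM' N' lN' rN' P' L'"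
    and re: "retracts (carrier G) M lM rM M' lM' rM'"
  shows "retracts (carrier G) N lN rN N' lN' rN'"
proof -
  interpret D: dual_pair G mul M lM rM N lN rN P L by fact
  interpret D': dual_pair G mul M' lM' rM' N' lN' rN' P' L' by fact
  obtain fs where fs0: "fs \<noteq> []"
      "\<forall>(f, g)\<in>set fs. f \<in> bhom (carrier G) M lM rM M' lM' rM' \<and> g \<in> bhom (carrier G) M' lM' rM' M lM rM"
      "\<forall>m\<in>carrier M. lsum M (\<lambda>(f, g). g (f m)) fs = m"
    using re unfolding retracts_def by blast
  have fs: "fs \<noteq> []" "\<And>f g. (f, g) \<in> set fs \<Longrightarrow> f \<in> bhom (carrier G) M lM rM M' lM' rM'"
      "\<And>f g. (f, g) \<in> set fs \<Longrightarrow> g \<in> bhom (carrier G) M' lM' rM' M lM rM"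
      "\<And>m. m \<in> carrier M \<Longrightarrow> lsum M (\<lambda>(f, g). g (f m)) fs = m"
    using fs0 by auto
  have "\<exists>tf. \<forall>f g. (f, g) \<in> set fs \<longrightarrow> tf f \<in> bhom (carrier G) N' lN' rN' N lN rN \<and>
      (\<forall>m\<in>carrier M. \<forall>n\<in>carrier N'. P m (tf f n) = P' (f m) n)"
    using dual_pair_transpose[OF dp dp' fs(2)] by metis
  then obtain tf where tf: "\<And>f g. (f, g) \<in> set fs \<Longrightarrow> tf f \<in> bhom (carrier G) N' lN' rN' N lN rN"
      "\<And>f g m n. (f, g) \<in> set fs \<Longrightarrow> m \<in> carrier M \<Longrightarrow> n \<in> carrier N' \<Longrightarrow> P m (tf f n) = P' (f m) n"
    by metis
  have "\<forall>g. \<exists>t. (\<exists>f. (f, g) \<in> set fs) \<longrightarrow> t \<in> bhom (carrier G) N lN rN N' lN' rN' \<and>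
      (\<forall>m\<in>carrier M'. \<forall>n\<in>carrier N. P' m (t n) = P (g m) n)"
    using dual_pair_transpose[OF dp' dp fs(3)] by blast
  from choice[OF this]
  obtain tg where tg: "\<And>f g. (f, g) \<in> set fs \<Longrightarrow> tg g \<in> bhom (carrier G) N lN rN N' lN' rN'"
      "\<And>f g m n. (f, g) \<in> set fs \<Longrightarrow> m \<in> carrier M' \<Longrightarrow> n \<in> carrier N \<Longrightarrow> P' m (tg g n) = P (g m) n"
    by metis
  interpret M: abelian_group M by (rule bimodD[OF D.M])
  interpret N: abelian_group N by (rule bimodD[OF D.N])
  define fs' where "fs' = map (\<lambda>(f, g). (tg g, tf f)) fs"
  have "lsum N (\<lambda>(f, g). g (f n)) fs' = n" if n: "n \<in> carrier N" for n
  proof (rule D.nondegenerate)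
    have c: "(\<lambda>(f, g). tf f (tg g n)) x \<in> carrier N" if "x \<in> set fs" for x
    proof -
      obtain f g where x: "x = (f, g)" by (cases x)
      then have fg: "(f, g) \<in> set fs" using that by simp
      show ?thesis using bhomD(2)[OF tf(1)[OF fg] bhomD(2)[OF tg(1)[OF fg] n]] by (simp add: x)
    qed
    have eq: "lsum N (\<lambda>(f, g). g (f n)) fs' = lsum N (\<lambda>(f, g). tf f (tg g n)) fs"
      by (simp add: fs'_def lsum_map split_def)
    show "lsum N (\<lambda>(f, g). g (f n)) fs' \<in> carrier N" unfolding eq using c by (rule N.lsum_closed)
    fix m assume m: "m \<in> carrier M"
    have "P m (lsum N (\<lambda>(f, g). g (f n)) fs') = lsum G (\<lambda>x. P m ((\<lambda>(f, g). tf f (tg g n)) x)) fs"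
      unfolding eq by (rule ahom_lsum[OF N.abelian_group_axioms D.G D.Pr[OF m] c])
    also have "\<dots> = lsum G (\<lambda>x. P ((\<lambda>(f, g). g (f m)) x) n) fs"
    proof (rule lsum_cong)
      fix x assume xs: "x \<in> set fs"
      obtain f g where x: "x = (f, g)" by (cases x)
      with xs have fg: "(f, g) \<in> set fs" by simp
      have "P m (tf f (tg g n)) = P (g (f m)) n"
        using tf(2)[OF fg m bhomD(2)[OF tg(1)[OF fg] n]] tg(2)[OF fg bhomD(2)[OF fs(2)[OF fg] m] n] by simp
      then show "P m ((\<lambda>(f, g). tf f (tg g n)) x) = P ((\<lambda>(f, g). g (f m)) x) n" using x by simp
    qed simp
    also have "\<dots> = P (lsum M (\<lambda>(f, g). g (f m)) fs) n"
      using m bhomD(2)[OF fs(2)] bhomD(2)[OF fs(3)]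
      by (intro ahom_lsum[OF M.abelian_group_axioms D.G D.Pl[OF n], symmetric]) auto
    finally show "P m (lsum N (\<lambda>(f, g). g (f n)) fs') = P m n" using fs(4)[OF m] by simp
  qed (rule n)
  moreover have "fs' \<noteq> []" using fs(1) by (simp add: fs'_def)
  moreover have "\<forall>(f, g)\<in>set fs'. f \<in> bhom (carrier G) N lN rN N' lN' rN' \<and> g \<in> bhom (carrier G) N' lN' rN' N lN rN"
    using tf(1) tg(1) by (auto simp: fs'_def)
  ultimately show ?thesis unfolding retracts_def by blast
qed

lemma dual_pair_retracts_iff:
  assumes "dual_pair G mul M lM rM N lN rN P L" and "dual_pair G mul M' lM' rM' N' lN' rN' P' L'"
  shows "retracts (carrier G) M lM rM M' lM' rM' \<longleftrightarrow> retracts (carrier G) N lN rN N' lN' rN'"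
  using dual_pair_retracts[OF assms]
    dual_pair_retracts[OF dual_pair.mirror[OF assms(1)] dual_pair.mirror[OF assms(2)]]
  by (auto simp: retracts_flip)


section \<open>Sweedler sums\<close>

text \<open>Some list of pairs representing the coproduct. Sums over it of bilinear expressions do not
  depend on the choice (\<open>csum_eq_lsum\<close>).\<close>

definition cop :: "('k, 'z) ring_scheme \<Rightarrow> ('k, 'c, 'x) coalgebra_scheme \<Rightarrow> 'c \<Rightarrow> ('c \<times> 'c) list" where
  "cop K C c = (SOME ps. set ps \<subseteq> carrier C \<times> carrier C \<and>
     comult C c = lsum (tensor K C C) (\<lambda>(a, b). pure_tensor K C C a b) ps)"

definition csum ::
  "('k, 'z) ring_scheme \<Rightarrow> ('k, 'c, 'x) coalgebra_scheme \<Rightarrow> ('b, 'm) ring_scheme \<Rightarrow>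
    ('c \<Rightarrow> 'c \<Rightarrow> 'b) \<Rightarrow> 'c \<Rightarrow> 'b" where
  "csum K C G f c = lsum G (\<lambda>(a, b). f a b) (cop K C c)"

definition trilin ::
  "('k, 'z) ring_scheme \<Rightarrow> ('k, 'u, 'w) module_scheme \<Rightarrow> ('k, 'v, 'x) module_scheme \<Rightarrow>
    ('k, 't, 'y) module_scheme \<Rightarrow> ('b, 'm) ring_scheme \<Rightarrow> ('u \<Rightarrow> 'v \<Rightarrow> 't \<Rightarrow> 'b) \<Rightarrow> bool" where
  "trilin K U V W G f \<longleftrightarrow> (\<forall>u\<in>carrier U. bilin K V W G (f u)) \<and>
     (\<forall>w\<in>carrier W. bilin K U V G (\<lambda>u v. f u v w))"

lemma trilinI:
  assumes "\<And>u. u \<in> carrier U \<Longrightarrow> bilin K V W G (f u)"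
    and "\<And>w. w \<in> carrier W \<Longrightarrow> bilin K U V G (\<lambda>u v. f u v w)"
  shows "trilin K U V W G f"
  using assms by (simp add: trilin_def)

lemma trilinD:
  assumes "trilin K U V W G f"
  shows "u \<in> carrier U \<Longrightarrow> bilin K V W G (f u)"
    and "w \<in> carrier W \<Longrightarrow> bilin K U V G (\<lambda>u v. f u v w)"
  using assms by (simp_all add: trilin_def)

lemma module_hom_ahom: "\<phi> \<in> module_hom K V W \<Longrightarrow> \<phi> \<in> ahom V W"
  by (auto simp: module_hom_def ahom_def)

lemma module_homI:
  assumes "\<phi> \<in> ahom V W"
    and "\<And>c v. c \<in> carrier K \<Longrightarrow> v \<in> carrier V \<Longrightarrow> \<phi> (c \<odot>\<^bsub>V\<^esub> v) = c \<odot>\<^bsub>W\<^esub> \<phi> v"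
  shows "\<phi> \<in> module_hom K V W"
  using assms by (auto simp: module_hom_def ahom_def)

lemma module_hom_id: "(\<lambda>v. v) \<in> module_hom K V V"
  by (auto simp: module_hom_def)

lemma module_hom_comp: "\<phi> \<in> module_hom K U V \<Longrightarrow> \<psi> \<in> module_hom K V W \<Longrightarrow> (\<lambda>u. \<psi> (\<phi> u)) \<in> module_hom K U W"
  by (auto simp: module_hom_def Pi_def)

lemma bilin_precomp:
  assumes f: "bilin K V' W' G f" and p: "\<phi> \<in> module_hom K V V'" and q: "\<psi> \<in> module_hom K W W'"
  shows "bilin K V W G (\<lambda>v w. f (\<phi> v) (\<psi> w))"
proof (rule bilinI)
  fix w assume w: "w \<in> carrier W"
  then have "\<psi> w \<in> carrier W'" using module_hom_closed[OF q] by auto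
  from ahom_comp[OF module_hom_ahom[OF p] bilinD(1)[OF f this]]
  show "(\<lambda>v. f (\<phi> v) (\<psi> w)) \<in> ahom V G" .
next
  fix v assume v: "v \<in> carrier V"
  then have "\<phi> v \<in> carrier V'" using module_hom_closed[OF p] by auto
  from ahom_comp[OF module_hom_ahom[OF q] bilinD(2)[OF f this]]
  show "(\<lambda>w. f (\<phi> v) (\<psi> w)) \<in> ahom W G" .
next
  fix c v w assume *: "c \<in> carrier K" "v \<in> carrier V" "w \<in> carrier W"
  then have "\<phi> v \<in> carrier V'" "\<psi> w \<in> carrier W'"
    using module_hom_closed[OF p] module_hom_closed[OF q] by auto
  then show "f (\<phi> (c \<odot>\<^bsub>V\<^esub> v)) (\<psi> w) = f (\<phi> v) (\<psi> (c \<odot>\<^bsub>W\<^esub> w))"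
    using * by (simp add: module_hom_smult[OF p] module_hom_smult[OF q] bilinD(3)[OF f])
qed

lemma bilin_precomp_left:
  "bilin K V' W G f \<Longrightarrow> \<phi> \<in> module_hom K V V' \<Longrightarrow> bilin K V W G (\<lambda>v w. f (\<phi> v) w)"
  using bilin_precomp[OF _ _ module_hom_id] by blast

lemma bilin_precomp_right:
  "bilin K V W' G f \<Longrightarrow> \<psi> \<in> module_hom K W W' \<Longrightarrow> bilin K V W G (\<lambda>v w. f v (\<psi> w))"
  using bilin_precomp[OF _ module_hom_id] by blast

context coalgebra
begin

sublocale T2: tensor_product K C C by unfold_locales

lemma comult_closed: "c \<in> carrier C \<Longrightarrow> comult C c \<in> carrier (tensor K C C)"
  using module_hom_closed[OF comult_hom] by auto

lemma cop: "c \<in> carrier C \<Longrightarrow> set (cop K C c) \<subseteq> carrier C \<times> carrier C \<and>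
     comult C c = lsum (tensor K C C) (\<lambda>(a, b). pure_tensor K C C a b) (cop K C c)"
  unfolding cop_def by (rule someI_ex) (rule T2.tensor_list[OF comult_closed])

lemma csum_cong:
  assumes "c \<in> carrier C" "\<And>a b. a \<in> carrier C \<Longrightarrow> b \<in> carrier C \<Longrightarrow> f a b = g a b"
  shows "csum K C G f c = csum K C G g c"
  unfolding csum_def using assms cop[OF assms(1)] by (intro lsum_cong) auto

lemma csum_hom:
  assumes "abelian_group G" "abelian_group G'" "h \<in> ahom G G'" "c \<in> carrier C"
    and "\<And>a b. a \<in> carrier C \<Longrightarrow> b \<in> carrier C \<Longrightarrow> f a b \<in> carrier G"
  shows "h (csum K C G f c) = csum K C G' (\<lambda>a b. h (f a b)) c"
proof -
  have "h (csum K C G f c) = lsum G' (\<lambda>x. h ((\<lambda>(a, b). f a b) x)) (cop K C c)"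
    unfolding csum_def using assms(5) cop[OF assms(4)] by (intro ahom_lsum[OF assms(1-3)]) auto
  also have "\<dots> = csum K C G' (\<lambda>a b. h (f a b)) c"
    unfolding csum_def by (intro lsum_cong) auto
  finally show ?thesis .
qed

lemma csum_lsum_swap:
  assumes "abelian_group G" "c \<in> carrier C"
    and "\<And>a b i. a \<in> carrier C \<Longrightarrow> b \<in> carrier C \<Longrightarrow> i \<in> set xs \<Longrightarrow> f a b i \<in> carrier G"
  shows "csum K C G (\<lambda>a b. lsum G (\<lambda>i. f a b i) xs) c = lsum G (\<lambda>i. csum K C G (\<lambda>a b. f a b i) c) xs"
proof -
  have "csum K C G (\<lambda>a b. lsum G (\<lambda>i. f a b i) xs) c =
      lsum G (\<lambda>p. lsum G (\<lambda>i. f (fst p) (snd p) i) xs) (cop K C c)"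
    by (simp add: csum_def split_def)
  also have "\<dots> = lsum G (\<lambda>i. lsum G (\<lambda>p. f (fst p) (snd p) i) (cop K C c)) xs"
    using assms(3) cop[OF assms(2)] by (intro abelian_group.lsum_swap[OF assms(1)]) auto
  finally show ?thesis by (simp add: csum_def split_def)
qed

lemma bilin_csum_fun:
  assumes "abelian_group G" "c \<in> carrier C"
    and "\<And>a b. a \<in> carrier C \<Longrightarrow> b \<in> carrier C \<Longrightarrow> bilin K V W G (f a b)"
  shows "bilin K V W G (\<lambda>v w. csum K C G (\<lambda>a b. f a b v w) c)"
proof -
  have "bilin K V W G (\<lambda>v w. lsum G (\<lambda>p. f (fst p) (snd p) v w) (cop K C c))"
    using cop[OF assms(2)] assms(3) by (intro bilin_lsum[OF assms(1)]) auto
  then show ?thesis by (simp add: csum_def split_def)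
qed

lemma csum_swap:
  assumes "abelian_group G" "c \<in> carrier C" "d \<in> carrier C"
    and "\<And>a b x y. a \<in> carrier C \<Longrightarrow> b \<in> carrier C \<Longrightarrow> x \<in> carrier C \<Longrightarrow> y \<in> carrier C \<Longrightarrow>
      f a b x y \<in> carrier G"
  shows "csum K C G (\<lambda>a b. csum K C G (\<lambda>x y. f a b x y) d) c =
    csum K C G (\<lambda>x y. csum K C G (\<lambda>a b. f a b x y) c) d"
proof -
  have "csum K C G (\<lambda>a b. csum K C G (\<lambda>x y. f a b x y) d) c =
      csum K C G (\<lambda>a b. lsum G (\<lambda>p. f a b (fst p) (snd p)) (cop K C d)) c"
    by (simp add: csum_def split_def)
  also have "\<dots> = lsum G (\<lambda>p. csum K C G (\<lambda>a b. f a b (fst p) (snd p)) c) (cop K C d)"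
    using cop[OF assms(3)] assms(4) by (intro csum_lsum_swap[OF assms(1,2)]) auto
  finally show ?thesis by (simp add: csum_def split_def)
qed

lemma csum_eq_tensor_lift:
  assumes "abelian_group G" "bilin K C C G f" "c \<in> carrier C"
  shows "csum K C G f c = tensor_lift K C C G f (comult C c)"
proof -
  have "tensor_lift K C C G f (comult C c) =
      lsum G (\<lambda>x. tensor_lift K C C G f ((\<lambda>(a, b). pure_tensor K C C a b) x)) (cop K C c)"
    unfolding conjunct2[OF cop[OF assms(3)]]
    using cop[OF assms(3)]
    by (intro ahom_lsum[OF T2.T.abelian_group_T assms(1) T2.tensor_lift_ahom[OF assms(1,2)]]) auto
  also have "\<dots> = csum K C G f c"
    unfolding csum_def using cop[OF assms(3)]
    by (intro lsum_cong) (auto simp: T2.tensor_lift_pure[OF assms(1,2)])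
  finally show ?thesis by simp
qed

lemma sweedler_eq_csum:
  "abelian_group G \<Longrightarrow> bilin K C C G f \<Longrightarrow> c \<in> carrier C \<Longrightarrow> sweedler K C G f c = csum K C G f c"
  by (simp add: sweedler_def csum_eq_tensor_lift)

lemma csum_eq_lsum:
  assumes "abelian_group G" "bilin K C C G f" "c \<in> carrier C"
    and ps: "set ps \<subseteq> carrier C \<times> carrier C" "comult C c = lsum (tensor K C C) (\<lambda>(a, b). pure_tensor K C C a b) ps"
  shows "csum K C G f c = lsum G (\<lambda>(a, b). f a b) ps"
proof -
  have "tensor_lift K C C G f (comult C c) =
      lsum G (\<lambda>x. tensor_lift K C C G f ((\<lambda>(a, b). pure_tensor K C C a b) x)) ps"
    unfolding ps(2) using ps(1)
    by (intro ahom_lsum[OF T2.T.abelian_group_T assms(1) T2.tensor_lift_ahom[OF assms(1,2)]]) auto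
  also have "\<dots> = lsum G (\<lambda>(a, b). f a b) ps"
    using ps(1) by (intro lsum_cong) (auto simp: T2.tensor_lift_pure[OF assms(1,2)])
  finally show ?thesis using csum_eq_tensor_lift[OF assms(1-3)] by simp
qed

lemma csum_ahom:
  assumes "abelian_group G" "bilin K C C G f"
  shows "(\<lambda>c. csum K C G f c) \<in> ahom C G"
proof -
  have "(\<lambda>c. tensor_lift K C C G f (comult C c)) \<in> ahom C G"
    by (rule ahom_comp[OF module_hom_ahom[OF comult_hom] T2.tensor_lift_ahom[OF assms]])
  then show ?thesis by (simp add: ahom_def csum_eq_tensor_lift[OF assms])
qed

lemma csum_smult:
  assumes "abelian_group G" "bilin K C C G f" "k \<in> carrier K" "c \<in> carrier C"
  shows "csum K C G f (k \<odot>\<^bsub>C\<^esub> c) = csum K C G (\<lambda>a b. f (k \<odot>\<^bsub>C\<^esub> a) b) c"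
proof -
  have b: "bilin K C C G (\<lambda>a b. f (k \<odot>\<^bsub>C\<^esub> a) b)"
  proof (rule bilin_precomp_left[OF assms(2)], rule module_homI)
    show "smult C k \<in> ahom C C" using assms(3) by (auto intro!: ahomI simp: smult_r_distr)
    show "k \<odot>\<^bsub>C\<^esub> (c \<odot>\<^bsub>C\<^esub> v) = c \<odot>\<^bsub>C\<^esub> (k \<odot>\<^bsub>C\<^esub> v)" if "c \<in> carrier K" "v \<in> carrier C" for c v
      using that assms(3) by (simp add: smult_assoc1[symmetric] R.m_comm)
  qed
  have "tensor_lift K C C G f (k \<odot>\<^bsub>tensor K C C\<^esub> comult C c) =
      tensor_lift K C C G (\<lambda>a b. f (k \<odot>\<^bsub>C\<^esub> a) b) (comult C c)"
    by (rule T2.tensor_ext[OF assms(1)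
          ahom_comp[OF T2.smult_tensor_ahom[OF assms(3)] T2.tensor_lift_ahom[OF assms(1,2)]]
          T2.tensor_lift_ahom[OF assms(1) b] _ comult_closed[OF assms(4)]])
      (use assms(3) in \<open>simp add: T2.smult_pure T2.tensor_lift_pure[OF assms(1,2)] T2.tensor_lift_pure[OF assms(1) b]\<close>)
  then show ?thesis
    using assms(3,4) by (simp add: csum_eq_tensor_lift[OF assms(1,2)] csum_eq_tensor_lift[OF assms(1) b]
        module_hom_smult[OF comult_hom])
qed

lemma bilin_csum_right:
  assumes "abelian_group G" "trilin K V C C G f" "module K V"
  shows "bilin K V C G (\<lambda>v c. csum K C G (f v) c)"
proof (rule bilinI)
  interpret V: module K V by fact
  fix c assume c: "c \<in> carrier C"
  show "(\<lambda>v. csum K C G (f v) c) \<in> ahom V G"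
    unfolding csum_def
    using cop[OF c] bilinD(1)[OF trilinD(2)[OF assms(2)]]
    by (intro ahom_lsum_fun[OF assms(1)]) auto
  fix k v assume k: "k \<in> carrier K" "v \<in> carrier V"
  show "csum K C G (f (k \<odot>\<^bsub>V\<^esub> v)) c = csum K C G (f v) (k \<odot>\<^bsub>C\<^esub> c)"
    using k c by (simp add: csum_smult[OF assms(1) trilinD(1)[OF assms(2)]])
      (auto intro!: csum_cong simp: bilinD(3)[OF trilinD(2)[OF assms(2)]])
next
  fix v assume v: "v \<in> carrier V"
  show "(\<lambda>c. csum K C G (f v) c) \<in> ahom C G"
    by (rule csum_ahom[OF assms(1) trilinD(1)[OF assms(2) v]])
qed

lemma bilin_csum_left:
  assumes "abelian_group G" "trilin K C C V G f" "module K V"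
  shows "bilin K C V G (\<lambda>c v. csum K C G (\<lambda>a b. f a b v) c)"
proof (rule bilinI)
  interpret V: module K V by fact
  fix v assume v: "v \<in> carrier V"
  show "(\<lambda>c. csum K C G (\<lambda>a b. f a b v) c) \<in> ahom C G"
    by (rule csum_ahom[OF assms(1) trilinD(2)[OF assms(2) v]])
  fix k c assume k: "k \<in> carrier K" "c \<in> carrier C"
  have "csum K C G (\<lambda>a b. f (k \<odot>\<^bsub>C\<^esub> a) b v) c = csum K C G (\<lambda>a b. f a b (k \<odot>\<^bsub>V\<^esub> v)) c"
    using k v by (intro csum_cong)
      (auto simp: bilinD(3)[OF trilinD(2)[OF assms(2)]] bilinD(3)[OF trilinD(1)[OF assms(2)]])
  then show "csum K C G (\<lambda>a b. f a b v) (k \<odot>\<^bsub>C\<^esub> c) = csum K C G (\<lambda>a b. f a b (k \<odot>\<^bsub>V\<^esub> v)) c"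
    using k v by (simp add: csum_smult[OF assms(1) trilinD(2)[OF assms(2)]])
next
  fix c assume c: "c \<in> carrier C"
  show "(\<lambda>v. csum K C G (\<lambda>a b. f a b v) c) \<in> ahom V G"
    unfolding csum_def
    using cop[OF c] bilinD(2)[OF trilinD(1)[OF assms(2)]]
    by (intro ahom_lsum_fun[OF assms(1)]) auto
qed

text \<open>The coassociativity axiom is an equation in \<open>C \<otimes> (C \<otimes> C)\<close>. Applying the additive map \<open>\<Psi>\<close> that the
  trilinear map \<open>f\<close> induces there turns it into an equation between sums of values of \<open>f\<close>.\<close>

lemma csum_coassoc:
  assumes G: "abelian_group G" and f: "trilin K C C C G f" and c: "c \<in> carrier C"
  shows "csum K C G (\<lambda>a b. csum K C G (\<lambda>b1 b2. f a b1 b2) b) c =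
    csum K C G (\<lambda>a b. csum K C G (\<lambda>a1 a2. f a1 a2 b) a) c"
proof -
  interpret T3: tensor_product K C "tensor K C C"
    by (rule tensor_product.intro[OF T2.V T2.module_tensor])
  let ?T2 = "tensor K C C" let ?T3 = "tensor K C ?T2"
  note p2 = T2.bilin_pure and p3 = T3.bilin_pure
  note T3G = T3.T.abelian_group_T
  define \<Psi> where "\<Psi> = tensor_lift K C ?T2 G (\<lambda>a. tensor_lift K C C G (f a))"
  have lf: "a \<in> carrier C \<Longrightarrow> tensor_lift K C C G (f a) \<in> ahom ?T2 G"
    and lfp: "a \<in> carrier C \<Longrightarrow> b \<in> carrier C \<Longrightarrow> d \<in> carrier C \<Longrightarrow>
      tensor_lift K C C G (f a) (pure_tensor K C C b d) = f a b d" for a b d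
    using T2.tensor_lift_ahom[OF G trilinD(1)[OF f]] T2.tensor_lift_pure[OF G trilinD(1)[OF f]] by auto
  have b3: "bilin K C ?T2 G (\<lambda>a. tensor_lift K C C G (f a))"
  proof (rule bilinI)
    fix t assume t: "t \<in> carrier ?T2"
    show "(\<lambda>a. tensor_lift K C C G (f a) t) \<in> ahom C G"
    proof (rule ahomI)
      fix x y assume xy: "x \<in> carrier C" "y \<in> carrier C"
      show "tensor_lift K C C G (f (x \<oplus>\<^bsub>C\<^esub> y)) t =
          tensor_lift K C C G (f x) t \<oplus>\<^bsub>G\<^esub> tensor_lift K C C G (f y) t"
        by (rule T2.tensor_ext[OF G lf ahom_add_fun[OF G lf lf] _ t])
          (use xy in \<open>auto simp: lfp ahom_add[OF bilinD(1)[OF trilinD(2)[OF f]]]\<close>)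
    qed (use t lf in \<open>auto intro: ahom_closed\<close>)
  next
    fix k a t assume k: "k \<in> carrier K" "a \<in> carrier C" "t \<in> carrier ?T2"
    show "tensor_lift K C C G (f (k \<odot>\<^bsub>C\<^esub> a)) t = tensor_lift K C C G (f a) (k \<odot>\<^bsub>?T2\<^esub> t)"
      by (rule T2.tensor_ext[OF G lf ahom_comp[OF T2.smult_tensor_ahom lf] _ k(3)])
        (use k in \<open>auto simp: lfp T2.smult_pure bilinD(3)[OF trilinD(2)[OF f]]\<close>)
  qed (rule lf)
  have \<Psi>: "\<Psi> \<in> ahom ?T3 G" and \<Psi>p: "\<And>a t. a \<in> carrier C \<Longrightarrow> t \<in> carrier ?T2 \<Longrightarrow>
      \<Psi> (pure_tensor K C ?T2 a t) = tensor_lift K C C G (f a) t"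
    unfolding \<Psi>_def using T3.tensor_lift_ahom[OF G b3] T3.tensor_lift_pure[OF G b3] by auto
  have bl: "bilin K C C ?T3 (\<lambda>a b. pure_tensor K C ?T2 a (comult C b))"
    by (rule bilin_precomp_right[OF p3 comult_hom])
  have tri: "trilin K C C C ?T3 (\<lambda>a1 a2 b. pure_tensor K C ?T2 a1 (pure_tensor K C C a2 b))"
  proof (rule trilinI)
    fix u assume "u \<in> carrier C"
    then show "bilin K C C ?T3 (\<lambda>a2 b. pure_tensor K C ?T2 u (pure_tensor K C C a2 b))"
      by (intro bilin_comp[OF p2] bilinD(2)[OF p3])
  next
    fix w assume w: "w \<in> carrier C"
    have "(\<lambda>a2. pure_tensor K C C a2 w) \<in> module_hom K C ?T2"
      using w by (intro module_homI bilinD(1)[OF p2]) (simp_all add: T2.smult_pure)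
    from bilin_precomp_right[OF p3 this]
    show "bilin K C C ?T3 (\<lambda>a1 a2. pure_tensor K C ?T2 a1 (pure_tensor K C C a2 w))" .
  qed
  have br: "bilin K C C ?T3 (\<lambda>a b. csum K C ?T3 (\<lambda>a1 a2. pure_tensor K C ?T2 a1 (pure_tensor K C C a2 b)) a)"
    by (rule bilin_csum_left[OF T3G tri T2.V])
  have br': "bilin K C C ?T3 (\<lambda>a b. sweedler K C ?T3 (\<lambda>a1 a2. pure_tensor K C ?T2 a1 (pure_tensor K C C a2 b)) a)"
    by (rule bilin_cong[OF br])
      (simp_all add: sweedler_eq_csum[OF T3G trilinD(2)[OF tri]] T2.V)
  have "csum K C ?T3 (\<lambda>a b. pure_tensor K C ?T2 a (comult C b)) c =
      csum K C ?T3 (\<lambda>a b. sweedler K C ?T3 (\<lambda>a1 a2. pure_tensor K C ?T2 a1 (pure_tensor K C C a2 b)) a) c"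
    using coassoc[OF c] by (simp add: sweedler_eq_csum[OF T3G bl c] sweedler_eq_csum[OF T3G br' c])
  also have "\<dots> = csum K C ?T3 (\<lambda>a b. csum K C ?T3 (\<lambda>a1 a2. pure_tensor K C ?T2 a1 (pure_tensor K C C a2 b)) a) c"
    by (rule csum_cong[OF c]) (rule sweedler_eq_csum[OF T3G trilinD(2)[OF tri]])
  finally have "\<Psi> (csum K C ?T3 (\<lambda>a b. pure_tensor K C ?T2 a (comult C b)) c) =
      \<Psi> (csum K C ?T3 (\<lambda>a b. csum K C ?T3 (\<lambda>a1 a2. pure_tensor K C ?T2 a1 (pure_tensor K C C a2 b)) a) c)"
    by simp
  moreover have "\<Psi> (csum K C ?T3 (\<lambda>a b. pure_tensor K C ?T2 a (comult C b)) c) =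
      csum K C G (\<lambda>a b. csum K C G (\<lambda>b1 b2. f a b1 b2) b) c"
    by (subst csum_hom[OF T3G G \<Psi> c bilinD(4)[OF bl]])
      (auto intro!: csum_cong[OF c] simp: \<Psi>p comult_closed csum_eq_tensor_lift[OF G trilinD(1)[OF f]])
  moreover have "\<Psi> (csum K C ?T3 (\<lambda>a b. csum K C ?T3 (\<lambda>a1 a2. pure_tensor K C ?T2 a1 (pure_tensor K C C a2 b)) a) c) =
      csum K C G (\<lambda>a b. csum K C G (\<lambda>a1 a2. f a1 a2 b) a) c"
  proof -
    have "\<Psi> (csum K C ?T3 (\<lambda>a1 a2. pure_tensor K C ?T2 a1 (pure_tensor K C C a2 b)) a) =
        csum K C G (\<lambda>a1 a2. f a1 a2 b) a" if "a \<in> carrier C" "b \<in> carrier C" for a b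
      using that
      by (subst csum_hom[OF T3G G \<Psi>]) (auto intro!: csum_cong simp: \<Psi>p lfp)
    then show ?thesis
      by (subst csum_hom[OF T3G G \<Psi> c bilinD(4)[OF br]]) (auto intro!: csum_cong[OF c])
  qed
  ultimately show ?thesis by simp
qed

lemma counit_closed [simp]: "c \<in> carrier C \<Longrightarrow> counit C c \<in> carrier K"
  using module_hom_closed[OF counit_hom] by (auto simp: self_module_def)

lemma counit_add: "a \<in> carrier C \<Longrightarrow> b \<in> carrier C \<Longrightarrow> counit C (a \<oplus>\<^bsub>C\<^esub> b) = counit C a \<oplus> counit C b"
  using module_hom_add[OF counit_hom] by (simp add: self_module_def)

lemma counit_smult: "k \<in> carrier K \<Longrightarrow> a \<in> carrier C \<Longrightarrow> counit C (k \<odot>\<^bsub>C\<^esub> a) = k \<otimes> counit C a"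
  using module_hom_smult[OF counit_hom] by (simp add: self_module_def)

lemma bilin_counit_left: "bilin K C C C (\<lambda>a b. counit C a \<odot>\<^bsub>C\<^esub> b)"
  by (rule bilinI; (rule ahomI)?)
    (simp_all add: counit_add counit_smult smult_l_distr smult_r_distr smult_assoc1[symmetric] R.m_comm)

lemma bilin_counit_right: "bilin K C C C (\<lambda>a b. counit C b \<odot>\<^bsub>C\<^esub> a)"
  by (rule bilinI; (rule ahomI)?)
    (simp_all add: counit_add counit_smult smult_l_distr smult_r_distr smult_assoc1[symmetric] R.m_comm)

lemma csum_counit_left:
  assumes "abelian_group G" "\<phi> \<in> ahom C G" "c \<in> carrier C"
  shows "csum K C G (\<lambda>a b. \<phi> (counit C a \<odot>\<^bsub>C\<^esub> b)) c = \<phi> c"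
  using csum_hom[where f = "\<lambda>a b. counit C a \<odot>\<^bsub>C\<^esub> b", OF abelian_group_axioms assms bilinD(4)[OF bilin_counit_left]]
    counit_left[OF assms(3)] sweedler_eq_csum[OF abelian_group_axioms bilin_counit_left assms(3)]
  by simp

lemma csum_counit_right:
  assumes "abelian_group G" "\<phi> \<in> ahom C G" "c \<in> carrier C"
  shows "csum K C G (\<lambda>a b. \<phi> (counit C b \<odot>\<^bsub>C\<^esub> a)) c = \<phi> c"
  using csum_hom[where f = "\<lambda>a b. counit C b \<odot>\<^bsub>C\<^esub> a", OF abelian_group_axioms assms bilinD(4)[OF bilin_counit_right]]
    counit_right[OF assms(3)] sweedler_eq_csum[OF abelian_group_axioms bilin_counit_right assms(3)]
  by simp

end


section \<open>Hopf algebras\<close>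

context hopf_algebra
begin

abbreviation H_mult (infixl "\<bullet>" 70) where "x \<bullet> y \<equiv> x \<otimes>\<^bsub>H\<^esub> y"
abbreviation H_smult (infixl "\<cdot>" 70) where "k \<cdot> x \<equiv> k \<odot>\<^bsub>H\<^esub> x"

abbreviation "S \<equiv> antipode H"

lemma S_closed [simp]: "x \<in> carrier H \<Longrightarrow> S x \<in> carrier H"
  using module_hom_closed[OF antipode_hom] by auto

lemma H_abelian: "abelian_group H" by (rule abelian_group_axioms)

lemma lmult_hom: "x \<in> carrier H \<Longrightarrow> \<phi> \<in> module_hom K V H \<Longrightarrow> (\<lambda>v. x \<bullet> \<phi> v) \<in> module_hom K V H"
  by (auto simp: module_hom_def Pi_def r_distr smult_mult_right)

lemma rmult_hom: "x \<in> carrier H \<Longrightarrow> \<phi> \<in> module_hom K V H \<Longrightarrow> (\<lambda>v. \<phi> v \<bullet> x) \<in> module_hom K V H"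
  by (auto simp: module_hom_def Pi_def l_distr smult_mult_left)

lemma S_hom: "\<phi> \<in> module_hom K V H \<Longrightarrow> (\<lambda>v. S (\<phi> v)) \<in> module_hom K V H"
  by (rule module_hom_comp[OF _ antipode_hom])

lemma lmult_ahom: "x \<in> carrier H \<Longrightarrow> (\<lambda>a. x \<bullet> a) \<in> ahom H H"
  by (auto intro!: ahomI simp: r_distr)

lemma rmult_ahom: "x \<in> carrier H \<Longrightarrow> (\<lambda>a. a \<bullet> x) \<in> ahom H H"
  by (auto intro!: ahomI simp: l_distr)

lemma bilin_mult: "bilin K H H H (\<lambda>a b. a \<bullet> b)"
  by (rule bilinI) (simp_all add: lmult_ahom rmult_ahom smult_mult_left smult_mult_right)

lemma bilin_mult_homs:
  "\<phi> \<in> module_hom K V H \<Longrightarrow> \<psi> \<in> module_hom K W H \<Longrightarrow> bilin K V W H (\<lambda>v w. \<phi> v \<bullet> \<psi> w)"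
  by (rule bilin_precomp[OF bilin_mult])

lemma bilin_lmult: "bilin K V W H f \<Longrightarrow> x \<in> carrier H \<Longrightarrow> bilin K V W H (\<lambda>v w. x \<bullet> f v w)"
  by (rule bilin_comp[OF _ lmult_ahom])

lemma bilin_rmult: "bilin K V W H f \<Longrightarrow> x \<in> carrier H \<Longrightarrow> bilin K V W H (\<lambda>v w. f v w \<bullet> x)"
  by (rule bilin_comp[OF _ rmult_ahom])

lemmas hom_intros = module_hom_id lmult_hom rmult_hom S_hom

lemma csum_mult:
  assumes G: "abelian_group G" and f: "bilin K H H G f" and x: "x \<in> carrier H" and y: "y \<in> carrier H"
  shows "csum K H G f (x \<bullet> y) =
    csum K H G (\<lambda>a b. csum K H G (\<lambda>c d. f (a \<bullet> c) (b \<bullet> d)) y) x"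
proof -
  let ?T = "tensor K H H"
  note TG = T2.T.abelian_group_T and p = T2.bilin_pure
  have i: "bilin K H H ?T (\<lambda>c d. pure_tensor K H H (a \<bullet> c) (b \<bullet> d))"
    if "a \<in> carrier H" "b \<in> carrier H" for a b
    using that by (intro bilin_precomp[OF p] hom_intros)
  have i': "bilin K H H ?T (\<lambda>a b. pure_tensor K H H (a \<bullet> c) (b \<bullet> d))"
    if "c \<in> carrier H" "d \<in> carrier H" for c d
    using that by (intro bilin_precomp[OF p] hom_intros)
  have o: "bilin K H H ?T (\<lambda>a b. csum K H ?T (\<lambda>c d. pure_tensor K H H (a \<bullet> c) (b \<bullet> d)) y)"
    using i' by (intro bilin_csum_fun[OF TG y])
  have o': "bilin K H H ?T (\<lambda>a b. sweedler K H ?T (\<lambda>c d. pure_tensor K H H (a \<bullet> c) (b \<bullet> d)) y)"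
    by (rule bilin_cong[OF o]) (simp_all add: sweedler_eq_csum[OF TG i y] T2.V)
  have eq: "comult H (x \<bullet> y) =
      csum K H ?T (\<lambda>a b. csum K H ?T (\<lambda>c d. pure_tensor K H H (a \<bullet> c) (b \<bullet> d)) y) x"
    unfolding comult_mult[OF x y] sweedler_eq_csum[OF TG o' x]
    by (rule csum_cong[OF x]) (rule sweedler_eq_csum[OF TG i y])
  note L = T2.tensor_lift_ahom[OF G f] and Lp = T2.tensor_lift_pure[OF G f]
  have "csum K H G f (x \<bullet> y) = tensor_lift K H H G f (comult H (x \<bullet> y))"
    using x y by (intro csum_eq_tensor_lift[OF G f]) simp
  also have "\<dots> = csum K H G (\<lambda>a b. tensor_lift K H H G f
      (csum K H ?T (\<lambda>c d. pure_tensor K H H (a \<bullet> c) (b \<bullet> d)) y)) x"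
    unfolding eq by (rule csum_hom[OF TG G L x bilinD(4)[OF o]])
  also have "\<dots> = csum K H G (\<lambda>a b. csum K H G (\<lambda>c d. f (a \<bullet> c) (b \<bullet> d)) y) x"
    by (rule csum_cong[OF x], subst csum_hom[OF TG G L y bilinD(4)[OF i]])
      (auto intro!: csum_cong[OF y] simp: Lp)
  finally show ?thesis .
qed

lemma csum_one:
  assumes G: "abelian_group G" and f: "bilin K H H G f"
  shows "csum K H G f \<one>\<^bsub>H\<^esub> = f \<one>\<^bsub>H\<^esub> \<one>\<^bsub>H\<^esub>"
proof -
  interpret G: abelian_group G by (rule G)
  have "comult H \<one>\<^bsub>H\<^esub> = lsum (tensor K H H) (\<lambda>(a, b). pure_tensor K H H a b) [(\<one>\<^bsub>H\<^esub>, \<one>\<^bsub>H\<^esub>)]"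
    by (simp add: comult_one)
  from csum_eq_lsum[OF G f one_closed _ this] show ?thesis using bilinD(4)[OF f] by simp
qed

lemma csum_antipode_left: "x \<in> carrier H \<Longrightarrow> csum K H H (\<lambda>a b. S a \<bullet> b) x = counit H x \<cdot> \<one>\<^bsub>H\<^esub>"
  using antipode_left[of x] sweedler_eq_csum[OF H_abelian bilin_mult_homs[OF S_hom[OF module_hom_id] module_hom_id], of x]
  by simp

lemma csum_antipode_right: "x \<in> carrier H \<Longrightarrow> csum K H H (\<lambda>a b. a \<bullet> S b) x = counit H x \<cdot> \<one>\<^bsub>H\<^esub>"
  using antipode_right[of x] sweedler_eq_csum[OF H_abelian bilin_mult_homs[OF module_hom_id S_hom[OF module_hom_id]], of x]
  by simp

text \<open>One half of the proof that \<open>S(xy) = S(y)S(x)\<close>; for grouplike elements it says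
  \<open>(xy)\<^sup>-\<^sup>1 x = y\<^sup>-\<^sup>1\<close>. Insert \<open>y\<^sub>(\<^sub>2\<^sub>) S(y\<^sub>(\<^sub>3\<^sub>))\<close> and contract \<open>S(x\<^sub>(\<^sub>1\<^sub>) y\<^sub>(\<^sub>1\<^sub>)) x\<^sub>(\<^sub>2\<^sub>) y\<^sub>(\<^sub>2\<^sub>)\<close> with the antipode
  axiom for the product \<open>xy\<close>. Treating the two arguments one after the other keeps each use of coassociativity
  in a single variable.\<close>

lemma S_mult_aux:
  assumes x: "x \<in> carrier H" and y: "y \<in> carrier H"
  shows "csum K H H (\<lambda>a b. S (a \<bullet> y) \<bullet> b) x = counit H x \<cdot> S y"
proof -
  note cs = csum_cong and G = H_abelian
  define F where "F p q r = csum K H H (\<lambda>a b. S (a \<bullet> p) \<bullet> ((b \<bullet> q) \<bullet> S r)) x" for p q r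
  have tri: "trilin K H H H H F"
    unfolding F_def
    by (rule trilinI; rule bilin_csum_fun[OF G x])
      (auto intro!: bilin_mult_homs hom_intros bilin_lmult)
  have 1: "csum K H H (\<lambda>r s. F p r s) q = csum K H H (\<lambda>a b. S (a \<bullet> (counit H q \<cdot> p)) \<bullet> b) x"
    if p: "p \<in> carrier H" and q: "q \<in> carrier H" for p q
  proof -
    have "csum K H H (\<lambda>r s. F p r s) q =
        csum K H H (\<lambda>a b. csum K H H (\<lambda>r s. S (a \<bullet> p) \<bullet> ((b \<bullet> r) \<bullet> S s)) q) x"
      unfolding F_def using p by (intro csum_swap[OF G q x]) simp
    also have "\<dots> = csum K H H (\<lambda>a b. S (a \<bullet> (counit H q \<cdot> p)) \<bullet> b) x"
    proof (rule cs[OF x])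
      fix a b assume a: "a \<in> carrier H" and b: "b \<in> carrier H"
      have "csum K H H (\<lambda>r s. S (a \<bullet> p) \<bullet> ((b \<bullet> r) \<bullet> S s)) q =
          csum K H H (\<lambda>r s. (S (a \<bullet> p) \<bullet> b) \<bullet> (r \<bullet> S s)) q"
        using a b p by (intro cs[OF q]) (simp add: m_assoc)
      also have "\<dots> = (S (a \<bullet> p) \<bullet> b) \<bullet> csum K H H (\<lambda>r s. r \<bullet> S s) q"
        using a b p by (intro csum_hom[OF G G lmult_ahom q, symmetric]) simp_all
      also have "\<dots> = counit H q \<cdot> (S (a \<bullet> p) \<bullet> b)"
        using a b p q by (simp add: csum_antipode_right smult_mult_right)
      also have "\<dots> = S (a \<bullet> (counit H q \<cdot> p)) \<bullet> b"
        using a b p q by (simp add: smult_mult_right smult_mult_left module_hom_smult[OF antipode_hom])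
      finally show "csum K H H (\<lambda>r s. S (a \<bullet> p) \<bullet> ((b \<bullet> r) \<bullet> S s)) q =
        S (a \<bullet> (counit H q \<cdot> p)) \<bullet> b" .
    qed
    finally show ?thesis .
  qed
  have 2: "csum K H H (\<lambda>p1 p2. F p1 p2 q) p = counit H x \<cdot> S (counit H p \<cdot> q)"
    if p: "p \<in> carrier H" and q: "q \<in> carrier H" for p q
  proof -
    have "csum K H H (\<lambda>p1 p2. F p1 p2 q) p = 
        csum K H H (\<lambda>a b. csum K H H (\<lambda>p1 p2. S (a \<bullet> p1) \<bullet> ((b \<bullet> p2) \<bullet> S q)) p) x"
      unfolding F_def using q by (intro csum_swap[OF G p x]) simp
    also have "\<dots> = csum K H H (\<lambda>a b. csum K H H (\<lambda>p1 p2. (S (a \<bullet> p1) \<bullet> (b \<bullet> p2)) \<bullet> S q) p) x"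
      using q by (intro cs[OF x] cs[OF p]) (simp add: m_assoc)
    also have "\<dots> = csum K H H (\<lambda>u v. (S u \<bullet> v) \<bullet> S q) (x \<bullet> p)"
      using q by (intro csum_mult[OF G _ x p, symmetric] bilin_rmult bilin_mult_homs hom_intros) simp
    also have "\<dots> = csum K H H (\<lambda>u v. S u \<bullet> v) (x \<bullet> p) \<bullet> S q"
      using q x p by (intro csum_hom[OF G G rmult_ahom, symmetric]) simp_all
    also have "\<dots> = counit H x \<cdot> S (counit H p \<cdot> q)"
      using q x p by (simp add: csum_antipode_left counit_mult smult_mult_left module_hom_smult[OF antipode_hom] smult_assoc1)
    finally show ?thesis .
  qed
  have "csum K H H (\<lambda>a b. S (a \<bullet> y) \<bullet> b) x =
      csum K H H (\<lambda>p q. csum K H H (\<lambda>a b. S (a \<bullet> (counit H q \<cdot> p)) \<bullet> b) x) y"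
  proof (rule csum_counit_right[OF G _ y, symmetric])
    show "(\<lambda>y. csum K H H (\<lambda>a b. S (a \<bullet> y) \<bullet> b) x) \<in> ahom H H"
      unfolding csum_def using cop[OF x]
      by (intro ahom_lsum_fun[OF G]) (auto intro!: module_hom_ahom[where K = K] hom_intros)
  qed
  also have "\<dots> = csum K H H (\<lambda>p q. csum K H H (\<lambda>r s. F p r s) q) y"
    by (rule cs[OF y]) (simp add: 1)
  also have "\<dots> = csum K H H (\<lambda>p q. csum K H H (\<lambda>p1 p2. F p1 p2 q) p) y"
    by (rule csum_coassoc[OF G tri y])
  also have "\<dots> = csum K H H (\<lambda>p q. counit H x \<cdot> S (counit H p \<cdot> q)) y"
    by (rule cs[OF y]) (rule 2)
  also have "\<dots> = counit H x \<cdot> S y"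
  proof (rule csum_counit_left[OF G _ y])
    show "(\<lambda>q. counit H x \<cdot> S q) \<in> ahom H H"
      using x by (auto intro!: ahomI simp: smult_r_distr module_hom_add[OF antipode_hom])
  qed
  finally show ?thesis .
qed

text \<open>\<open>S(xy) = S(x\<^sub>(\<^sub>1\<^sub>) y) x\<^sub>(\<^sub>2\<^sub>) S(x\<^sub>(\<^sub>3\<^sub>))\<close>, and the first two factors contract by the previous lemma.\<close>

lemma S_mult:
  assumes x: "x \<in> carrier H" and y: "y \<in> carrier H"
  shows "S (x \<bullet> y) = S y \<bullet> S x"
proof -
  note cs = csum_cong and G = H_abelian
  define F where "F a b c = S (a \<bullet> y) \<bullet> (b \<bullet> S c)" for a b c
  have tri: "trilin K H H H H F"
    unfolding F_def using y
    by (intro trilinI) (auto intro!: bilin_mult_homs hom_intros bilin_lmult)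
  have "S (x \<bullet> y) = csum K H H (\<lambda>a b. S ((counit H b \<cdot> a) \<bullet> y)) x"
    using y by (intro csum_counit_right[OF G _ x, symmetric] module_hom_ahom[where K = K] hom_intros)
  also have "\<dots> = csum K H H (\<lambda>a b. csum K H H (\<lambda>b1 b2. F a b1 b2) b) x"
  proof (rule cs[OF x])
    fix a b assume a: "a \<in> carrier H" and b: "b \<in> carrier H"
    have "csum K H H (\<lambda>b1 b2. F a b1 b2) b = S (a \<bullet> y) \<bullet> csum K H H (\<lambda>b1 b2. b1 \<bullet> S b2) b"
      unfolding F_def using a b y by (intro csum_hom[OF G G lmult_ahom b, symmetric]) simp_all
    also have "\<dots> = S ((counit H b \<cdot> a) \<bullet> y)"
      using a b y by (simp add: csum_antipode_right smult_mult_right smult_mult_left module_hom_smult[OF antipode_hom])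
    finally show "S ((counit H b \<cdot> a) \<bullet> y) = csum K H H (\<lambda>b1 b2. F a b1 b2) b" by simp
  qed
  also have "\<dots> = csum K H H (\<lambda>a b. csum K H H (\<lambda>a1 a2. F a1 a2 b) a) x"
    by (rule csum_coassoc[OF G tri x])
  also have "\<dots> = csum K H H (\<lambda>a b. S y \<bullet> S (counit H a \<cdot> b)) x"
  proof (rule cs[OF x])
    fix a b assume a: "a \<in> carrier H" and b: "b \<in> carrier H"
    have "csum K H H (\<lambda>a1 a2. F a1 a2 b) a =
        csum K H H (\<lambda>a1 a2. (S (a1 \<bullet> y) \<bullet> a2) \<bullet> S b) a"
      unfolding F_def using b y by (intro cs[OF a]) (simp add: m_assoc)
    also have "\<dots> = csum K H H (\<lambda>a1 a2. S (a1 \<bullet> y) \<bullet> a2) a \<bullet> S b"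
      using a b y by (intro csum_hom[OF G G rmult_ahom a, symmetric]) simp_all
    also have "\<dots> = S y \<bullet> S (counit H a \<cdot> b)"
      using a b y by (simp add: S_mult_aux smult_mult_right smult_mult_left module_hom_smult[OF antipode_hom])
    finally show "csum K H H (\<lambda>a1 a2. F a1 a2 b) a = S y \<bullet> S (counit H a \<cdot> b)" .
  qed
  also have "\<dots> = S y \<bullet> S x"
    using y by (intro csum_counit_left[OF G _ x] module_hom_ahom[where K = K] hom_intros) simp
  finally show ?thesis .
qed

end


section \<open>The quotient module coalgebra and its dual\<close>

lemma (in abelian_group) finsum_eq_lsum:
  "distinct xs \<Longrightarrow> f \<in> set xs \<rightarrow> carrier G \<Longrightarrow> finsum G f (set xs) = lsum G f xs"
  by (induction xs) (auto simp: Pi_def)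

text \<open>Linearity of the coordinates \<open>co\<close> follows from their uniqueness.\<close>

lemma (in vectorspace) fin_dim_dual_basis:
  assumes "fin_dim"
  shows "\<exists>L. set L \<subseteq> carrier V \<times> module_hom K V (self_module K) \<and>
    (\<forall>v\<in>carrier V. lsum V (\<lambda>(b, \<phi>). \<phi> v \<odot>\<^bsub>V\<^esub> b) L = v)"
proof -
  obtain \<beta> where \<beta>: "finite \<beta>" "basis \<beta>" using finite_basis_exists[OF assms] by blast
  then have \<beta>c: "\<beta> \<subseteq> carrier V" by (simp add: basis_def)
  have ex1: "\<exists>!a. a \<in> \<beta> \<rightarrow>\<^sub>E carrier K \<and> lincomb a \<beta> = v" if "v \<in> carrier V" for v
    using basis_criterion[OF \<beta>(1) \<beta>c] \<beta>(2) that by blast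
  define co where "co v = (THE a. a \<in> \<beta> \<rightarrow>\<^sub>E carrier K \<and> lincomb a \<beta> = v)" for v
  have co: "co v \<in> \<beta> \<rightarrow>\<^sub>E carrier K" "lincomb (co v) \<beta> = v" if "v \<in> carrier V" for v
    using theI'[OF ex1[OF that]] by (auto simp: co_def)
  have co_unique: "co v = a" if "a \<in> \<beta> \<rightarrow>\<^sub>E carrier K" "lincomb a \<beta> = v" for a v
  proof -
    have "lincomb a \<beta> \<in> carrier V" using that(1) \<beta>c by (intro lincomb_closed) auto
    then have v: "v \<in> carrier V" using that(2) by simp
    then show ?thesis using ex1[OF v] co[OF v] that by blast
  qed
  have cong: "lincomb (restrict a \<beta>) \<beta> = lincomb a \<beta>" if "a \<in> \<beta> \<rightarrow> carrier K" for a
    unfolding lincomb_def using that \<beta>c by (intro finsum_cong') auto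
  have co_add: "co (v \<oplus>\<^bsub>V\<^esub> w) = (\<lambda>b\<in>\<beta>. co v b \<oplus>\<^bsub>K\<^esub> co w b)" if vw: "v \<in> carrier V" "w \<in> carrier V" for v w
  proof (rule co_unique)
    have c: "co v \<in> \<beta> \<rightarrow> carrier K" "co w \<in> \<beta> \<rightarrow> carrier K" using co vw by auto
    show "(\<lambda>b\<in>\<beta>. co v b \<oplus>\<^bsub>K\<^esub> co w b) \<in> \<beta> \<rightarrow>\<^sub>E carrier K" using c by auto
    have "lincomb (\<lambda>b\<in>\<beta>. co v b \<oplus>\<^bsub>K\<^esub> co w b) \<beta> = lincomb (\<lambda>b. co v b \<oplus>\<^bsub>K\<^esub> co w b) \<beta>"
      using c by (intro cong) auto
    then show "lincomb (\<lambda>b\<in>\<beta>. co v b \<oplus>\<^bsub>K\<^esub> co w b) \<beta> = v \<oplus>\<^bsub>V\<^esub> w"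
      using lincomb_sum[OF \<beta>(1) \<beta>c c] co(2) vw by simp
  qed
  have co_smult: "co (k \<odot>\<^bsub>V\<^esub> v) = (\<lambda>b\<in>\<beta>. k \<otimes>\<^bsub>K\<^esub> co v b)" if vw: "k \<in> carrier K" "v \<in> carrier V" for k v
  proof (rule co_unique)
    have c: "co v \<in> \<beta> \<rightarrow> carrier K" using co vw by auto
    show "(\<lambda>b\<in>\<beta>. k \<otimes>\<^bsub>K\<^esub> co v b) \<in> \<beta> \<rightarrow>\<^sub>E carrier K" using c vw by auto
    have "lincomb (\<lambda>b\<in>\<beta>. k \<otimes>\<^bsub>K\<^esub> co v b) \<beta> = lincomb (\<lambda>b. k \<otimes>\<^bsub>K\<^esub> co v b) \<beta>"
      using c vw by (intro cong) auto
    then show "lincomb (\<lambda>b\<in>\<beta>. k \<otimes>\<^bsub>K\<^esub> co v b) \<beta> = k \<odot>\<^bsub>V\<^esub> v"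
      using lincomb_smult[OF \<beta>c c vw(1)] co(2) vw by simp
  qed
  obtain bs where bs: "set bs = \<beta>" "distinct bs" using finite_distinct_list[OF \<beta>(1)] by blast
  define L where "L = map (\<lambda>b. (b, \<lambda>v. co v b)) bs"
  have "(\<lambda>v. co v b) \<in> module_hom K V (self_module K)" if "b \<in> \<beta>" for b
    using that co(1) by (auto simp: module_hom_def self_module_def co_add co_smult)
  then have "set L \<subseteq> carrier V \<times> module_hom K V (self_module K)"
    using \<beta>c by (auto simp: L_def bs(1))
  moreover have "lsum V (\<lambda>(b, \<phi>). \<phi> v \<odot>\<^bsub>V\<^esub> b) L = v" if v: "v \<in> carrier V" for v
  proof -
    have "lsum V (\<lambda>(b, \<phi>). \<phi> v \<odot>\<^bsub>V\<^esub> b) L = lsum V (\<lambda>b. co v b \<odot>\<^bsub>V\<^esub> b) bs"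
      by (simp add: L_def lsum_map)
    also have "\<dots> = lincomb (co v) \<beta>"
      unfolding lincomb_def bs(1)[symmetric] using co(1)[OF v] \<beta>c bs
      by (intro finsum_eq_lsum[symmetric]) auto
    finally show ?thesis using co(2)[OF v] by simp
  qed
  ultimately show ?thesis by blast
qed

locale hopf_extension = hopf_algebra K H
  for K :: "('k, 'z) ring_scheme" (structure) and H :: "('k, 'h, 'x) hopf_scheme" (structure) and R :: "'h set" +
  assumes sub: "hopf_subalgebra K R H" and fin_dim_H: "vectorspace.fin_dim K H"
begin

lemma K_abelian: "abelian_group K" by (rule R.abelian_group_axioms)

lemma subring_R: "subring R H" using sub by (simp add: hopf_subalgebra_def)

lemma R_closed [simp]: "r \<in> R \<Longrightarrow> r \<in> carrier H"
  using subringE(1)[OF subring_R] by auto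

lemma R_add: "r \<in> R \<Longrightarrow> s \<in> R \<Longrightarrow> r \<oplus>\<^bsub>H\<^esub> s \<in> R"
  using subringE(7)[OF subring_R] .

lemma R_minus: "r \<in> R \<Longrightarrow> \<ominus>\<^bsub>H\<^esub> r \<in> R"
  using subringE(5)[OF subring_R] .

lemma R_one: "\<one>\<^bsub>H\<^esub> \<in> R"
  using subringE(3)[OF subring_R] .

lemma R_smult: "k \<in> carrier K \<Longrightarrow> r \<in> R \<Longrightarrow> k \<cdot> r \<in> R"
  using sub submodule.smult_closed subspace.submod by (fastforce simp: hopf_subalgebra_def)

lemma cop_R:
  assumes "r \<in> R"
  shows "\<exists>ps. set ps \<subseteq> R \<times> R \<and> comult H r = lsum (tensor K H H) (\<lambda>(a, b). pure_tensor K H H a b) ps"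
proof -
  have "comult H r \<in> generate (add_monoid (tensor K H H)) {pure_tensor K H H a b | a b. a \<in> R \<and> b \<in> R}"
    using sub assms by (simp add: hopf_subalgebra_def)
  then show ?thesis
  proof (induction rule: generate.induct)
    case one
    show ?case by (rule exI[of _ "[]"]) simp
  next
    case (incl h)
    then obtain a b where ab: "h = pure_tensor K H H a b" "a \<in> R" "b \<in> R" by blast
    have "h = lsum (tensor K H H) (\<lambda>(a, b). pure_tensor K H H a b) [(a, b)]"
      using ab T2.pure_closed[of a b] by simp
    then show ?case using ab by (intro exI[of _ "[(a, b)]"]) auto
  next
    case (inv h)
    then obtain a b where ab: "h = pure_tensor K H H a b" "a \<in> R" "b \<in> R" by blast
    have "inv\<^bsub>add_monoid (tensor K H H)\<^esub> h = pure_tensor K H H a (\<ominus>\<^bsub>H\<^esub> b)"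
      using ab by (simp add: T2.pure_minus a_inv_def[symmetric])
    also have "\<dots> = lsum (tensor K H H) (\<lambda>(a, b). pure_tensor K H H a b) [(a, \<ominus>\<^bsub>H\<^esub> b)]"
      using ab T2.pure_closed[of a "\<ominus>\<^bsub>H\<^esub> b"] by simp
    finally show ?case using ab R_minus by (intro exI[of _ "[(a, \<ominus>\<^bsub>H\<^esub> b)]"]) auto
  next
    case (eng h1 h2)
    then obtain ps qs where ps: "set ps \<subseteq> R \<times> R" "h1 = lsum (tensor K H H) (\<lambda>(a, b). pure_tensor K H H a b) ps"
      and qs: "set qs \<subseteq> R \<times> R" "h2 = lsum (tensor K H H) (\<lambda>(a, b). pure_tensor K H H a b) qs"
      by blast
    have "lsum (tensor K H H) (\<lambda>(a, b). pure_tensor K H H a b) (ps @ qs) = h1 \<oplus>\<^bsub>tensor K H H\<^esub> h2"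
      unfolding ps(2) qs(2) using ps(1) qs(1) by (intro T2.T.lsum_append) auto
    then show ?case using ps qs by (intro exI[of _ "ps @ qs"]) auto
  qed
qed

text \<open>As the coproduct of an element of \<^term>\<open>R\<close> lives in \<open>R \<otimes> R\<close>, a Sweedler sum over it only
  sees the values of the bilinear map on \<^term>\<open>R\<close>.\<close>

lemma csum_R_cong:
  assumes "abelian_group G" "bilin K H H G f" "bilin K H H G g" "r \<in> R"
    and "\<And>a b. a \<in> R \<Longrightarrow> b \<in> R \<Longrightarrow> f a b = g a b"
  shows "csum K H G f r = csum K H G g r"
proof -
  obtain ps where ps: "set ps \<subseteq> R \<times> R" "comult H r = lsum (tensor K H H) (\<lambda>(a, b). pure_tensor K H H a b) ps"
    using cop_R[OF assms(4)] by blast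
  have ps': "set ps \<subseteq> carrier H \<times> carrier H" using ps(1) by auto
  have "lsum G (\<lambda>(a, b). f a b) ps = lsum G (\<lambda>(a, b). g a b) ps"
    using ps(1) assms(5) by (intro lsum_cong) auto
  then show ?thesis
    using csum_eq_lsum[OF assms(1,2) R_closed[OF assms(4)] ps' ps(2)]
      csum_eq_lsum[OF assms(1,3) R_closed[OF assms(4)] ps' ps(2)] by simp
qed

abbreviation "J \<equiv> aug_right_ideal K H R"

lemma J_gens: "{r \<bullet> h | r h. r \<in> aug_ideal K H R \<and> h \<in> carrier H} \<subseteq> carrier H"
  by (auto simp: aug_ideal_def)

sublocale J: abelian_subgroup J H
proof (rule abelian_subgroupI3)
  show "additive_subgroup J H"
    unfolding aug_right_ideal_def
    by (rule additive_subgroupI, rule group.generate_is_subgroup[OF a_group]) (use J_gens in simp)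
qed (rule H_abelian)

lemma J_gen: "r \<in> R \<Longrightarrow> counit H r = \<zero> \<Longrightarrow> h \<in> carrier H \<Longrightarrow> r \<bullet> h \<in> J"
  unfolding aug_right_ideal_def by (rule generate.incl) (auto simp: aug_ideal_def)

text \<open>The elements that \<open>\<phi>\<close> sends into a subgroup form a subgroup, so the generators \<open>r h\<close> with
  \<open>\<epsilon>(r) = 0\<close> decide. All properties of the right ideal \<open>J = R\<^sup>+H\<close> are obtained in this way.\<close>

lemma J_hom_into:
  assumes G: "abelian_group G" and \<phi>: "\<phi> \<in> ahom H G" and N: "subgroup N (add_monoid G)"
    and gens: "\<And>r h. r \<in> R \<Longrightarrow> counit H r = \<zero> \<Longrightarrow> h \<in> carrier H \<Longrightarrow> \<phi> (r \<bullet> h) \<in> N"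
    and x: "x \<in> J"
  shows "\<phi> x \<in> N"
proof -
  interpret N: subgroup N "add_monoid G" by fact
  have "x \<in> carrier H \<and> \<phi> x \<in> N"
    using x unfolding aug_right_ideal_def
  proof (induction rule: generate.induct)
    case one
    show ?case using N.one_closed ahom_zero[OF H_abelian G \<phi>] by simp
  next
    case (incl h)
    then show ?case using gens by (auto simp: aug_ideal_def)
  next
    case (inv h)
    then obtain r y where h: "h = r \<bullet> y" "r \<in> R" "counit H r = \<zero>" "y \<in> carrier H"
      by (auto simp: aug_ideal_def)
    have "\<phi> (\<ominus>\<^bsub>H\<^esub> h) = \<ominus>\<^bsub>G\<^esub> \<phi> h"
      using h by (intro ahom_minus[OF H_abelian G \<phi>]) simp
    then show ?case using h gens N.m_inv_closed by (simp add: a_inv_def)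
  next
    case (eng h1 h2)
    then show ?case using N.m_closed ahom_add[OF \<phi>] by simp
  qed
  then show ?thesis by simp
qed

lemma J_vanish:
  assumes G: "abelian_group G" and \<phi>: "\<phi> \<in> ahom H G" 
    and gens: "\<And>r h. r \<in> R \<Longrightarrow> counit H r = \<zero> \<Longrightarrow> h \<in> carrier H \<Longrightarrow> \<phi> (r \<bullet> h) = \<zero>\<^bsub>G\<^esub>"
    and x: "x \<in> J"
  shows "\<phi> x = \<zero>\<^bsub>G\<^esub>"
proof -
  interpret G: abelian_group G by fact
  have "subgroup {\<zero>\<^bsub>G\<^esub>} (add_monoid G)" using group.triv_subgroup[OF G.a_group] by simp
  from J_hom_into[OF G \<phi> this _ x] gens show ?thesis by simp
qed

lemma J_rmult: "x \<in> J \<Longrightarrow> y \<in> carrier H \<Longrightarrow> x \<bullet> y \<in> J"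
  by (rule J_hom_into[OF H_abelian rmult_ahom J.a_subgroup, rotated -1])
    (simp_all add: m_assoc J_gen)

lemma smult_ahom: "k \<in> carrier K \<Longrightarrow> (\<lambda>x. k \<cdot> x) \<in> ahom H H"
  by (auto intro!: ahomI simp: smult_r_distr)

lemma J_smult: "x \<in> J \<Longrightarrow> k \<in> carrier K \<Longrightarrow> k \<cdot> x \<in> J"
  by (rule J_hom_into[OF H_abelian smult_ahom J.a_subgroup, rotated -1])
    (simp_all add: smult_mult_right[symmetric] J_gen)

lemma counit_ahom: "counit H \<in> ahom H K"
  by (auto intro!: ahomI simp: counit_add)

lemma counit_J: "x \<in> J \<Longrightarrow> counit H x = \<zero>"
  by (rule J_vanish[OF K_abelian counit_ahom]) (simp_all add: counit_mult)

abbreviation cls :: "'h \<Rightarrow> 'h set" where "cls x \<equiv> J +>\<^bsub>H\<^esub> x"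
abbreviation "Qm \<equiv> quot_module H J"
abbreviation "Qc \<equiv> Q_coalg K H R"

lemma cls_eq_iff: "x \<in> carrier H \<Longrightarrow> y \<in> carrier H \<Longrightarrow> cls x = cls y \<longleftrightarrow> x \<ominus>\<^bsub>H\<^esub> y \<in> J"
  by (metis J.a_rcos_module J.a_rcos_self J.a_repr_independence' a_minus_def)

lemma carrier_Qm: "carrier Qm = cls ` carrier H"
  by (auto simp: quot_module_def A_RCOSETS_def')

lemma cls_closed [simp]: "x \<in> carrier H \<Longrightarrow> cls x \<in> carrier Qm"
  by (simp add: carrier_Qm)

lemma the_elem_cls:
  assumes x: "x \<in> carrier H" and "\<And>y. y \<in> carrier H \<Longrightarrow> y \<ominus>\<^bsub>H\<^esub> x \<in> J \<Longrightarrow> F y = F x"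
  shows "the_elem (F ` cls x) = F x"
proof -
  have "F ` cls x = {F x}"
  proof
    show "F ` cls x \<subseteq> {F x}"
      using assms J.a_rcos_module_imp[OF x] J.a_elemrcos_carrier[OF x] by (auto simp: a_minus_def)
    show "{F x} \<subseteq> F ` cls x" using J.a_rcos_self[OF x] by auto
  qed
  then show ?thesis by simp
qed

lemma the_elem_cls_ahom:
  assumes "abelian_group G" "\<phi> \<in> ahom H G" "x \<in> carrier H" "\<And>y. y \<in> J \<Longrightarrow> \<phi> y = \<zero>\<^bsub>G\<^esub>"
  shows "the_elem (\<phi> ` cls x) = \<phi> x"
proof (rule the_elem_cls[OF assms(3)])
  interpret G: abelian_group G by fact
  fix y assume y: "y \<in> carrier H" "y \<ominus>\<^bsub>H\<^esub> x \<in> J"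
  have "\<phi> (y \<ominus>\<^bsub>H\<^esub> x) = \<phi> y \<ominus>\<^bsub>G\<^esub> \<phi> x"
    using y assms(3) by (simp add: a_minus_def ahom_add[OF assms(2)] ahom_minus[OF H_abelian assms(1,2)])
  then show "\<phi> y = \<phi> x"
    using assms(4)[OF y(2)] y(1) assms(3) ahom_closed[OF assms(2)] G.minus_eq_zero_iff by metis
qed

lemma cls_add: "x \<in> carrier H \<Longrightarrow> y \<in> carrier H \<Longrightarrow> cls x \<oplus>\<^bsub>Qm\<^esub> cls y = cls (x \<oplus>\<^bsub>H\<^esub> y)"
  by (simp add: quot_module_def J.a_rcos_sum)

lemma cls_zero: "\<zero>\<^bsub>Qm\<^esub> = cls \<zero>\<^bsub>H\<^esub>"
  using J.a_rcos_const[OF J.zero_closed] by (simp add: quot_module_def)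

lemma cls_smult:
  assumes "k \<in> carrier K" "x \<in> carrier H" shows "k \<odot>\<^bsub>Qm\<^esub> cls x = cls (k \<cdot> x)"
proof -
  have "the_elem ((\<lambda>x. cls (k \<cdot> x)) ` cls x) = cls (k \<cdot> x)"
  proof (rule the_elem_cls[OF assms(2)])
    fix y assume y: "y \<in> carrier H" "y \<ominus>\<^bsub>H\<^esub> x \<in> J"
    have "k \<cdot> y \<ominus>\<^bsub>H\<^esub> k \<cdot> x = k \<cdot> (y \<ominus>\<^bsub>H\<^esub> x)"
      using y assms by (simp add: a_minus_def smult_r_distr smult_r_minus)
    then show "cls (k \<cdot> y) = cls (k \<cdot> x)"
      using y assms J_smult by (subst cls_eq_iff) auto
  qed
  then show ?thesis by (simp add: quot_module_def)
qed

lemma vectorspace_Qm: "vectorspace K Qm"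
proof (rule vs_criteria)
  show "\<forall>v\<in>carrier Qm. \<exists>neg_v\<in>carrier Qm. v \<oplus>\<^bsub>Qm\<^esub> neg_v = \<zero>\<^bsub>Qm\<^esub>"
  proof
    fix v assume "v \<in> carrier Qm"
    then obtain x where x: "v = cls x" "x \<in> carrier H" by (auto simp: carrier_Qm)
    then show "\<exists>neg_v\<in>carrier Qm. v \<oplus>\<^bsub>Qm\<^esub> neg_v = \<zero>\<^bsub>Qm\<^esub>"
      by (intro bexI[of _ "cls (\<ominus>\<^bsub>H\<^esub> x)"]) (simp_all add: cls_add cls_zero r_neg)
  qed
  show "field K" by unfold_locales
qed (auto simp: carrier_Qm cls_add cls_zero cls_smult a_ac smult_l_distr smult_r_distr smult_assoc1)

sublocale Qm: vectorspace K Qm by (rule vectorspace_Qm)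

lemma cls_hom: "cls \<in> module_hom K H Qm"
  by (auto simp: module_hom_def cls_add cls_smult)

lemma cls_ahom: "cls \<in> ahom H Qm" by (rule module_hom_ahom[OF cls_hom])

lemma cls_J: "x \<in> J \<Longrightarrow> cls x = \<zero>\<^bsub>Qm\<^esub>"
  by (simp add: J.a_rcos_const quot_module_def)

text \<open>\<open>r - \<epsilon>(r) 1\<close> lies in \<open>R\<^sup>+\<close>.\<close>

lemma cls_R_mult:
  assumes "r \<in> R" "h \<in> carrier H" shows "cls (r \<bullet> h) = cls (counit H r \<cdot> h)"
proof -
  let ?r = "r \<oplus>\<^bsub>H\<^esub> \<ominus>\<^bsub>H\<^esub> (counit H r \<cdot> \<one>\<^bsub>H\<^esub>)"
  have "?r \<in> R" using assms by (intro R_add R_minus R_smult R_one) auto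
  moreover have "counit H ?r = \<zero>"
  proof -
    have "counit H ?r = counit H r \<oplus> \<ominus> counit H r"
      using assms ahom_minus[OF H_abelian K_abelian counit_ahom]
      by (simp add: counit_add counit_smult counit_one)
    then show ?thesis using assms by (simp add: R.r_neg)
  qed
  ultimately have "?r \<bullet> h \<in> J" using assms by (intro J_gen)
  moreover have "?r \<bullet> h = r \<bullet> h \<ominus>\<^bsub>H\<^esub> counit H r \<cdot> h"
    using assms by (simp add: l_distr l_minus smult_mult_left a_minus_def)
  ultimately show ?thesis using assms by (subst cls_eq_iff) auto
qed

lemma carrier_Qc: "carrier Qc = carrier Qm"
  and add_Qc: "add Qc = add Qm" and smult_Qc: "smult Qc = smult Qm" and zero_Qc: "zero Qc = zero Qm"
  by (simp_all add: Q_coalg_def quot_coalgebra_def module.defs)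

sublocale QQ: tensor_product K Qm Qm by (rule tensor_product.intro) (rule Qm.module.module_axioms)+

lemma tensor_rels_Qc: "tensor_rels K Qc Qc = tensor_rels K Qm Qm"
  and tensor_gens_Qc: "tensor_gens Qc Qc = tensor_gens Qm Qm"
  by (simp_all add: tensor_rels_def tensor_gens_def carrier_Qc add_Qc smult_Qc)

lemma bilin_pure_cls: "bilin K H H (tensor K Qm Qm) (\<lambda>a b. pure_tensor K Qm Qm (cls a) (cls b))"
  by (rule bilin_precomp[OF QQ.bilin_pure cls_hom cls_hom])

text \<open>\<open>J\<close> is a coideal, which makes the coproduct of the quotient well defined: in the class of
  \<open>r\<^sub>(\<^sub>1\<^sub>) h\<^sub>(\<^sub>1\<^sub>) \<otimes> r\<^sub>(\<^sub>2\<^sub>) h\<^sub>(\<^sub>2\<^sub>)\<close> both legs of \<open>r\<close> act through the counit, and the two counits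
  combine to \<open>\<epsilon>(r)\<close>.\<close>

lemma csum_cls_J:
  assumes x: "x \<in> J"
  shows "csum K H (tensor K Qm Qm) (\<lambda>a b. pure_tensor K Qm Qm (cls a) (cls b)) x = \<zero>\<^bsub>tensor K Qm Qm\<^esub>"
proof (rule J_vanish[OF QQ.T.abelian_group_T csum_ahom[OF QQ.T.abelian_group_T bilin_pure_cls] _ x])
  let ?T = "tensor K Qm Qm" and ?p = "pure_tensor K Qm Qm"
  note TG = QQ.T.abelian_group_T
  fix r h assume r: "r \<in> R" and r0: "counit H r = \<zero>" and h: "h \<in> carrier H"
  \<comment> \<open>Once both legs of \<open>r\<close> act through the counit, the sum over \<open>r\<close> is \<open>\<psi>\<close> at
    \<open>\<epsilon>(r\<^sub>(\<^sub>1\<^sub>)) r\<^sub>(\<^sub>2\<^sub>) = r\<close>.\<close>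
  define \<psi> where "\<psi> b = csum K H ?T (\<lambda>c d. ?p (cls c) (cls (counit H b \<cdot> d))) h" for b
  have sm: "smult H k \<in> module_hom K H H" if "k \<in> carrier K" for k
    using that by (auto intro!: module_homI smult_ahom simp: smult_assoc1[symmetric] R.m_comm)
  have \<psi>: "\<psi> \<in> ahom H ?T"
    unfolding \<psi>_def csum_def
    by (rule ahom_lsum_fun[OF TG])
      (use cop[OF h] in \<open>auto intro!: ahomI simp: counit_add smult_l_distr cls_add[symmetric]
          ahom_add[OF bilinD(2)[OF QQ.bilin_pure]]\<close>)
  have b1: "bilin K H H ?T (\<lambda>a b. csum K H ?T (\<lambda>c d. ?p (cls (a \<bullet> c)) (cls (b \<bullet> d))) h)"
    by (intro bilin_csum_fun[OF TG h] bilin_precomp[OF bilin_pure_cls] hom_intros)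
  have "bilin K H H ?T (\<lambda>a b. \<psi> (counit H a \<cdot> b))"
    by (rule bilin_comp[OF bilin_counit_left \<psi>])
  have "csum K H ?T (\<lambda>a b. ?p (cls a) (cls b)) (r \<bullet> h) =
      csum K H ?T (\<lambda>a b. csum K H ?T (\<lambda>c d. ?p (cls (a \<bullet> c)) (cls (b \<bullet> d))) h) r"
    using r h by (intro csum_mult[OF TG bilin_pure_cls]) auto
  also have "\<dots> = csum K H ?T (\<lambda>a b. \<psi> (counit H a \<cdot> b)) r"
  proof (rule csum_R_cong[OF TG b1 bilin_comp[OF bilin_counit_left \<psi>] r])
    fix a b assume a: "a \<in> R" and b: "b \<in> R"
    show "csum K H ?T (\<lambda>c d. ?p (cls (a \<bullet> c)) (cls (b \<bullet> d))) h = \<psi> (counit H a \<cdot> b)"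
      unfolding \<psi>_def
    proof (rule csum_cong[OF h])
      fix c d assume c: "c \<in> carrier H" "d \<in> carrier H"
      have "?p (cls (a \<bullet> c)) (cls (b \<bullet> d)) = ?p (counit H a \<odot>\<^bsub>Qm\<^esub> cls c) (cls (counit H b \<cdot> d))"
        using a b c by (simp add: cls_R_mult cls_smult)
      also have "\<dots> = ?p (cls c) (counit H a \<odot>\<^bsub>Qm\<^esub> cls (counit H b \<cdot> d))"
        using a b c by (intro bilinD(3)[OF QQ.bilin_pure]) auto
      also have "\<dots> = ?p (cls c) (cls (counit H (counit H a \<cdot> b) \<cdot> d))"
        using a b c by (simp add: cls_smult counit_smult smult_assoc1)
      finally show "?p (cls (a \<bullet> c)) (cls (b \<bullet> d)) =
        ?p (cls c) (cls (counit H (counit H a \<cdot> b) \<cdot> d))" .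
    qed
  qed
  also have "\<dots> = \<psi> r" using r by (intro csum_counit_left[OF TG \<psi>]) auto
  also have "\<dots> = csum K H ?T (\<lambda>c d. \<zero>\<^bsub>?T\<^esub>) h"
    unfolding \<psi>_def r0
  proof (rule csum_cong[OF h])
    fix c d assume c: "c \<in> carrier H" "d \<in> carrier H"
    show "?p (cls c) (cls (\<zero> \<cdot> d)) = \<zero>\<^bsub>?T\<^esub>"
      using c ahom_zero[OF Qm.abelian_group_axioms TG bilinD(2)[OF QQ.bilin_pure, of "cls c"]]
      by (simp add: cls_zero)
  qed
  also have "\<dots> = \<zero>\<^bsub>?T\<^esub>" by (simp add: csum_def split_def QQ.T.lsum_zero)
  finally show "csum K H ?T (\<lambda>a b. ?p (cls a) (cls b)) (r \<bullet> h) = \<zero>\<^bsub>?T\<^esub>" .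
qed

lemma comult_Qc:
  assumes x: "x \<in> carrier H"
  shows "comult Qc (cls x) = csum K H (tensor K Qm Qm) (\<lambda>a b. pure_tensor K Qm Qm (cls a) (cls b)) x"
proof -
  let ?T = "tensor K Qm Qm" and ?f = "\<lambda>a b. pure_tensor K Qm Qm (cls a) (cls b)"
  note TG = QQ.T.abelian_group_T
  have "comult Qc (cls x) = the_elem (sweedler K H ?T ?f ` cls x)"
    by (simp add: Q_coalg_def quot_coalgebra_def module.defs)
  also have "sweedler K H ?T ?f ` cls x = (\<lambda>y. csum K H ?T ?f y) ` cls x"
    by (rule image_cong) (auto simp: sweedler_eq_csum[OF TG bilin_pure_cls] J.a_elemrcos_carrier[OF x])
  also have "the_elem \<dots> = csum K H ?T ?f x"
    by (rule the_elem_cls_ahom[OF TG csum_ahom[OF TG bilin_pure_cls] x csum_cls_J])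
  finally show ?thesis .
qed

lemma sweedler_Qc:
  assumes G: "abelian_group G" and f: "bilin K Qm Qm G f" and x: "x \<in> carrier H"
  shows "sweedler K Qc G f (cls x) = csum K H G (\<lambda>a b. f (cls a) (cls b)) x"
proof -
  have "sweedler K Qc G f (cls x) = tensor_lift K Qm Qm G f (comult Qc (cls x))"
    by (simp add: sweedler_def tensor_lift_def tensor_rels_Qc tensor_gens_Qc)
  also have "\<dots> = csum K H G (\<lambda>a b. tensor_lift K Qm Qm G f (pure_tensor K Qm Qm (cls a) (cls b))) x"
    unfolding comult_Qc[OF x]
    by (rule csum_hom[OF QQ.T.abelian_group_T G QQ.tensor_lift_ahom[OF G f] x]) auto
  also have "\<dots> = csum K H G (\<lambda>a b. f (cls a) (cls b)) x"
    by (rule csum_cong[OF x]) (simp add: QQ.tensor_lift_pure[OF G f])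
  finally show ?thesis .
qed

lemma counit_Qc: "x \<in> carrier H \<Longrightarrow> counit Qc (cls x) = counit H x"
  using the_elem_cls_ahom[OF K_abelian counit_ahom _ counit_J]
  by (simp add: Q_coalg_def quot_coalgebra_def module.defs)

lemma Q_act_cls:
  assumes "x \<in> carrier H" "h \<in> carrier H"
  shows "Q_act K H R (cls x) h = cls (x \<bullet> h)"
  unfolding Q_act_def quot_act_def
proof (rule the_elem_cls[OF assms(1)])
  fix y assume y: "y \<in> carrier H" "y \<ominus>\<^bsub>H\<^esub> x \<in> J"
  have "y \<bullet> h \<ominus>\<^bsub>H\<^esub> x \<bullet> h = (y \<ominus>\<^bsub>H\<^esub> x) \<bullet> h"
    using y assms by (simp add: a_minus_def l_distr l_minus)
  then show "cls (y \<bullet> h) = cls (x \<bullet> h)"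
    using y assms J_rmult by (subst cls_eq_iff) auto
qed

abbreviation "Qd \<equiv> Q_dual_op K H R"
abbreviation "act \<equiv> Q_dual_act K H R"

lemma Qd_defs:
  "carrier Qd = module_hom K Qc (self_module K) \<inter> extensional (carrier Qc)"
  "\<theta> \<otimes>\<^bsub>Qd\<^esub> \<gamma> = (\<lambda>x\<in>carrier Qc. sweedler K Qc K (\<lambda>x1 x2. \<theta> x2 \<otimes> \<gamma> x1) x)"
  "\<one>\<^bsub>Qd\<^esub> = (\<lambda>x\<in>carrier Qc. counit Qc x)" "\<zero>\<^bsub>Qd\<^esub> = (\<lambda>x\<in>carrier Qc. \<zero>)"
  "\<theta> \<oplus>\<^bsub>Qd\<^esub> \<gamma> = (\<lambda>x\<in>carrier Qc. \<theta> x \<oplus> \<gamma> x)"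
  "c \<odot>\<^bsub>Qd\<^esub> \<theta> = (\<lambda>x\<in>carrier Qc. c \<otimes> \<theta> x)"
  by (simp_all add: Q_dual_op_def dual_op_def)

lemma QdI:
  assumes "\<theta> \<in> extensional (carrier Qm)"
    and "\<And>x. x \<in> carrier H \<Longrightarrow> \<theta> (cls x) \<in> carrier K"
    and "\<And>x y. x \<in> carrier H \<Longrightarrow> y \<in> carrier H \<Longrightarrow> \<theta> (cls (x \<oplus>\<^bsub>H\<^esub> y)) = \<theta> (cls x) \<oplus> \<theta> (cls y)"
    and "\<And>k x. k \<in> carrier K \<Longrightarrow> x \<in> carrier H \<Longrightarrow> \<theta> (cls (k \<cdot> x)) = k \<otimes> \<theta> (cls x)"
  shows "\<theta> \<in> carrier Qd"
  using assms by (auto simp: Qd_defs module_hom_def self_module_def carrier_Qc add_Qc smult_Qc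
      carrier_Qm cls_add cls_smult)

lemma QdD:
  assumes "\<theta> \<in> carrier Qd"
  shows "x \<in> carrier H \<Longrightarrow> \<theta> (cls x) \<in> carrier K"
    and "x \<in> carrier H \<Longrightarrow> y \<in> carrier H \<Longrightarrow> \<theta> (cls (x \<oplus>\<^bsub>H\<^esub> y)) = \<theta> (cls x) \<oplus> \<theta> (cls y)"
    and "k \<in> carrier K \<Longrightarrow> x \<in> carrier H \<Longrightarrow> \<theta> (cls (k \<cdot> x)) = k \<otimes> \<theta> (cls x)"
    and "\<theta> \<in> extensional (carrier Qm)"
  using assms
  by (auto simp: Qd_defs module_hom_def self_module_def carrier_Qc add_Qc smult_Qc Pi_def
      cls_add[symmetric] cls_smult[symmetric])

lemma Qd_R_mult: "\<theta> \<in> carrier Qd \<Longrightarrow> r \<in> R \<Longrightarrow> x \<in> carrier H \<Longrightarrow>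
    \<theta> (cls (r \<bullet> x)) = counit H r \<otimes> \<theta> (cls x)"
  by (simp add: cls_R_mult QdD)

lemma Qd_ext:
  assumes "\<theta> \<in> extensional (carrier Qm)" "\<gamma> \<in> extensional (carrier Qm)"
    "\<And>x. x \<in> carrier H \<Longrightarrow> \<theta> (cls x) = \<gamma> (cls x)"
  shows "\<theta> = \<gamma>"
  using assms by (intro extensionalityI[of _ "carrier Qm"]) (auto simp: carrier_Qm)

lemma Qd_extensional [simp]:
  "\<theta> \<otimes>\<^bsub>Qd\<^esub> \<gamma> \<in> extensional (carrier Qm)" "\<one>\<^bsub>Qd\<^esub> \<in> extensional (carrier Qm)"
  "\<zero>\<^bsub>Qd\<^esub> \<in> extensional (carrier Qm)" "\<theta> \<oplus>\<^bsub>Qd\<^esub> \<gamma> \<in> extensional (carrier Qm)"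
  "c \<odot>\<^bsub>Qd\<^esub> \<theta> \<in> extensional (carrier Qm)" "act h \<theta> \<in> extensional (carrier Qm)"
  by (simp_all add: Qd_defs Q_dual_act_def carrier_Qc)

lemma bilin_Qd_mult:
  assumes "\<theta> \<in> carrier Qd" "\<gamma> \<in> carrier Qd"
  shows "bilin K Qm Qm K (\<lambda>x1 x2. \<theta> x2 \<otimes> \<gamma> x1)"
  by (rule bilinI; (rule ahomI)?)
    (use QdD[OF assms(1)] QdD[OF assms(2)] in
      \<open>auto simp: carrier_Qm cls_add cls_smult R.l_distr R.r_distr R.m_ac\<close>)

lemma Qd_eval:
  "x \<in> carrier H \<Longrightarrow> (\<theta> \<oplus>\<^bsub>Qd\<^esub> \<gamma>) (cls x) = \<theta> (cls x) \<oplus> \<gamma> (cls x)"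
  "x \<in> carrier H \<Longrightarrow> (c \<odot>\<^bsub>Qd\<^esub> \<theta>) (cls x) = c \<otimes> \<theta> (cls x)"
  "x \<in> carrier H \<Longrightarrow> \<zero>\<^bsub>Qd\<^esub> (cls x) = \<zero>"
  "x \<in> carrier H \<Longrightarrow> \<one>\<^bsub>Qd\<^esub> (cls x) = counit H x"
  "x \<in> carrier H \<Longrightarrow> h \<in> carrier H \<Longrightarrow> act h \<theta> (cls x) = \<theta> (cls (x \<bullet> h))"
  "x \<in> carrier H \<Longrightarrow> \<theta> \<in> carrier Qd \<Longrightarrow> \<gamma> \<in> carrier Qd \<Longrightarrow>
    (\<theta> \<otimes>\<^bsub>Qd\<^esub> \<gamma>) (cls x) = csum K H K (\<lambda>a b. \<theta> (cls b) \<otimes> \<gamma> (cls a)) x"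
  by (simp_all add: Qd_defs carrier_Qc counit_Qc Q_dual_act_def Q_act_cls
      sweedler_Qc[OF K_abelian bilin_Qd_mult])

lemma module_Qd: "module K Qd"
proof -
  have "abelian_group Qd"
  proof (rule abelian_groupI)
    fix \<theta> assume t: "\<theta> \<in> carrier Qd"
    show "\<exists>\<gamma>\<in>carrier Qd. \<gamma> \<oplus>\<^bsub>Qd\<^esub> \<theta> = \<zero>\<^bsub>Qd\<^esub>"
    proof
      show "(\<ominus> \<one>) \<odot>\<^bsub>Qd\<^esub> \<theta> \<in> carrier Qd"
        using QdD[OF t] by (intro QdI) (simp_all add: Qd_eval R.r_distr R.m_lcomm)
      show "(\<ominus> \<one>) \<odot>\<^bsub>Qd\<^esub> \<theta> \<oplus>\<^bsub>Qd\<^esub> \<theta> = \<zero>\<^bsub>Qd\<^esub>"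
        using QdD[OF t] by (intro Qd_ext) (simp_all add: Qd_eval R.l_minus R.l_neg)
    qed
  qed (auto intro!: QdI Qd_ext simp: Qd_eval QdD R.a_ac R.r_distr R.zero_closed)
  then show ?thesis
    by (intro moduleI R.is_cring)
      (auto intro!: QdI Qd_ext simp: Qd_eval QdD R.r_distr R.l_distr R.m_ac)
qed

sublocale Qd: module K Qd by (rule module_Qd)

lemma one_Qd: "\<one>\<^bsub>Qd\<^esub> \<in> carrier Qd"
  by (rule QdI) (simp_all add: Qd_eval counit_add counit_smult)

lemma act_closed: "h \<in> carrier H \<Longrightarrow> \<gamma> \<in> carrier Qd \<Longrightarrow> act h \<gamma> \<in> carrier Qd"
  by (rule QdI) (simp_all add: Qd_eval QdD l_distr smult_mult_left)

lemma act_hom_left: "\<gamma> \<in> carrier Qd \<Longrightarrow> (\<lambda>h. act h \<gamma>) \<in> module_hom K H Qd"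
  by (intro module_homI ahomI Qd_ext) (simp_all add: act_closed Qd_eval QdD r_distr smult_mult_right)

lemma act_hom_right: "h \<in> carrier H \<Longrightarrow> act h \<in> module_hom K Qd Qd"
  by (intro module_homI ahomI Qd_ext) (simp_all add: act_closed Qd_eval QdD)

lemma bilin_Qd_mult_cls:
  assumes "\<theta> \<in> carrier Qd" "\<gamma> \<in> carrier Qd"
  shows "bilin K H H K (\<lambda>a b. \<theta> (cls b) \<otimes> \<gamma> (cls a))"
  using bilin_precomp[OF bilin_Qd_mult[OF assms] cls_hom cls_hom] .

lemma K_lmult_ahom: "k \<in> carrier K \<Longrightarrow> (\<lambda>x. k \<otimes> x) \<in> ahom K K"
  by (auto intro!: ahomI simp: R.r_distr)

lemma Qd_mult_closed:
  assumes t: "\<theta> \<in> carrier Qd" and g: "\<gamma> \<in> carrier Qd" shows "\<theta> \<otimes>\<^bsub>Qd\<^esub> \<gamma> \<in> carrier Qd"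
proof (rule QdI)
  note b = bilin_Qd_mult_cls[OF t g] and cs = csum_ahom[OF K_abelian bilin_Qd_mult_cls[OF t g]]
  show "(\<theta> \<otimes>\<^bsub>Qd\<^esub> \<gamma>) (cls x) \<in> carrier K" if "x \<in> carrier H" for x
    using that ahom_closed[OF cs] t g by (simp add: Qd_eval)
  show "(\<theta> \<otimes>\<^bsub>Qd\<^esub> \<gamma>) (cls (x \<oplus>\<^bsub>H\<^esub> y)) = (\<theta> \<otimes>\<^bsub>Qd\<^esub> \<gamma>) (cls x) \<oplus> (\<theta> \<otimes>\<^bsub>Qd\<^esub> \<gamma>) (cls y)"
    if "x \<in> carrier H" "y \<in> carrier H" for x y
    using that ahom_add[OF cs] t g by (simp add: Qd_eval)
  show "(\<theta> \<otimes>\<^bsub>Qd\<^esub> \<gamma>) (cls (k \<cdot> x)) = k \<otimes> (\<theta> \<otimes>\<^bsub>Qd\<^esub> \<gamma>) (cls x)"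
    if k: "k \<in> carrier K" and x: "x \<in> carrier H" for k x
  proof -
    have "(\<theta> \<otimes>\<^bsub>Qd\<^esub> \<gamma>) (cls (k \<cdot> x)) =
        csum K H K (\<lambda>a b. \<theta> (cls b) \<otimes> \<gamma> (cls (k \<cdot> a))) x"
      using k x t g by (simp add: Qd_eval csum_smult[OF K_abelian b])
    also have "\<dots> = csum K H K (\<lambda>a b. k \<otimes> (\<theta> (cls b) \<otimes> \<gamma> (cls a))) x"
      using k QdD[OF t] QdD[OF g] by (intro csum_cong[OF x]) (simp add: R.m_ac)
    also have "\<dots> = k \<otimes> csum K H K (\<lambda>a b. \<theta> (cls b) \<otimes> \<gamma> (cls a)) x"
      using QdD[OF t] QdD[OF g]
      by (intro csum_hom[OF K_abelian K_abelian K_lmult_ahom[OF k] x, symmetric]) auto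
    finally show ?thesis using x t g by (simp add: Qd_eval)
  qed
qed simp

lemma csum_K_add:
  assumes "x \<in> carrier H" "\<And>a b. a \<in> carrier H \<Longrightarrow> b \<in> carrier H \<Longrightarrow> f a b \<in> carrier K"
    "\<And>a b. a \<in> carrier H \<Longrightarrow> b \<in> carrier H \<Longrightarrow> g a b \<in> carrier K"
  shows "csum K H K (\<lambda>a b. f a b \<oplus> g a b) x = csum K H K f x \<oplus> csum K H K g x"
  unfolding csum_def split_def using cop[OF assms(1)] assms(2,3)
  by (intro R.lsum_add) auto

lemma Qd_mult_hom_left:
  assumes g: "\<gamma> \<in> carrier Qd" shows "(\<lambda>\<theta>. \<theta> \<otimes>\<^bsub>Qd\<^esub> \<gamma>) \<in> module_hom K Qd Qd"
proof (intro module_homI ahomI Qd_ext)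
  fix \<theta> \<eta> x assume t: "\<theta> \<in> carrier Qd" "\<eta> \<in> carrier Qd" and x: "x \<in> carrier H"
  have "((\<theta> \<oplus>\<^bsub>Qd\<^esub> \<eta>) \<otimes>\<^bsub>Qd\<^esub> \<gamma>) (cls x) =
      csum K H K (\<lambda>a b. \<theta> (cls b) \<otimes> \<gamma> (cls a) \<oplus> \<eta> (cls b) \<otimes> \<gamma> (cls a)) x"
    using t x g by (simp add: Qd_eval) (auto intro!: csum_cong simp: Qd_eval QdD R.l_distr)
  then show "((\<theta> \<oplus>\<^bsub>Qd\<^esub> \<eta>) \<otimes>\<^bsub>Qd\<^esub> \<gamma>) (cls x) = ((\<theta> \<otimes>\<^bsub>Qd\<^esub> \<gamma>) \<oplus>\<^bsub>Qd\<^esub> (\<eta> \<otimes>\<^bsub>Qd\<^esub> \<gamma>)) (cls x)"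
    using t x g by (simp add: csum_K_add QdD Qd_eval)
next
  fix k \<theta> x assume k: "k \<in> carrier K" and t: "\<theta> \<in> carrier Qd" and x: "x \<in> carrier H"
  have "((k \<odot>\<^bsub>Qd\<^esub> \<theta>) \<otimes>\<^bsub>Qd\<^esub> \<gamma>) (cls x) = csum K H K (\<lambda>a b. k \<otimes> (\<theta> (cls b) \<otimes> \<gamma> (cls a))) x"
    using t x g k by (simp add: Qd_eval) (auto intro!: csum_cong simp: Qd_eval QdD R.m_assoc)
  also have "\<dots> = k \<otimes> csum K H K (\<lambda>a b. \<theta> (cls b) \<otimes> \<gamma> (cls a)) x"
    using QdD[OF t] QdD[OF g]
    by (intro csum_hom[OF K_abelian K_abelian K_lmult_ahom[OF k] x, symmetric]) auto
  finally show "((k \<odot>\<^bsub>Qd\<^esub> \<theta>) \<otimes>\<^bsub>Qd\<^esub> \<gamma>) (cls x) = (k \<odot>\<^bsub>Qd\<^esub> (\<theta> \<otimes>\<^bsub>Qd\<^esub> \<gamma>)) (cls x)"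
    using t x g by (simp add: Qd_eval)
qed (simp_all add: Qd_mult_closed g)

lemma Qd_mult_hom_right:
  assumes t: "\<theta> \<in> carrier Qd" shows "(\<lambda>\<gamma>. \<theta> \<otimes>\<^bsub>Qd\<^esub> \<gamma>) \<in> module_hom K Qd Qd"
proof (intro module_homI ahomI Qd_ext)
  fix \<gamma> \<eta> x assume g: "\<gamma> \<in> carrier Qd" "\<eta> \<in> carrier Qd" and x: "x \<in> carrier H"
  have "(\<theta> \<otimes>\<^bsub>Qd\<^esub> (\<gamma> \<oplus>\<^bsub>Qd\<^esub> \<eta>)) (cls x) =
      csum K H K (\<lambda>a b. \<theta> (cls b) \<otimes> \<gamma> (cls a) \<oplus> \<theta> (cls b) \<otimes> \<eta> (cls a)) x"
    using t x g by (simp add: Qd_eval) (auto intro!: csum_cong simp: Qd_eval QdD R.r_distr)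
  then show "(\<theta> \<otimes>\<^bsub>Qd\<^esub> (\<gamma> \<oplus>\<^bsub>Qd\<^esub> \<eta>)) (cls x) = ((\<theta> \<otimes>\<^bsub>Qd\<^esub> \<gamma>) \<oplus>\<^bsub>Qd\<^esub> (\<theta> \<otimes>\<^bsub>Qd\<^esub> \<eta>)) (cls x)"
    using t x g by (simp add: csum_K_add QdD Qd_eval)
next
  fix k \<gamma> x assume k: "k \<in> carrier K" and g: "\<gamma> \<in> carrier Qd" and x: "x \<in> carrier H"
  have "(\<theta> \<otimes>\<^bsub>Qd\<^esub> (k \<odot>\<^bsub>Qd\<^esub> \<gamma>)) (cls x) = csum K H K (\<lambda>a b. k \<otimes> (\<theta> (cls b) \<otimes> \<gamma> (cls a))) x"
    using t x g k by (simp add: Qd_eval) (auto intro!: csum_cong simp: Qd_eval QdD R.m_lcomm)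
  also have "\<dots> = k \<otimes> csum K H K (\<lambda>a b. \<theta> (cls b) \<otimes> \<gamma> (cls a)) x"
    using QdD[OF t] QdD[OF g]
    by (intro csum_hom[OF K_abelian K_abelian K_lmult_ahom[OF k] x, symmetric]) auto
  finally show "(\<theta> \<otimes>\<^bsub>Qd\<^esub> (k \<odot>\<^bsub>Qd\<^esub> \<gamma>)) (cls x) = (k \<odot>\<^bsub>Qd\<^esub> (\<theta> \<otimes>\<^bsub>Qd\<^esub> \<gamma>)) (cls x)"
    using t x g by (simp add: Qd_eval)
qed (simp_all add: Qd_mult_closed t)

lemma Qd_functional_ahom: "\<theta> \<in> carrier Qd \<Longrightarrow> (\<lambda>x. \<theta> (cls x)) \<in> ahom H K"
  by (auto intro!: ahomI simp: QdD)

lemma Qd_one_mult: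
  assumes g: "\<gamma> \<in> carrier Qd" shows "\<one>\<^bsub>Qd\<^esub> \<otimes>\<^bsub>Qd\<^esub> \<gamma> = \<gamma>"
proof (rule Qd_ext)
  fix x assume x: "x \<in> carrier H"
  have "(\<one>\<^bsub>Qd\<^esub> \<otimes>\<^bsub>Qd\<^esub> \<gamma>) (cls x) = csum K H K (\<lambda>a b. \<gamma> (cls (counit H b \<cdot> a))) x"
    using x g one_Qd by (simp add: Qd_eval) (auto intro!: csum_cong simp: Qd_eval QdD)
  also have "\<dots> = \<gamma> (cls x)" by (rule csum_counit_right[OF K_abelian Qd_functional_ahom[OF g] x])
  finally show "(\<one>\<^bsub>Qd\<^esub> \<otimes>\<^bsub>Qd\<^esub> \<gamma>) (cls x) = \<gamma> (cls x)" .
qed (simp_all add: QdD g)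

lemma Qd_mult_act_one:
  assumes t: "\<theta> \<in> carrier Qd" and h: "h \<in> carrier H"
  shows "\<theta> \<otimes>\<^bsub>Qd\<^esub> act h \<one>\<^bsub>Qd\<^esub> = counit H h \<odot>\<^bsub>Qd\<^esub> \<theta>"
proof (rule Qd_ext)
  fix x assume x: "x \<in> carrier H"
  note ac = act_closed[OF h one_Qd]
  have "(\<theta> \<otimes>\<^bsub>Qd\<^esub> act h \<one>\<^bsub>Qd\<^esub>) (cls x) =
      csum K H K (\<lambda>a b. counit H h \<otimes> \<theta> (cls (counit H a \<cdot> b))) x"
    using x t h ac by (simp add: Qd_eval) (auto intro!: csum_cong simp: Qd_eval QdD counit_mult R.m_ac)
  also have "\<dots> = counit H h \<otimes> \<theta> (cls x)"
    using h by (intro csum_counit_left[OF K_abelian _ x] ahom_comp[OF Qd_functional_ahom[OF t] K_lmult_ahom]) simp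
  finally show "(\<theta> \<otimes>\<^bsub>Qd\<^esub> act h \<one>\<^bsub>Qd\<^esub>) (cls x) = (counit H h \<odot>\<^bsub>Qd\<^esub> \<theta>) (cls x)"
    using x by (simp add: Qd_eval)
qed simp_all

text \<open>As a linear image of \<^term>\<open>H\<close>, the quotient is finite-dimensional. Its basis is lifted to \<^term>\<open>H\<close>,
  where the expansion of an element only holds modulo \<^term>\<open>J\<close>.\<close>

lemma dual_basis_Q:
  "\<exists>L. set L \<subseteq> carrier H \<times> carrier Qd \<and>
    (\<forall>x\<in>carrier H. x \<ominus>\<^bsub>H\<^esub> lsum H (\<lambda>(q, \<theta>). \<theta> (cls x) \<cdot> q) L \<in> J)"
proof -
  interpret linear_map K H Qm cls
    by unfold_locales (rule cls_hom)
  have "Qm.fin_dim" by (rule rank_nullity_main(2)[OF fin_dim_H]) (simp add: carrier_Qm)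
  from Qm.fin_dim_dual_basis[OF this] obtain L where
    L: "set L \<subseteq> carrier Qm \<times> module_hom K Qm (self_module K)"
      "\<And>v. v \<in> carrier Qm \<Longrightarrow> lsum Qm (\<lambda>(b, \<phi>). \<phi> v \<odot>\<^bsub>Qm\<^esub> b) L = v" by blast
  define rep where "rep X = (SOME x. x \<in> carrier H \<and> cls x = X)" for X
  have rep: "rep X \<in> carrier H" "cls (rep X) = X" if "X \<in> carrier Qm" for X
    using that someI_ex[of "\<lambda>x. x \<in> carrier H \<and> cls x = X"] by (auto simp: rep_def carrier_Qm)
  define L' where "L' = map (\<lambda>(b, \<phi>). (rep b, restrict \<phi> (carrier Qm))) L"
  have sub': "set L' \<subseteq> carrier H \<times> carrier Qd"
    using L(1) rep by (auto simp: L'_def Qd_defs module_hom_def carrier_Qc add_Qc smult_Qc)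
  have "x \<ominus>\<^bsub>H\<^esub> lsum H (\<lambda>(q, \<theta>). \<theta> (cls x) \<cdot> q) L' \<in> J" if x: "x \<in> carrier H" for x
  proof -
    have c: "(\<lambda>(q, \<theta>). \<theta> (cls x) \<cdot> q) p \<in> carrier H" if "p \<in> set L'" for p
      using that sub' x by (auto simp: QdD)
    have "cls (lsum H (\<lambda>(q, \<theta>). \<theta> (cls x) \<cdot> q) L') =
        lsum Qm (\<lambda>p. cls ((\<lambda>(q, \<theta>). \<theta> (cls x) \<cdot> q) p)) L'"
      by (rule ahom_lsum[OF H_abelian Qm.abelian_group_axioms cls_ahom c])
    also have "\<dots> = lsum Qm (\<lambda>(b, \<phi>). \<phi> (cls x) \<odot>\<^bsub>Qm\<^esub> b) L"
      unfolding L'_def lsum_map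
    proof (rule lsum_cong)
      fix p assume p: "p \<in> set L"
      obtain b \<phi> where bp: "p = (b, \<phi>)" by (cases p)
      with p L(1) have b: "b \<in> carrier Qm" and ph: "\<phi> \<in> module_hom K Qm (self_module K)" by auto
      have "\<phi> (cls x) \<in> carrier K" using ph x by (auto simp: module_hom_def self_module_def Pi_def)
      then show "cls ((\<lambda>(q, \<theta>). \<theta> (cls x) \<cdot> q) ((\<lambda>(b, \<phi>). (rep b, restrict \<phi> (carrier Qm))) p)) =
          (\<lambda>(b, \<phi>). \<phi> (cls x) \<odot>\<^bsub>Qm\<^esub> b) p"
        using b x rep[OF b] cls_smult[of "\<phi> (cls x)" "rep b"] by (simp add: bp)
    qed simp
    also have "\<dots> = cls x" using x by (intro L(2)) simp
    finally show ?thesis using x c by (subst cls_eq_iff[symmetric]) (auto intro!: lsum_closed)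
  qed
  then show ?thesis using sub' by blast
qed

end


section \<open>The smash product and its action on the Hopf algebra\<close>

text \<open>The product of the smash product takes the two legs of \<open>h\<close> in reverse order.\<close>

lemma bilin_flip: "bilin K V W G f \<Longrightarrow> bilin K W V G (\<lambda>w v. f v w)"
  by (simp add: bilin_def)

context hopf_extension
begin

sublocale SM: tensor_product K Qd H by (rule tensor_product.intro[OF module_Qd T2.V])

abbreviation "A \<equiv> smash K H R"
abbreviation A_mult (infixl "\<star>" 70) where "a \<star> b \<equiv> a \<otimes>\<^bsub>A\<^esub> b"
abbreviation "TA \<equiv> smash_space K H R"
abbreviation "sm \<equiv> pure_tensor K Qd H"
abbreviation "e h \<equiv> sm \<one>\<^bsub>Qd\<^esub> h"
abbreviation "base \<equiv> smash_base K H R"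

lemma A_simps: "carrier A = carrier TA" "add A = add TA" "zero A = zero TA"
  by (simp_all add: smash_def)

lemma TA_abelian: "abelian_group TA" by (rule SM.T.abelian_group_T)

lemma A_abelian: "abelian_group A"
proof -
  show ?thesis
    by (rule abelian_groupI) (auto simp: A_simps SM.T.a_ac intro: SM.T.add.l_inv_ex)
qed

lemma ahom_A: "ahom A G = ahom TA G" "ahom G A = ahom G TA"
  by (simp_all add: ahom_def A_simps)

lemma base_eq: "base = e ` carrier H"
  by (auto simp: smash_base_def smash_elem_def)

lemma e_closed [simp]: "h \<in> carrier H \<Longrightarrow> e h \<in> carrier TA"
  by (intro SM.pure_closed one_Qd)

lemma sm_closed: "\<theta> \<in> carrier Qd \<Longrightarrow> h \<in> carrier H \<Longrightarrow> sm \<theta> h \<in> carrier TA"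
  by (rule SM.pure_closed)

lemma trilin_smash:
  assumes g: "\<gamma> \<in> carrier Qd" and y: "y \<in> carrier H"
  shows "trilin K Qd H H TA (\<lambda>\<theta> h1 h2. sm (\<theta> \<otimes>\<^bsub>Qd\<^esub> act h2 \<gamma>) (h1 \<bullet> y))"
proof (rule trilinI)
  fix \<theta> assume t: "\<theta> \<in> carrier Qd"
  have "(\<lambda>h2. \<theta> \<otimes>\<^bsub>Qd\<^esub> act h2 \<gamma>) \<in> module_hom K H Qd"
    by (rule module_hom_comp[OF act_hom_left[OF g] Qd_mult_hom_right[OF t]])
  from bilin_flip[OF bilin_precomp[OF SM.bilin_pure this rmult_hom[OF y module_hom_id]]]
  show "bilin K H H TA (\<lambda>h1 h2. sm (\<theta> \<otimes>\<^bsub>Qd\<^esub> act h2 \<gamma>) (h1 \<bullet> y))" .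
next
  fix h2 assume h: "h2 \<in> carrier H"
  from bilin_precomp[OF SM.bilin_pure Qd_mult_hom_left[OF act_closed[OF h g]] rmult_hom[OF y module_hom_id]]
  show "bilin K Qd H TA (\<lambda>\<theta> h1. sm (\<theta> \<otimes>\<^bsub>Qd\<^esub> act h2 \<gamma>) (h1 \<bullet> y))" .
qed

definition "smash_prod \<theta> h \<gamma> g = csum K H TA (\<lambda>h1 h2. sm (\<theta> \<otimes>\<^bsub>Qd\<^esub> act h2 \<gamma>) (h1 \<bullet> g)) h"

lemma bilin_smash_prod_left:
  "\<gamma> \<in> carrier Qd \<Longrightarrow> g \<in> carrier H \<Longrightarrow> bilin K Qd H TA (\<lambda>\<theta> h. smash_prod \<theta> h \<gamma> g)"
  unfolding smash_prod_def by (rule bilin_csum_right[OF TA_abelian trilin_smash module_Qd])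

lemma bilin_smash_prod_right:
  assumes t: "\<theta> \<in> carrier Qd" and h: "h \<in> carrier H"
  shows "bilin K Qd H TA (smash_prod \<theta> h)"
  unfolding smash_prod_def
proof (rule bilin_csum_fun[OF TA_abelian h])
  fix a b assume a: "a \<in> carrier H" and b: "b \<in> carrier H"
  show "bilin K Qd H TA (\<lambda>\<gamma> g. sm (\<theta> \<otimes>\<^bsub>Qd\<^esub> act b \<gamma>) (a \<bullet> g))"
    by (rule bilin_precomp[OF SM.bilin_pure module_hom_comp[OF act_hom_right[OF b] Qd_mult_hom_right[OF t]]
          lmult_hom[OF a module_hom_id]])
qed

definition "smash_lift \<theta> h t = tensor_lift K Qd H TA (smash_prod \<theta> h) t"

lemma smash_lift_ahom: "\<theta> \<in> carrier Qd \<Longrightarrow> h \<in> carrier H \<Longrightarrow> smash_lift \<theta> h \<in> ahom TA TA"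
  unfolding smash_lift_def by (rule SM.tensor_lift_ahom[OF TA_abelian bilin_smash_prod_right])

lemma smash_lift_sm: "\<theta> \<in> carrier Qd \<Longrightarrow> h \<in> carrier H \<Longrightarrow> \<gamma> \<in> carrier Qd \<Longrightarrow> g \<in> carrier H \<Longrightarrow>
    smash_lift \<theta> h (sm \<gamma> g) = smash_prod \<theta> h \<gamma> g"
  unfolding smash_lift_def by (rule SM.tensor_lift_pure[OF TA_abelian bilin_smash_prod_right])

lemma bilin_smash_lift:
  assumes t: "t \<in> carrier TA" shows "bilin K Qd H TA (\<lambda>\<theta> h. smash_lift \<theta> h t)"
proof (rule bilinI; (rule ahomI)?)
  note sl = smash_lift_ahom and G = TA_abelian and b = bilinD[OF bilin_smash_prod_left]
  fix h assume h: "h \<in> carrier H"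
  show "smash_lift (\<theta> \<oplus>\<^bsub>Qd\<^esub> \<eta>) h t = smash_lift \<theta> h t \<oplus>\<^bsub>TA\<^esub> smash_lift \<eta> h t"
    if "\<theta> \<in> carrier Qd" "\<eta> \<in> carrier Qd" for \<theta> \<eta>
    by (rule SM.tensor_ext[OF G sl ahom_add_fun[OF G sl sl] _ t])
      (use that h in \<open>simp_all add: smash_lift_sm ahom_add[OF b(1)]\<close>)
  show "smash_lift \<theta> h t \<in> carrier TA" if "\<theta> \<in> carrier Qd" for \<theta>
    using that h t by (intro ahom_closed[OF sl])
next
  note sl = smash_lift_ahom and G = TA_abelian and b = bilinD[OF bilin_smash_prod_left]
  fix \<theta> assume th: "\<theta> \<in> carrier Qd"
  show "smash_lift \<theta> (g \<oplus>\<^bsub>H\<^esub> h) t = smash_lift \<theta> g t \<oplus>\<^bsub>TA\<^esub> smash_lift \<theta> h t"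
    if "g \<in> carrier H" "h \<in> carrier H" for g h
    by (rule SM.tensor_ext[OF G sl ahom_add_fun[OF G sl sl] _ t])
      (use that th in \<open>simp_all add: smash_lift_sm ahom_add[OF b(2)]\<close>)
  show "smash_lift \<theta> h t \<in> carrier TA" if "h \<in> carrier H" for h
    using that th t by (intro ahom_closed[OF sl])
next
  note sl = smash_lift_ahom and G = TA_abelian and b = bilinD[OF bilin_smash_prod_left]
  fix c \<theta> h assume c: "c \<in> carrier K" "\<theta> \<in> carrier Qd" "h \<in> carrier H"
  show "smash_lift (c \<odot>\<^bsub>Qd\<^esub> \<theta>) h t = smash_lift \<theta> (c \<cdot> h) t"
    by (rule SM.tensor_ext[OF G sl sl _ t]) (use c in \<open>simp_all add: smash_lift_sm b(3)\<close>)
qed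

lemma sweedler_smash:
  assumes "\<theta> \<in> carrier Qd" "\<gamma> \<in> carrier Qd" "h \<in> carrier H" "g \<in> carrier H"
  shows "sweedler K H TA (\<lambda>h1 h2. smash_elem K H R (\<theta> \<otimes>\<^bsub>Qd\<^esub> act h2 \<gamma>) (h1 \<bullet> g)) h =
    smash_prod \<theta> h \<gamma> g"
  unfolding smash_prod_def smash_elem_def
  by (rule sweedler_eq_csum[OF TA_abelian trilinD(1)[OF trilin_smash]]) (use assms in auto)

text \<open>The product is defined by lifting Sweedler sums that are bilinear only on the carriers, so
  these sums have to be rewritten below the lift.\<close>

lemma tensor_lift_cong:
  fixes G :: "('b, 'm) ring_scheme"
  assumes "\<And>\<theta> h. \<theta> \<in> carrier Qd \<Longrightarrow> h \<in> carrier H \<Longrightarrow> f \<theta> h = f' \<theta> h"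
  shows "tensor_lift K Qd H G f = tensor_lift K Qd H G f'"
proof -
  have "(\<forall>g\<in>tensor_gens Qd H. \<phi> g = (case g of (v, w) \<Rightarrow> f v w)) =
      (\<forall>g\<in>tensor_gens Qd H. \<phi> g = (case g of (v, w) \<Rightarrow> f' v w))" for \<phi> :: "('h set \<Rightarrow> 'k) \<times> 'h \<Rightarrow> 'b"
    using assms by (auto simp: tensor_gens_def)
  then show ?thesis
    unfolding tensor_lift_def pres_lift_def by simp
qed

lemma smash_mult_eq: "s \<star> t = tensor_lift K Qd H TA (\<lambda>\<theta> h. smash_lift \<theta> h t) s"
proof -
  have "tensor_lift K Qd H TA (\<lambda>\<theta> h. tensor_lift K Qd H TA (\<lambda>\<gamma> g. sweedler K H TA
        (\<lambda>h1 h2. smash_elem K H R (\<theta> \<otimes>\<^bsub>Qd\<^esub> act h2 \<gamma>) (h1 \<bullet> g)) h) t) =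
      tensor_lift K Qd H TA (\<lambda>\<theta> h. smash_lift \<theta> h t)"
  proof (rule tensor_lift_cong)
    fix \<theta> h assume *: "\<theta> \<in> carrier Qd" "h \<in> carrier H"
    have "tensor_lift K Qd H TA (\<lambda>\<gamma> g. sweedler K H TA
        (\<lambda>h1 h2. smash_elem K H R (\<theta> \<otimes>\<^bsub>Qd\<^esub> act h2 \<gamma>) (h1 \<bullet> g)) h) = tensor_lift K Qd H TA (smash_prod \<theta> h)"
      by (rule tensor_lift_cong) (rule sweedler_smash[OF *(1) _ *(2)])
    then show "tensor_lift K Qd H TA (\<lambda>\<gamma> g. sweedler K H TA
        (\<lambda>h1 h2. smash_elem K H R (\<theta> \<otimes>\<^bsub>Qd\<^esub> act h2 \<gamma>) (h1 \<bullet> g)) h) t = smash_lift \<theta> h t"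
      by (simp only: smash_lift_def)
  qed
  moreover have "s \<star> t = tensor_lift K Qd H TA (\<lambda>\<theta> h. tensor_lift K Qd H TA (\<lambda>\<gamma> g. sweedler K H TA
        (\<lambda>h1 h2. smash_elem K H R (\<theta> \<otimes>\<^bsub>Qd\<^esub> act h2 \<gamma>) (h1 \<bullet> g)) h) t) s"
    by (simp only: smash_def ring.simps monoid.simps)
  ultimately show ?thesis by simp
qed

lemma sm_mult:
  assumes "\<theta> \<in> carrier Qd" "h \<in> carrier H" "t \<in> carrier TA"
  shows "sm \<theta> h \<star> t = smash_lift \<theta> h t"
  unfolding smash_mult_eq using assms
  by (simp add: SM.tensor_lift_pure[OF TA_abelian bilin_smash_lift])

lemma rmult_ahom_A: "t \<in> carrier TA \<Longrightarrow> (\<lambda>s. s \<star> t) \<in> ahom TA TA"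
  unfolding smash_mult_eq by (rule SM.tensor_lift_ahom[OF TA_abelian bilin_smash_lift])

lemma e_mult_ahom: "h \<in> carrier H \<Longrightarrow> (\<lambda>t. e h \<star> t) \<in> ahom TA TA"
  using smash_lift_ahom[OF one_Qd] by (simp add: ahom_def sm_mult one_Qd)

lemma e_mult_sm:
  assumes h: "h \<in> carrier H" and g: "\<gamma> \<in> carrier Qd" and y: "y \<in> carrier H"
  shows "e h \<star> sm \<gamma> y = csum K H TA (\<lambda>h1 h2. sm (act h2 \<gamma>) (h1 \<bullet> y)) h"
proof -
  have "e h \<star> sm \<gamma> y = smash_prod \<one>\<^bsub>Qd\<^esub> h \<gamma> y"
    using assms one_Qd by (simp add: sm_mult smash_lift_sm)
  also have "\<dots> = csum K H TA (\<lambda>h1 h2. sm (act h2 \<gamma>) (h1 \<bullet> y)) h"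
    unfolding smash_prod_def by (rule csum_cong[OF h]) (simp add: Qd_one_mult act_closed g)
  finally show ?thesis .
qed

lemma sm_mult_e:
  assumes t: "\<theta> \<in> carrier Qd" and h: "h \<in> carrier H" and y: "y \<in> carrier H"
  shows "sm \<theta> h \<star> e y = sm \<theta> (h \<bullet> y)"
proof -
  have "sm \<theta> h \<star> e y = smash_prod \<theta> h \<one>\<^bsub>Qd\<^esub> y"
    using assms one_Qd by (simp add: sm_mult smash_lift_sm)
  also have "\<dots> = csum K H TA (\<lambda>h1 h2. sm \<theta> ((counit H h2 \<cdot> h1) \<bullet> y)) h"
    unfolding smash_prod_def
  proof (rule csum_cong[OF h])
    fix a b assume ab: "a \<in> carrier H" "b \<in> carrier H"
    show "sm (\<theta> \<otimes>\<^bsub>Qd\<^esub> act b \<one>\<^bsub>Qd\<^esub>) (a \<bullet> y) = sm \<theta> ((counit H b \<cdot> a) \<bullet> y)"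
      using ab t y by (simp add: Qd_mult_act_one bilinD(3)[OF SM.bilin_pure] smult_mult_left)
  qed
  also have "\<dots> = sm \<theta> (h \<bullet> y)"
    by (rule csum_counit_right[OF TA_abelian ahom_comp[OF rmult_ahom[OF y] bilinD(2)[OF SM.bilin_pure t]] h])
  finally show ?thesis .
qed

lemma e_mult_e: "h \<in> carrier H \<Longrightarrow> y \<in> carrier H \<Longrightarrow> e h \<star> e y = e (h \<bullet> y)"
  by (rule sm_mult_e[OF one_Qd])

lemma e_ahom: "(\<lambda>h. e h) \<in> ahom H TA"
  by (rule bilinD(2)[OF SM.bilin_pure one_Qd])

lemma mult_e_ahom:
  assumes a: "a \<in> carrier TA" shows "(\<lambda>h. a \<star> e h) \<in> ahom H TA"
proof (rule ahomI)
  show "a \<star> e h \<in> carrier TA" if "h \<in> carrier H" for h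
    using that a by (intro ahom_closed[OF rmult_ahom_A]) auto
  fix h h' assume h: "h \<in> carrier H" "h' \<in> carrier H"
  show "a \<star> e (h \<oplus>\<^bsub>H\<^esub> h') = (a \<star> e h) \<oplus>\<^bsub>TA\<^esub> (a \<star> e h')"
    by (rule SM.tensor_ext[OF TA_abelian rmult_ahom_A ahom_add_fun[OF TA_abelian rmult_ahom_A rmult_ahom_A] _ a])
      (use h in \<open>auto simp: sm_mult_e r_distr ahom_add[OF bilinD(2)[OF SM.bilin_pure]]\<close>)
qed

lemma e_one_mult: assumes a: "a \<in> carrier TA" shows "e \<one>\<^bsub>H\<^esub> \<star> a = a"
proof (rule SM.tensor_ext[OF TA_abelian e_mult_ahom[OF one_closed] ahom_id _ a])
  fix \<gamma> g assume g: "\<gamma> \<in> carrier Qd" "g \<in> carrier H"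
  have b: "bilin K H H TA (\<lambda>h1 h2. sm (act h2 \<gamma>) (h1 \<bullet> g))"
    by (rule bilin_flip[OF bilin_precomp[OF SM.bilin_pure act_hom_left[OF g(1)] rmult_hom[OF g(2) module_hom_id]]])
  have "act \<one>\<^bsub>H\<^esub> \<gamma> = \<gamma>" using g by (intro Qd_ext) (simp_all add: Qd_eval QdD)
  then show "e \<one>\<^bsub>H\<^esub> \<star> sm \<gamma> g = sm \<gamma> g"
    using g by (simp add: e_mult_sm csum_one[OF TA_abelian b])
qed

lemma smash_assoc:
  assumes h: "h \<in> carrier H" and y: "y \<in> carrier H" and a: "a \<in> carrier TA"
  shows "(e h \<star> a) \<star> e y = e h \<star> (a \<star> e y)"
proof (rule SM.tensor_ext[OF TA_abelian ahom_comp[OF e_mult_ahom[OF h] rmult_ahom_A[OF e_closed[OF y]]]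
      ahom_comp[OF rmult_ahom_A[OF e_closed[OF y]] e_mult_ahom[OF h]] _ a])
  fix \<gamma> g assume g: "\<gamma> \<in> carrier Qd" "g \<in> carrier H"
  have "(e h \<star> sm \<gamma> g) \<star> e y =
      csum K H TA (\<lambda>h1 h2. sm (act h2 \<gamma>) (h1 \<bullet> g) \<star> e y) h"
    unfolding e_mult_sm[OF h g] using g
    by (intro csum_hom[OF TA_abelian TA_abelian rmult_ahom_A[OF e_closed[OF y]] h] sm_closed act_closed) auto
  also have "\<dots> = csum K H TA (\<lambda>h1 h2. sm (act h2 \<gamma>) (h1 \<bullet> (g \<bullet> y))) h"
    using g y by (intro csum_cong[OF h]) (simp add: sm_mult_e act_closed m_assoc)
  also have "\<dots> = e h \<star> (sm \<gamma> g \<star> e y)"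
    using g h y by (simp add: sm_mult_e e_mult_sm)
  finally show "(e h \<star> sm \<gamma> g) \<star> e y = e h \<star> (sm \<gamma> g \<star> e y)" .
qed

lemma acted_smash: "acted_ring A base base"
  by (rule acted_ring.intro)
    (auto simp: base_eq ahom_A A_simps A_abelian e_mult_ahom rmult_ahom_A smash_assoc)

lemma acted_H: "acted_ring H (carrier H) R"
  by (rule acted_ring.intro) (auto simp: lmult_ahom rmult_ahom m_assoc H_abelian)

text \<open>The smash product acts on \<^term>\<open>H\<close> by left \<^term>\<open>R\<close>-linear endomorphisms: \<open>\<theta> # g\<close> sends
  \<open>x\<close> to the sum of \<open>\<theta>(x\<^sub>(\<^sub>2\<^sub>)) x\<^sub>(\<^sub>1\<^sub>) g\<close>.\<close>

definition "Phi a x = tensor_lift K Qd H H (\<lambda>\<theta> g. csum K H H (\<lambda>x1 x2. \<theta> (cls x2) \<cdot> (x1 \<bullet> g)) x) a"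

lemma bilin_Phi_summand:
  assumes "x1 \<in> carrier H" "x2 \<in> carrier H"
  shows "bilin K Qd H H (\<lambda>\<theta> g. \<theta> (cls x2) \<cdot> (x1 \<bullet> g))"
  by (rule bilinI; (rule ahomI)?)
    (use assms in \<open>simp_all add: QdD Qd_eval smult_l_distr smult_r_distr r_distr smult_mult_right
      smult_assoc1[symmetric] R.m_comm\<close>)

lemma bilin_Phi_arg:
  assumes "\<theta> \<in> carrier Qd" "g \<in> carrier H"
  shows "bilin K H H H (\<lambda>x1 x2. \<theta> (cls x2) \<cdot> (x1 \<bullet> g))"
  by (rule bilinI; (rule ahomI)?)
    (use assms in \<open>simp_all add: QdD smult_l_distr smult_r_distr l_distr smult_mult_left
      smult_assoc1[symmetric] R.m_comm\<close>)

lemma bilin_Phi: "x \<in> carrier H \<Longrightarrow>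
    bilin K Qd H H (\<lambda>\<theta> g. csum K H H (\<lambda>x1 x2. \<theta> (cls x2) \<cdot> (x1 \<bullet> g)) x)"
  by (rule bilin_csum_fun[OF H_abelian _ bilin_Phi_summand])

lemma Phi_ahom_left: "x \<in> carrier H \<Longrightarrow> (\<lambda>a. Phi a x) \<in> ahom TA H"
  unfolding Phi_def by (rule SM.tensor_lift_ahom[OF H_abelian bilin_Phi])

lemma Phi_sm: "x \<in> carrier H \<Longrightarrow> \<theta> \<in> carrier Qd \<Longrightarrow> g \<in> carrier H \<Longrightarrow>
    Phi (sm \<theta> g) x = csum K H H (\<lambda>x1 x2. \<theta> (cls x2) \<cdot> (x1 \<bullet> g)) x"
  unfolding Phi_def by (rule SM.tensor_lift_pure[OF H_abelian bilin_Phi])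

lemma Phi_closed [simp]: "a \<in> carrier TA \<Longrightarrow> x \<in> carrier H \<Longrightarrow> Phi a x \<in> carrier H"
  by (rule ahom_closed[OF Phi_ahom_left])

lemma Phi_ahom_right: assumes a: "a \<in> carrier TA" shows "Phi a \<in> ahom H H"
proof (rule ahomI)
  fix x y assume x: "x \<in> carrier H" and y: "y \<in> carrier H"
  show "Phi a (x \<oplus>\<^bsub>H\<^esub> y) = Phi a x \<oplus>\<^bsub>H\<^esub> Phi a y"
    by (rule SM.tensor_ext[OF H_abelian Phi_ahom_left ahom_add_fun[OF H_abelian Phi_ahom_left Phi_ahom_left] _ a])
      (use x y in \<open>auto simp: Phi_sm ahom_add[OF csum_ahom[OF H_abelian bilin_Phi_arg]]\<close>)
qed (use a in simp)

text \<open>In \<open>\<theta>(r\<^sub>(\<^sub>2\<^sub>) x\<^sub>(\<^sub>2\<^sub>)) r\<^sub>(\<^sub>1\<^sub>) x\<^sub>(\<^sub>1\<^sub>) g\<close> the factor \<open>r\<^sub>(\<^sub>2\<^sub>)\<close> leaves \<open>\<theta>\<close> as \<open>\<epsilon>(r\<^sub>(\<^sub>2\<^sub>))\<close>.\<close>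

lemma Phi_R_linear:
  assumes r: "r \<in> R" and x: "x \<in> carrier H" and a: "a \<in> carrier TA"
  shows "Phi a (r \<bullet> x) = r \<bullet> Phi a x"
proof (rule SM.tensor_ext[OF H_abelian Phi_ahom_left ahom_comp[OF Phi_ahom_left lmult_ahom] _ a])
  fix \<theta> g assume t: "\<theta> \<in> carrier Qd" and g: "g \<in> carrier H"
  note G = H_abelian
  \<comment> \<open>The sum over \<open>r\<close> becomes \<open>\<psi>\<close> at \<open>\<epsilon>(r\<^sub>(\<^sub>2\<^sub>)) r\<^sub>(\<^sub>1\<^sub>) = r\<close>.\<close>
  define \<psi> where "\<psi> a = csum K H H (\<lambda>c d. \<theta> (cls d) \<cdot> ((a \<bullet> c) \<bullet> g)) x" for a
  have \<psi>: "\<psi> a = a \<bullet> Phi (sm \<theta> g) x" if a: "a \<in> carrier H" for a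
  proof -
    have "\<psi> a = csum K H H (\<lambda>c d. a \<bullet> (\<theta> (cls d) \<cdot> (c \<bullet> g))) x"
      unfolding \<psi>_def using a t g by (intro csum_cong[OF x]) (simp add: QdD smult_mult_right m_assoc)
    also have "\<dots> = a \<bullet> Phi (sm \<theta> g) x"
      unfolding Phi_sm[OF x t g] using t g
      by (intro csum_hom[OF G G lmult_ahom[OF a] x, symmetric]) (simp add: QdD)
    finally show ?thesis .
  qed
  have \<psi>a: "\<psi> \<in> ahom H H"
    using t g x by (intro ahomI) (simp_all add: \<psi> sm_closed l_distr)
  have b1: "bilin K H H H (\<lambda>a b. csum K H H (\<lambda>c d. \<theta> (cls (b \<bullet> d)) \<cdot> ((a \<bullet> c) \<bullet> g)) x)"
    by (rule bilin_csum_fun[OF G x], rule bilin_precomp[OF bilin_Phi_arg[OF t g]]) (auto intro!: hom_intros)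
  have "Phi (sm \<theta> g) (r \<bullet> x) =
      csum K H H (\<lambda>a b. csum K H H (\<lambda>c d. \<theta> (cls (b \<bullet> d)) \<cdot> ((a \<bullet> c) \<bullet> g)) x) r"
    using r x t g by (simp add: Phi_sm csum_mult[OF G bilin_Phi_arg])
  also have "\<dots> = csum K H H (\<lambda>a b. \<psi> (counit H b \<cdot> a)) r"
  proof (rule csum_R_cong[OF G b1 bilin_comp[OF bilin_counit_right \<psi>a] r])
    fix a b assume a: "a \<in> R" and b: "b \<in> R"
    show "csum K H H (\<lambda>c d. \<theta> (cls (b \<bullet> d)) \<cdot> ((a \<bullet> c) \<bullet> g)) x = \<psi> (counit H b \<cdot> a)"
      unfolding \<psi>_def using a b t g
      by (intro csum_cong[OF x]) (simp add: Qd_R_mult QdD smult_mult_left smult_assoc1[symmetric] R.m_comm)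
  qed
  also have "\<dots> = \<psi> r" using r by (intro csum_counit_right[OF G \<psi>a]) simp
  also have "\<dots> = r \<bullet> Phi (sm \<theta> g) x" using r by (intro \<psi>) simp
  finally show "Phi (sm \<theta> g) (r \<bullet> x) = r \<bullet> Phi (sm \<theta> g) x" .
qed (use r x in auto)

text \<open>With the next lemma: as a bimodule over \<open>H\<close> the smash product behaves like \<open>Hom\<^sub>H(H \<otimes>\<^sub>R H, H)\<close>, on which \<open>H\<close> acts from the left
  through the right action on the source, and from the right through the target.\<close>

lemma Phi_e_mult:
  assumes h: "h \<in> carrier H" and x: "x \<in> carrier H" and a: "a \<in> carrier TA"
  shows "Phi (e h \<star> a) x = Phi a (x \<bullet> h)"
proof (rule SM.tensor_ext[OF H_abelian ahom_comp[OF e_mult_ahom[OF h] Phi_ahom_left[OF x]] Phi_ahom_left _ a])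
  fix \<gamma> g assume t: "\<gamma> \<in> carrier Qd" and g: "g \<in> carrier H"
  note G = H_abelian
  have "Phi (e h \<star> sm \<gamma> g) x = csum K H H (\<lambda>h1 h2. Phi (sm (act h2 \<gamma>) (h1 \<bullet> g)) x) h"
    unfolding e_mult_sm[OF h t g] using t g
    by (intro csum_hom[OF TA_abelian G Phi_ahom_left[OF x] h] sm_closed act_closed) auto
  also have "\<dots> = csum K H H (\<lambda>h1 h2. csum K H H (\<lambda>c d. \<gamma> (cls (d \<bullet> h2)) \<cdot> ((c \<bullet> h1) \<bullet> g)) x) h"
    using t g x
    by (intro csum_cong[OF h]) (simp add: Phi_sm act_closed, intro csum_cong[OF x], simp add: Qd_eval m_assoc)
  also have "\<dots> = csum K H H (\<lambda>c d. csum K H H (\<lambda>h1 h2. \<gamma> (cls (d \<bullet> h2)) \<cdot> ((c \<bullet> h1) \<bullet> g)) h) x"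
    using t g by (intro csum_swap[OF G h x]) (simp add: QdD)
  also have "\<dots> = Phi (sm \<gamma> g) (x \<bullet> h)"
    using x h t g by (simp add: Phi_sm csum_mult[OF G bilin_Phi_arg])
  finally show "Phi (e h \<star> sm \<gamma> g) x = Phi (sm \<gamma> g) (x \<bullet> h)" .
qed (use h x in auto)

lemma Phi_mult_e:
  assumes h: "h \<in> carrier H" and x: "x \<in> carrier H" and a: "a \<in> carrier TA"
  shows "Phi (a \<star> e h) x = Phi a x \<bullet> h"
proof (rule SM.tensor_ext[OF H_abelian ahom_comp[OF rmult_ahom_A[OF e_closed[OF h]] Phi_ahom_left[OF x]]
      ahom_comp[OF Phi_ahom_left[OF x] rmult_ahom[OF h]] _ a])
  fix \<theta> g assume t: "\<theta> \<in> carrier Qd" and g: "g \<in> carrier H"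
  have "Phi (sm \<theta> g \<star> e h) x = csum K H H (\<lambda>c d. \<theta> (cls d) \<cdot> (c \<bullet> (g \<bullet> h))) x"
    using t g h x by (simp add: sm_mult_e Phi_sm)
  also have "\<dots> = csum K H H (\<lambda>c d. (\<theta> (cls d) \<cdot> (c \<bullet> g)) \<bullet> h) x"
    using t g h by (intro csum_cong[OF x]) (simp add: QdD smult_mult_left m_assoc)
  also have "\<dots> = Phi (sm \<theta> g) x \<bullet> h"
    unfolding Phi_sm[OF x t g] using t g
    by (intro csum_hom[OF H_abelian H_abelian rmult_ahom[OF h] x, symmetric]) (simp add: QdD)
  finally show "Phi (sm \<theta> g \<star> e h) x = Phi (sm \<theta> g) x \<bullet> h" .
qed

lemma Phi_e: 
  assumes h: "h \<in> carrier H" and x: "x \<in> carrier H" shows "Phi (e h) x = x \<bullet> h"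
proof -
  have "Phi (e h) x = csum K H H (\<lambda>c d. (counit H d \<cdot> c) \<bullet> h) x"
    using h x one_Qd by (simp add: Phi_sm) (auto intro!: csum_cong simp: Qd_eval smult_mult_left)
  also have "\<dots> = x \<bullet> h" by (rule csum_counit_right[OF H_abelian rmult_ahom[OF h] x])
  finally show ?thesis .
qed


section \<open>Dual bases in the case of two factors\<close>

text \<open>The maps on pairs that factor through \<open>H \<otimes>\<^sub>R H\<close>. An identity in \<open>H \<otimes>\<^sub>R H\<close> is stated below as an
  identity for all balanced maps, so that it can be used on any two adjacent factors of a
  tensor power.\<close>

definition "balanced G f \<longleftrightarrow> (\<forall>y\<in>carrier H. (\<lambda>x. f x y) \<in> ahom H G) \<and> (\<forall>x\<in>carrier H. f x \<in> ahom H G) \<and>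
  (\<forall>x\<in>carrier H. \<forall>y\<in>carrier H. \<forall>r\<in>R. f (x \<bullet> r) y = f x (r \<bullet> y))"

lemma balanced_bilin:
  assumes "balanced G f" shows "bilin K H H G f"
proof (rule bilinI)
  fix c v w assume *: "c \<in> carrier K" "v \<in> carrier H" "w \<in> carrier H"
  have "f (v \<bullet> (c \<cdot> \<one>\<^bsub>H\<^esub>)) w = f v ((c \<cdot> \<one>\<^bsub>H\<^esub>) \<bullet> w)"
    using assms * R_smult[OF _ R_one] by (simp add: balanced_def)
  then show "f (c \<cdot> v) w = f v (c \<cdot> w)" using * by (simp add: smult_mult_left smult_mult_right)
qed (use assms in \<open>auto simp: balanced_def\<close>)

lemma balanced_closed: "balanced G f \<Longrightarrow> x \<in> carrier H \<Longrightarrow> y \<in> carrier H \<Longrightarrow> f x y \<in> carrier G"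
  using bilinD(4)[OF balanced_bilin] .

lemma bilin_section:
  assumes f: "balanced G f" and x: "x \<in> carrier H"
  shows "bilin K H H G (\<lambda>a b. f (x \<bullet> S a) b)"
  by (rule bilin_precomp_left[OF balanced_bilin[OF f]]) (intro lmult_hom S_hom module_hom_id x)

text \<open>The map \<open>h \<mapsto> x S(h\<^sub>(\<^sub>1\<^sub>)) \<otimes> h\<^sub>(\<^sub>2\<^sub>)\<close> into \<open>H \<otimes>\<^sub>R H\<close> factors through the quotient: its value at
  \<open>r h\<close> is \<open>x S(h\<^sub>(\<^sub>1\<^sub>)) S(r\<^sub>(\<^sub>1\<^sub>)) r\<^sub>(\<^sub>2\<^sub>) \<otimes> h\<^sub>(\<^sub>2\<^sub>)\<close>, as the antipode is anti-multiplicative and \<open>r\<^sub>(\<^sub>2\<^sub>)\<close> moves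
  across the tensor sign, and \<open>S(r\<^sub>(\<^sub>1\<^sub>)) r\<^sub>(\<^sub>2\<^sub>) = \<epsilon>(r)\<close>.\<close>

lemma section_J:
  assumes G: "abelian_group G" and f: "balanced G f" and x: "x \<in> carrier H" and j: "j \<in> J"
  shows "csum K H G (\<lambda>a b. f (x \<bullet> S a) b) j = \<zero>\<^bsub>G\<^esub>"
proof (rule J_vanish[OF G csum_ahom[OF G bilin_section[OF f x]] _ j])
  interpret G: abelian_group G by (rule G)
  note fb = balanced_bilin[OF f]
  have fR: "f (u \<bullet> r) v = f u (r \<bullet> v)" if "u \<in> carrier H" "v \<in> carrier H" "r \<in> R" for u v r
    using f that by (simp add: balanced_def)
  fix r h assume r: "r \<in> R" and r0: "counit H r = \<zero>" and h: "h \<in> carrier H"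
  have b1: "bilin K H H G (\<lambda>a b. csum K H G (\<lambda>c d. f (x \<bullet> S (a \<bullet> c)) (b \<bullet> d)) h)"
    by (rule bilin_csum_fun[OF G h], rule bilin_precomp[OF fb]) (use x in \<open>auto intro!: hom_intros\<close>)
  have b2: "bilin K H H G (\<lambda>a b. csum K H G (\<lambda>c d. f ((x \<bullet> S c) \<bullet> (S a \<bullet> b)) d) h)"
  proof (rule bilin_csum_fun[OF G h])
    fix c d assume c: "c \<in> carrier H" and d: "d \<in> carrier H"
    have xc: "x \<bullet> S c \<in> carrier H" using x c by simp
    show "bilin K H H G (\<lambda>a b. f ((x \<bullet> S c) \<bullet> (S a \<bullet> b)) d)"
      by (rule bilin_comp[OF bilin_lmult[OF bilin_mult_homs[OF S_hom[OF module_hom_id] module_hom_id] xc] bilinD(1)[OF fb d]])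
  qed
  have "csum K H G (\<lambda>a b. f (x \<bullet> S a) b) (r \<bullet> h) =
      csum K H G (\<lambda>a b. csum K H G (\<lambda>c d. f (x \<bullet> S (a \<bullet> c)) (b \<bullet> d)) h) r"
    using r h by (intro csum_mult[OF G bilin_section[OF f x]]) auto
  also have "\<dots> = csum K H G (\<lambda>a b. csum K H G (\<lambda>c d. f ((x \<bullet> S c) \<bullet> (S a \<bullet> b)) d) h) r"
  proof (rule csum_R_cong[OF G b1 b2 r])
    fix a b assume a: "a \<in> R" and b: "b \<in> R"
    show "csum K H G (\<lambda>c d. f (x \<bullet> S (a \<bullet> c)) (b \<bullet> d)) h =
        csum K H G (\<lambda>c d. f ((x \<bullet> S c) \<bullet> (S a \<bullet> b)) d) h"
      using a b x by (intro csum_cong[OF h]) (simp add: fR[symmetric] S_mult m_assoc)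
  qed
  also have "\<dots> = csum K H G (\<lambda>c d. csum K H G (\<lambda>a b. f ((x \<bullet> S c) \<bullet> (S a \<bullet> b)) d) r) h"
    using r h x by (intro csum_swap[OF G]) (auto intro!: balanced_closed[OF f])
  also have "\<dots> = csum K H G (\<lambda>c d. \<zero>\<^bsub>G\<^esub>) h"
  proof (rule csum_cong[OF h])
    fix c d assume c: "c \<in> carrier H" and d: "d \<in> carrier H"
    have xc: "x \<bullet> S c \<in> carrier H" using x c by simp
    note hom = ahom_comp[OF lmult_ahom[OF xc] bilinD(1)[OF fb d]]
    have "csum K H G (\<lambda>a b. f ((x \<bullet> S c) \<bullet> (S a \<bullet> b)) d) r =
        f ((x \<bullet> S c) \<bullet> csum K H H (\<lambda>a b. S a \<bullet> b) r) d"
      using r by (intro csum_hom[OF H_abelian G hom, symmetric]) auto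
    also have "\<dots> = f ((x \<bullet> S c) \<bullet> \<zero>\<^bsub>H\<^esub>) d" using r r0 by (simp add: csum_antipode_left)
    also have "\<dots> = \<zero>\<^bsub>G\<^esub>" using ahom_zero[OF H_abelian G hom] .
    finally show "csum K H G (\<lambda>a b. f ((x \<bullet> S c) \<bullet> (S a \<bullet> b)) d) r = \<zero>\<^bsub>G\<^esub>" .
  qed
  also have "\<dots> = \<zero>\<^bsub>G\<^esub>" by (simp add: csum_def split_def G.lsum_zero)
  finally show "csum K H G (\<lambda>a b. f (x \<bullet> S a) b) (r \<bullet> h) = \<zero>\<^bsub>G\<^esub>" .
qed

definition "Qbasis = (SOME L. set L \<subseteq> carrier H \<times> carrier Qd \<and>
    (\<forall>x\<in>carrier H. x \<ominus>\<^bsub>H\<^esub> lsum H (\<lambda>(q, \<theta>). \<theta> (cls x) \<cdot> q) L \<in> J))"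

lemma Qbasis: "set Qbasis \<subseteq> carrier H \<times> carrier Qd"
  "x \<in> carrier H \<Longrightarrow> x \<ominus>\<^bsub>H\<^esub> lsum H (\<lambda>(q, \<theta>). \<theta> (cls x) \<cdot> q) Qbasis \<in> J"
  using someI_ex[OF dual_basis_Q] by (auto simp: Qbasis_def)

lemma Qbasis_lsum_closed: "x \<in> carrier H \<Longrightarrow> lsum H (\<lambda>(q, \<theta>). \<theta> (cls x) \<cdot> q) Qbasis \<in> carrier H"
  using Qbasis(1) by (intro lsum_closed) (auto simp: QdD)

lemma hom_Qbasis:
  assumes G: "abelian_group G" and \<phi>: "\<phi> \<in> ahom H G" and v: "\<And>j. j \<in> J \<Longrightarrow> \<phi> j = \<zero>\<^bsub>G\<^esub>" and x: "x \<in> carrier H"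
  shows "lsum G (\<lambda>(q, \<theta>). \<phi> (\<theta> (cls x) \<cdot> q)) Qbasis = \<phi> x"
proof -
  interpret G: abelian_group G by (rule G)
  note c = Qbasis_lsum_closed[OF x]
  have "\<phi> x \<ominus>\<^bsub>G\<^esub> \<phi> (lsum H (\<lambda>(q, \<theta>). \<theta> (cls x) \<cdot> q) Qbasis) = \<zero>\<^bsub>G\<^esub>"
    using v[OF Qbasis(2)[OF x]] x c by (simp add: a_minus_def ahom_add[OF \<phi>] ahom_minus[OF H_abelian G \<phi>])
  then have "\<phi> x = \<phi> (lsum H (\<lambda>(q, \<theta>). \<theta> (cls x) \<cdot> q) Qbasis)"
    using G.minus_eq_zero_iff ahom_closed[OF \<phi>] x c by metis
  also have "\<dots> = lsum G (\<lambda>p. \<phi> ((\<lambda>(q, \<theta>). \<theta> (cls x) \<cdot> q) p)) Qbasis"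
    using Qbasis(1) x by (intro ahom_lsum[OF H_abelian G \<phi>]) (auto simp: QdD)
  finally show ?thesis by (simp add: split_def)
qed

text \<open>The dual bases \<open>S(q\<^sub>(\<^sub>1\<^sub>)) \<otimes> q\<^sub>(\<^sub>2\<^sub>)\<close> and \<open>\<theta> # 1\<close> of \<open>H \<otimes>\<^sub>R H\<close> and the smash product. The first is split into
  pure tensors \<open>(u, v)\<close>, each listed with the same partner; this is harmless as dual bases only enter
  through sums that are additive in the pair.\<close>

definition "basis1 = concat (map (\<lambda>(q, \<theta>). map (\<lambda>(a, b). ((S a, b), sm \<theta> \<one>\<^bsub>H\<^esub>)) (cop K H q)) Qbasis)"

lemma basis1: "set basis1 \<subseteq> (carrier H \<times> carrier H) \<times> carrier TA"
proof
  fix y assume "y \<in> set basis1"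
  then obtain q \<theta> a b where *: "(q, \<theta>) \<in> set Qbasis" "(a, b) \<in> set (cop K H q)" "y = ((S a, b), sm \<theta> \<one>\<^bsub>H\<^esub>)"
    by (auto simp: basis1_def)
  then have "q \<in> carrier H" "\<theta> \<in> carrier Qd" using Qbasis(1) by auto
  moreover from this have "a \<in> carrier H" "b \<in> carrier H" using cop[of q] *(2) by auto
  ultimately show "y \<in> (carrier H \<times> carrier H) \<times> carrier TA" using *(3) by (simp add: sm_closed)
qed

lemma lsum_basis1:
  assumes G: "abelian_group G"
    and F: "\<And>u v \<nu>. u \<in> carrier H \<Longrightarrow> v \<in> carrier H \<Longrightarrow> \<nu> \<in> carrier TA \<Longrightarrow> F u v \<nu> \<in> carrier G"
  shows "lsum G (\<lambda>((u, v), \<nu>). F u v \<nu>) basis1 =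
    lsum G (\<lambda>(q, \<theta>). csum K H G (\<lambda>a b. F (S a) b (sm \<theta> \<one>\<^bsub>H\<^esub>)) q) Qbasis"
proof -
  interpret G: abelian_group G by (rule G)
  let ?ys = "\<lambda>p. map (\<lambda>(a, b). ((S a, b), sm (snd p) \<one>\<^bsub>H\<^esub>)) (cop K H (fst p))"
  have basis1_eq: "basis1 = concat (map ?ys Qbasis)" by (simp add: basis1_def split_def)
  have c: "(\<lambda>((u, v), \<nu>). F u v \<nu>) y \<in> carrier G" if p: "p \<in> set Qbasis" and y: "y \<in> set (?ys p)" for p y
  proof -
    have "y \<in> set basis1" unfolding basis1_eq set_concat set_map using p y by blast
    then show ?thesis using basis1 by (auto intro!: F)
  qed
  have "lsum G (\<lambda>((u, v), \<nu>). F u v \<nu>) basis1 = lsum G (\<lambda>p. lsum G (\<lambda>((u, v), \<nu>). F u v \<nu>) (?ys p)) Qbasis"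
    unfolding basis1_eq by (rule G.lsum_concat) (rule c)
  then show ?thesis by (simp add: split_def lsum_map csum_def)
qed

text \<open>With \<open>w(h) = S(h\<^sub>(\<^sub>1\<^sub>)) \<otimes> h\<^sub>(\<^sub>2\<^sub>)\<close>, which only depends on the class of \<open>h\<close>, the sum is
  \<open>\<Sum> \<theta>(y\<^sub>(\<^sub>2\<^sub>)) x y\<^sub>(\<^sub>1\<^sub>) w(q) = x y\<^sub>(\<^sub>1\<^sub>) w(y\<^sub>(\<^sub>2\<^sub>)) = x y\<^sub>(\<^sub>1\<^sub>) S(y\<^sub>(\<^sub>2\<^sub>)) \<otimes> y\<^sub>(\<^sub>3\<^sub>) = x \<otimes> y\<close>.\<close>

lemma basis1_dual_left:
  assumes G: "abelian_group G" and f: "balanced G f" and x: "x \<in> carrier H" and y: "y \<in> carrier H"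
  shows "lsum G (\<lambda>((u, v), \<nu>). f ((x \<bullet> Phi \<nu> y) \<bullet> u) v) basis1 = f x y"
proof -
  interpret G: abelian_group G by (rule G)
  note fb = balanced_bilin[OF f] and fc = balanced_closed[OF f]
  define w where "w z h = csum K H G (\<lambda>a b. f (z \<bullet> S a) b) h" for z h
  have w_ahom: "w z \<in> ahom H G" if "z \<in> carrier H" for z
    unfolding w_def using csum_ahom[OF G bilin_section[OF f that]] .
  have w_J: "w z j = \<zero>\<^bsub>G\<^esub>" if "z \<in> carrier H" "j \<in> J" for z j
    unfolding w_def using section_J[OF G f that] .
  have "lsum G (\<lambda>((u, v), \<nu>). f ((x \<bullet> Phi \<nu> y) \<bullet> u) v) basis1 =
      lsum G (\<lambda>(q, \<theta>). csum K H G (\<lambda>a b. f ((x \<bullet> Phi (sm \<theta> \<one>\<^bsub>H\<^esub>) y) \<bullet> S a) b) q) Qbasis"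
    using x y by (intro lsum_basis1[OF G] fc) auto
  also have "\<dots> = lsum G (\<lambda>(q, \<theta>). csum K H G (\<lambda>c d. w (x \<bullet> c) (\<theta> (cls d) \<cdot> q)) y) Qbasis"
  proof (rule lsum_cong)
    fix p assume p: "p \<in> set Qbasis"
    obtain q \<theta> where qt: "p = (q, \<theta>)" by (cases p)
    with p Qbasis(1) have q: "q \<in> carrier H" and t: "\<theta> \<in> carrier Qd" by auto
    have "csum K H G (\<lambda>a b. f ((x \<bullet> Phi (sm \<theta> \<one>\<^bsub>H\<^esub>) y) \<bullet> S a) b) q =
        csum K H G (\<lambda>a b. csum K H G (\<lambda>c d. f ((x \<bullet> (\<theta> (cls d) \<cdot> c)) \<bullet> S a) b) y) q"
    proof (rule csum_cong[OF q])
      fix a b assume a: "a \<in> carrier H" and b: "b \<in> carrier H"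
      have Sa: "S a \<in> carrier H" using a by simp
      note hom = ahom_comp[OF ahom_comp[OF lmult_ahom[OF x] rmult_ahom[OF Sa]] bilinD(1)[OF fb b]]
      have "Phi (sm \<theta> \<one>\<^bsub>H\<^esub>) y = csum K H H (\<lambda>c d. \<theta> (cls d) \<cdot> c) y"
        using t y by (simp add: Phi_sm) (auto intro!: csum_cong)
      then show "f ((x \<bullet> Phi (sm \<theta> \<one>\<^bsub>H\<^esub>) y) \<bullet> S a) b =
          csum K H G (\<lambda>c d. f ((x \<bullet> (\<theta> (cls d) \<cdot> c)) \<bullet> S a) b) y"
        using t by (simp add: csum_hom[OF H_abelian G hom y] QdD)
    qed
    also have "\<dots> = csum K H G (\<lambda>c d. csum K H G (\<lambda>a b. f ((x \<bullet> (\<theta> (cls d) \<cdot> c)) \<bullet> S a) b) q) y"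
      using x t by (intro csum_swap[OF G q y] fc) (auto simp: QdD)
    also have "\<dots> = csum K H G (\<lambda>c d. w (x \<bullet> c) (\<theta> (cls d) \<cdot> q)) y"
    proof (rule csum_cong[OF y])
      fix c d assume c: "c \<in> carrier H" and d: "d \<in> carrier H"
      have xc: "x \<bullet> c \<in> carrier H" using x c by simp
      have td: "\<theta> (cls d) \<in> carrier K" using t d by (simp add: QdD)
      show "csum K H G (\<lambda>a b. f ((x \<bullet> (\<theta> (cls d) \<cdot> c)) \<bullet> S a) b) q = w (x \<bullet> c) (\<theta> (cls d) \<cdot> q)"
        unfolding w_def csum_smult[OF G bilin_section[OF f xc] td q]
        using x c td by (intro csum_cong[OF q])
          (simp add: module_hom_smult[OF antipode_hom] smult_mult_left smult_mult_right)
    qed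
    finally show "(case p of (q, \<theta>) \<Rightarrow> csum K H G (\<lambda>a b. f ((x \<bullet> Phi (sm \<theta> \<one>\<^bsub>H\<^esub>) y) \<bullet> S a) b) q) =
        (case p of (q, \<theta>) \<Rightarrow> csum K H G (\<lambda>c d. w (x \<bullet> c) (\<theta> (cls d) \<cdot> q)) y)" by (simp add: qt)
  qed simp
  also have "\<dots> = csum K H G (\<lambda>c d. lsum G (\<lambda>p. w (x \<bullet> c) (snd p (cls d) \<cdot> fst p)) Qbasis) y"
    unfolding split_def using x Qbasis(1)
    by (intro csum_lsum_swap[OF G y, symmetric] ahom_closed[OF w_ahom]) (auto simp: QdD)
  also have "\<dots> = csum K H G (\<lambda>c d. w (x \<bullet> c) d) y"
    using x hom_Qbasis[OF G w_ahom w_J] by (intro csum_cong[OF y]) (auto simp: split_def)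
  also have "\<dots> = csum K H G (\<lambda>c d. csum K H G (\<lambda>d1 d2. f ((x \<bullet> c) \<bullet> S d1) d2) d) y"
    by (simp add: w_def)
  also have "\<dots> = csum K H G (\<lambda>c d. csum K H G (\<lambda>c1 c2. f ((x \<bullet> c1) \<bullet> S c2) d) c) y"
  proof (rule csum_coassoc[OF G _ y], rule trilinI)
    fix c assume "c \<in> carrier H"
    then show "bilin K H H G (\<lambda>d1 d2. f ((x \<bullet> c) \<bullet> S d1) d2)"
      using x by (intro bilin_section[OF f]) simp
  next
    fix d assume "d \<in> carrier H"
    then show "bilin K H H G (\<lambda>c1 c2. f ((x \<bullet> c1) \<bullet> S c2) d)"
      by (intro bilin_comp[OF bilin_mult_homs[OF lmult_hom[OF x module_hom_id] S_hom[OF module_hom_id]] bilinD(1)[OF fb]])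
  qed
  also have "\<dots> = csum K H G (\<lambda>c d. f x (counit H c \<cdot> d)) y"
  proof (rule csum_cong[OF y])
    fix c d assume c: "c \<in> carrier H" and d: "d \<in> carrier H"
    note hom = ahom_comp[OF lmult_ahom[OF x] bilinD(1)[OF fb d]]
    have "csum K H G (\<lambda>c1 c2. f ((x \<bullet> c1) \<bullet> S c2) d) c =
        csum K H G (\<lambda>c1 c2. f (x \<bullet> (c1 \<bullet> S c2)) d) c"
      using x by (intro csum_cong[OF c]) (simp add: m_assoc)
    also have "\<dots> = f (x \<bullet> csum K H H (\<lambda>c1 c2. c1 \<bullet> S c2) c) d"
      by (intro csum_hom[OF H_abelian G hom c, symmetric]) simp
    also have "\<dots> = f x (counit H c \<cdot> d)"
      using x c d by (simp add: csum_antipode_right smult_mult_right bilinD(3)[OF fb])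
    finally show "csum K H G (\<lambda>c1 c2. f ((x \<bullet> c1) \<bullet> S c2) d) c = f x (counit H c \<cdot> d)" .
  qed
  also have "\<dots> = f x y" by (rule csum_counit_left[OF G bilinD(2)[OF fb x] y])
  finally show ?thesis .
qed

text \<open>For \<open>a = \<gamma> # g\<close> the pairing with \<open>S(q\<^sub>(\<^sub>1\<^sub>)) \<otimes> q\<^sub>(\<^sub>2\<^sub>)\<close> is
  \<open>S(q\<^sub>(\<^sub>1\<^sub>)) q\<^sub>(\<^sub>2\<^sub>) \<gamma>(q\<^sub>(\<^sub>3\<^sub>)) g = \<gamma>(q) g\<close>, and \<open>\<Sum> \<gamma>(q) \<theta> = \<gamma>\<close> by duality of the bases.\<close>

lemma basis1_dual_right:
  assumes a: "a \<in> carrier TA"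
  shows "lsum TA (\<lambda>((u, v), \<nu>). \<nu> \<star> e (u \<bullet> Phi a v)) basis1 = a"
proof (rule SM.tensor_ext[OF TA_abelian _ ahom_id _ a])
  note G = TA_abelian and HG = H_abelian
  have "(\<lambda>a. \<nu> \<star> e (u \<bullet> Phi a v)) \<in> ahom TA TA" if "u \<in> carrier H" "v \<in> carrier H" "\<nu> \<in> carrier TA" for u v \<nu>
  proof (rule ahomI)
    fix a b assume ab: "a \<in> carrier TA" "b \<in> carrier TA"
    from ahom_add[OF ahom_comp[OF ahom_comp[OF Phi_ahom_left lmult_ahom] mult_e_ahom]]
    show "\<nu> \<star> e (u \<bullet> Phi (a \<oplus>\<^bsub>TA\<^esub> b) v) =
        (\<nu> \<star> e (u \<bullet> Phi a v)) \<oplus>\<^bsub>TA\<^esub> (\<nu> \<star> e (u \<bullet> Phi b v))"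
      using that ab by blast
  qed (use that in \<open>intro ahom_closed[OF rmult_ahom_A], auto\<close>)
  then show "(\<lambda>a. lsum TA (\<lambda>((u, v), \<nu>). \<nu> \<star> e (u \<bullet> Phi a v)) basis1) \<in> ahom TA TA"
    unfolding split_def using basis1 by (intro ahom_lsum_fun[OF G]) auto
  fix \<gamma> g assume t: "\<gamma> \<in> carrier Qd" and g: "g \<in> carrier H"
  note sg = sm_closed[OF t g]
  have inner: "csum K H H (\<lambda>a b. S a \<bullet> Phi (sm \<gamma> g) b) q = \<gamma> (cls q) \<cdot> g" if q: "q \<in> carrier H" for q
  proof -
    have "csum K H H (\<lambda>a b. S a \<bullet> Phi (sm \<gamma> g) b) q =
        csum K H H (\<lambda>a b. csum K H H (\<lambda>b1 b2. S a \<bullet> (\<gamma> (cls b2) \<cdot> (b1 \<bullet> g))) b) q"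
      using t g by (intro csum_cong[OF q]) (simp add: Phi_sm, intro csum_hom[OF HG HG lmult_ahom], auto simp: QdD)
    also have "\<dots> = csum K H H (\<lambda>a b. csum K H H (\<lambda>a1 a2. S a1 \<bullet> (\<gamma> (cls b) \<cdot> (a2 \<bullet> g))) a) q"
    proof (rule csum_coassoc[OF HG _ q], rule trilinI)
      fix a assume "a \<in> carrier H"
      then show "bilin K H H H (\<lambda>b1 b2. S a \<bullet> (\<gamma> (cls b2) \<cdot> (b1 \<bullet> g)))"
        by (intro bilin_lmult bilin_Phi_arg[OF t g]) simp
    next
      fix b assume b: "b \<in> carrier H"
      have "smult H (\<gamma> (cls b)) \<in> module_hom K H H"
        using t b by (intro module_homI smult_ahom) (simp_all add: QdD smult_assoc1[symmetric] R.m_comm)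
      then show "bilin K H H H (\<lambda>a1 a2. S a1 \<bullet> (\<gamma> (cls b) \<cdot> (a2 \<bullet> g)))"
        by (intro bilin_mult_homs S_hom module_hom_id module_hom_comp[OF rmult_hom[OF g module_hom_id]])
    qed
    also have "\<dots> = csum K H H (\<lambda>a b. \<gamma> (cls (counit H a \<cdot> b)) \<cdot> g) q"
    proof (rule csum_cong[OF q])
      fix a b assume a: "a \<in> carrier H" and b: "b \<in> carrier H"
      have gb: "\<gamma> (cls b) \<in> carrier K" using t b by (simp add: QdD)
      have "csum K H H (\<lambda>a1 a2. S a1 \<bullet> (\<gamma> (cls b) \<cdot> (a2 \<bullet> g))) a =
          csum K H H (\<lambda>a1 a2. \<gamma> (cls b) \<cdot> ((S a1 \<bullet> a2) \<bullet> g)) a"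
        using g gb by (intro csum_cong[OF a]) (simp add: smult_mult_right m_assoc)
      also have "\<dots> = \<gamma> (cls b) \<cdot> (csum K H H (\<lambda>a1 a2. S a1 \<bullet> a2) a \<bullet> g)"
        by (intro csum_hom[OF HG HG ahom_comp[OF rmult_ahom[OF g] smult_ahom[OF gb]] a, symmetric]) simp
      also have "\<dots> = \<gamma> (cls (counit H a \<cdot> b)) \<cdot> g"
        using a b g gb t by (simp add: csum_antipode_left smult_mult_left QdD smult_assoc1[symmetric] R.m_comm)
      finally show "csum K H H (\<lambda>a1 a2. S a1 \<bullet> (\<gamma> (cls b) \<cdot> (a2 \<bullet> g))) a =
          \<gamma> (cls (counit H a \<cdot> b)) \<cdot> g" .
    qed
    also have "\<dots> = \<gamma> (cls q) \<cdot> g"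
      using t g by (intro csum_counit_left[OF HG _ q] ahomI) (simp_all add: QdD smult_l_distr)
    finally show ?thesis .
  qed
  have "lsum TA (\<lambda>((u, v), \<nu>). \<nu> \<star> e (u \<bullet> Phi (sm \<gamma> g) v)) basis1 =
      lsum TA (\<lambda>(q, \<theta>). csum K H TA (\<lambda>a b. sm \<theta> \<one>\<^bsub>H\<^esub> \<star> e (S a \<bullet> Phi (sm \<gamma> g) b)) q) Qbasis"
    using sg by (intro lsum_basis1[OF G] ahom_closed[OF rmult_ahom_A]) auto
  also have "\<dots> = lsum TA (\<lambda>(q, \<theta>). sm (\<gamma> (cls q) \<odot>\<^bsub>Qd\<^esub> \<theta>) g) Qbasis"
  proof (rule lsum_cong)
    fix p assume p: "p \<in> set Qbasis"
    obtain q \<theta> where qt: "p = (q, \<theta>)" by (cases p)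
    with p Qbasis(1) have q: "q \<in> carrier H" and th: "\<theta> \<in> carrier Qd" by auto
    have "csum K H TA (\<lambda>a b. sm \<theta> \<one>\<^bsub>H\<^esub> \<star> e (S a \<bullet> Phi (sm \<gamma> g) b)) q =
        csum K H TA (\<lambda>a b. sm \<theta> (S a \<bullet> Phi (sm \<gamma> g) b)) q"
      using th sg by (intro csum_cong[OF q]) (simp add: sm_mult_e)
    also have "\<dots> = sm \<theta> (csum K H H (\<lambda>a b. S a \<bullet> Phi (sm \<gamma> g) b) q)"
      using sg by (intro csum_hom[OF HG G bilinD(2)[OF SM.bilin_pure th] q, symmetric]) simp
    also have "\<dots> = sm (\<gamma> (cls q) \<odot>\<^bsub>Qd\<^esub> \<theta>) g"
      using t g q th by (simp add: inner QdD bilinD(3)[OF SM.bilin_pure])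
    finally show "(case p of (q, \<theta>) \<Rightarrow> csum K H TA (\<lambda>a b. sm \<theta> \<one>\<^bsub>H\<^esub> \<star> e (S a \<bullet> Phi (sm \<gamma> g) b)) q) =
        (case p of (q, \<theta>) \<Rightarrow> sm (\<gamma> (cls q) \<odot>\<^bsub>Qd\<^esub> \<theta>) g)" by (simp add: qt)
  qed simp
  also have "\<dots> = sm (lsum Qd (\<lambda>(q, \<theta>). \<gamma> (cls q) \<odot>\<^bsub>Qd\<^esub> \<theta>) Qbasis) g"
  proof -
    have "sm (lsum Qd (\<lambda>p. \<gamma> (cls (fst p)) \<odot>\<^bsub>Qd\<^esub> snd p) Qbasis) g =
        lsum TA (\<lambda>p. sm (\<gamma> (cls (fst p)) \<odot>\<^bsub>Qd\<^esub> snd p) g) Qbasis"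
      using Qbasis(1) t by (intro ahom_lsum[OF Qd.M.abelian_group_axioms G bilinD(1)[OF SM.bilin_pure g]]) (auto simp: QdD)
    then show ?thesis by (simp add: split_def)
  qed
  also have "lsum Qd (\<lambda>(q, \<theta>). \<gamma> (cls q) \<odot>\<^bsub>Qd\<^esub> \<theta>) Qbasis = \<gamma>"
  proof (rule Qd_ext)
    have c: "lsum Qd (\<lambda>(q, \<theta>). \<gamma> (cls q) \<odot>\<^bsub>Qd\<^esub> \<theta>) Qbasis \<in> carrier Qd"
      using Qbasis(1) t by (intro Qd.M.lsum_closed) (auto simp: QdD)
    then show "lsum Qd (\<lambda>(q, \<theta>). \<gamma> (cls q) \<odot>\<^bsub>Qd\<^esub> \<theta>) Qbasis \<in> extensional (carrier Qm)" by (rule QdD)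
    show "\<gamma> \<in> extensional (carrier Qm)" using t by (rule QdD)
    fix x assume x: "x \<in> carrier H"
    have ev: "(\<lambda>\<theta>. \<theta> (cls x)) \<in> ahom Qd K" using x by (intro ahomI) (simp_all add: QdD Qd_eval)
    have "lsum Qd (\<lambda>(q, \<theta>). \<gamma> (cls q) \<odot>\<^bsub>Qd\<^esub> \<theta>) Qbasis (cls x) =
        lsum K (\<lambda>p. (\<lambda>(q, \<theta>). \<gamma> (cls q) \<odot>\<^bsub>Qd\<^esub> \<theta>) p (cls x)) Qbasis"
      using Qbasis(1) t by (intro ahom_lsum[OF Qd.M.abelian_group_axioms K_abelian ev]) (auto simp: QdD)
    also have "\<dots> = lsum K (\<lambda>(q, \<theta>). \<gamma> (cls (\<theta> (cls x) \<cdot> q))) Qbasis"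
      using Qbasis(1) t x by (intro lsum_cong) (auto simp: QdD Qd_eval R.m_comm)
    also have "\<dots> = \<gamma> (cls x)"
    proof (rule hom_Qbasis[OF K_abelian Qd_functional_ahom[OF t] _ x])
      fix j assume j: "j \<in> J"
      have "\<gamma> (cls \<zero>\<^bsub>H\<^esub>) = \<zero>"
        by (rule ahom_zero[OF H_abelian K_abelian Qd_functional_ahom[OF t]])
      then show "\<gamma> (cls j) = \<zero>" using cls_J[OF j] by (simp add: cls_zero)
    qed
    finally show "lsum Qd (\<lambda>(q, \<theta>). \<gamma> (cls q) \<odot>\<^bsub>Qd\<^esub> \<theta>) Qbasis (cls x) = \<gamma> (cls x)" .
  qed
  finally show "lsum TA (\<lambda>((u, v), \<nu>). \<nu> \<star> e (u \<bullet> Phi (sm \<gamma> g) v)) basis1 = sm \<gamma> g" .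
qed

end


section \<open>Duality between the tensor powers\<close>

text \<open>\<open>x\<^sub>0 \<phi>\<^bsub>a\<^sub>1\<^esub>(x\<^sub>1 \<phi>\<^bsub>a\<^sub>2\<^esub>(\<dots> \<phi>\<^bsub>a\<^sub>n\<^esub>(x\<^sub>n)))\<close>. The pairing feeds it the second list in reverse order, as
  dualising reverses tensor products. The values on lists whose lengths do not
  differ by one are arbitrary.\<close>

fun iter_pair :: "('h \<Rightarrow> 'h \<Rightarrow> 'h) \<Rightarrow> ('a \<Rightarrow> 'h \<Rightarrow> 'h) \<Rightarrow> 'h list \<Rightarrow> 'a list \<Rightarrow> 'h" where
  "iter_pair m \<phi> (x # y # ys) (a # as) = m x (\<phi> a (iter_pair m \<phi> (y # ys) as))"
| "iter_pair m \<phi> (x # ys) [] = x"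
| "iter_pair m \<phi> [x] as = x"
| "iter_pair m \<phi> [] as = undefined"

lemma rev_update_Suc: "k < length xs \<Longrightarrow> rev (xs[k := y]) = (rev xs)[length xs - Suc k := y]"
  by (simp add: rev_update)

context acted_ring
begin

lemma multiadd_ahom:
  assumes f: "multiadd A B n G f" and xs: "xs \<in> power_gens A n" and i: "i < n"
  shows "(\<lambda>a. f (xs[i := a])) \<in> ahom A G"
  using xs i by (intro ahomI) (simp_all add: multiaddD[OF f] power_gens_update)

lemma multiadd_ahom_last:
  assumes f: "multiadd A B (Suc n) G f" and xs: "xs \<in> power_gens A n"
  shows "(\<lambda>a. f (xs @ [a])) \<in> ahom A G"
proof -
  have l: "length xs = n" by (rule power_gens_length[OF xs])
  have "xs @ [\<zero>\<^bsub>A\<^esub>] \<in> power_gens A (Suc n)" using xs by (simp add: power_gens_snoc)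
  from multiadd_ahom[OF f this lessI] show ?thesis using l by (simp add: list_update_append)
qed

lemma multiadd_ahom_hd:
  assumes f: "multiadd A B (Suc n) G f" and xs: "xs \<in> power_gens A n"
  shows "(\<lambda>a. f (a # xs)) \<in> ahom A G"
proof -
  have "\<zero>\<^bsub>A\<^esub> # xs \<in> power_gens A (Suc n)" using xs by (simp add: power_gens_Cons)
  from multiadd_ahom[OF f this, of 0] show ?thesis by simp
qed

lemma multiadd_Cons:
  assumes f: "multiadd A B (Suc n) G f" and x: "x \<in> carrier A"
  shows "multiadd A B n G (\<lambda>xs. f (x # xs))"
proof (rule multiaddI)
  fix xs i assume xs: "xs \<in> power_gens A n"
  have c: "x # xs \<in> power_gens A (Suc n)" using x xs by (simp add: power_gens_Cons)
  show "f (x # xs) \<in> carrier G" by (rule multiaddD(1)[OF f c])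
  show "f (x # xs[i := a \<oplus>\<^bsub>A\<^esub> a']) = f (x # xs[i := a]) \<oplus>\<^bsub>G\<^esub> f (x # xs[i := a'])"
    if "i < n" "a \<in> carrier A" "a' \<in> carrier A" for a a'
    using multiaddD(2)[OF f c, of "Suc i" a a'] that by simp
  show "f (x # xs[i := xs ! i \<otimes>\<^bsub>A\<^esub> b]) = f (x # xs[Suc i := b \<otimes>\<^bsub>A\<^esub> xs ! Suc i])"
    if "Suc i < n" "b \<in> B" for b
    using multiaddD(3)[OF f c, of "Suc i" b] that by simp
qed

lemma multiadd_snoc:
  assumes f: "multiadd A B (Suc n) G f" and x: "x \<in> carrier A"
  shows "multiadd A B n G (\<lambda>xs. f (xs @ [x]))"
proof (rule multiaddI)
  fix xs i assume xs: "xs \<in> power_gens A n"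
  have l: "length xs = n" by (rule power_gens_length[OF xs])
  have c: "xs @ [x] \<in> power_gens A (Suc n)" using x xs by (simp add: power_gens_snoc)
  show "f (xs @ [x]) \<in> carrier G" by (rule multiaddD(1)[OF f c])
  show "f (xs[i := a \<oplus>\<^bsub>A\<^esub> a'] @ [x]) = f (xs[i := a] @ [x]) \<oplus>\<^bsub>G\<^esub> f (xs[i := a'] @ [x])"
    if "i < n" "a \<in> carrier A" "a' \<in> carrier A" for a a'
    using multiaddD(2)[OF f c, of i a a'] that l by (simp add: list_update_append1)
  show "f (xs[i := xs ! i \<otimes>\<^bsub>A\<^esub> b] @ [x]) = f (xs[Suc i := b \<otimes>\<^bsub>A\<^esub> xs ! Suc i] @ [x])"
    if "Suc i < n" "b \<in> B" for b
    using multiaddD(3)[OF f c, of i b] that l by (simp add: list_update_append1 nth_append)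
qed

end

context hopf_extension
begin

sublocale HH: acted_ring H "carrier H" R by (rule acted_H)
sublocale AA: acted_ring A base base by (rule acted_smash)

abbreviation "pr \<equiv> iter_pair (mult H) Phi"

lemma pr_Cons: "ys \<noteq> [] \<Longrightarrow> pr (x # ys) (a # as) = x \<bullet> Phi a (pr ys as)"
  by (cases ys) auto

lemma pr_closed: "xs \<in> power_gens H (Suc n) \<Longrightarrow> as \<in> power_gens A n \<Longrightarrow> pr xs as \<in> carrier H"
proof (induction n arbitrary: xs as)
  case 0
  then show ?case by (auto simp: power_gens_def length_Suc_conv)
next
  case (Suc n)
  then obtain x xs' a as' where [simp]: "xs = x # xs'" "as = a # as'"
    by (auto simp: power_gens_def length_Suc_conv)
  have "xs' \<noteq> []" using Suc.prems by (auto simp: power_gens_def)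
  then show ?case using Suc by (simp add: pr_Cons power_gens_Cons A_simps)
qed

lemma gens_SucE:
  assumes "xs \<in> power_gens C (Suc n)"
  obtains x ys where "xs = x # ys" "x \<in> carrier C" "ys \<in> power_gens C n"
  using assms by (auto simp: power_gens_def length_Suc_conv)

lemma gens_not_Nil: "xs \<in> power_gens C (Suc n) \<Longrightarrow> xs \<noteq> []"
  by (auto simp: power_gens_def)

lemma pr_add_left:
  assumes "xs \<in> power_gens H (Suc n)" "as \<in> power_gens A n" "i < Suc n" "x \<in> carrier H" "y \<in> carrier H"
  shows "pr (xs[i := x \<oplus>\<^bsub>H\<^esub> y]) as = pr (xs[i := x]) as \<oplus>\<^bsub>H\<^esub> pr (xs[i := y]) as"
  using assms
proof (induction n arbitrary: xs as i)
  case 0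
  then show ?case by (auto simp: power_gens_def length_Suc_conv)
next
  case (Suc n)
  obtain u us where u: "xs = u # us" "u \<in> carrier H" "us \<in> power_gens H (Suc n)"
    using Suc.prems(1) by (rule gens_SucE)
  obtain a as' where a: "as = a # as'" "a \<in> carrier A" "as' \<in> power_gens A n"
    using Suc.prems(2) by (rule gens_SucE)
  note ne = gens_not_Nil[OF u(3)]
  have aT: "a \<in> carrier TA" using a(2) by (simp add: A_simps)
  note c = pr_closed[OF u(3) a(3)] 
  show ?case
  proof (cases i)
    case 0
    then show ?thesis using ne c aT Suc.prems by (simp add: u a pr_Cons l_distr)
  next
    case (Suc j)
    have "pr (us[j := x]) as' \<in> carrier H" "pr (us[j := y]) as' \<in> carrier H"
      using u a Suc.prems by (auto intro!: pr_closed power_gens_update)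
    then show ?thesis
      using ne aT u(2) Suc Suc.prems(3) Suc.IH[OF u(3) a(3) _ Suc.prems(4,5), of j]
      by (simp add: u(1) a(1) pr_Cons ahom_add[OF Phi_ahom_right] r_distr)
  qed
qed

lemma pr_lmult:
  assumes "xs \<in> power_gens H (Suc n)" "as \<in> power_gens A n" "h \<in> carrier H"
  shows "pr (xs[0 := h \<bullet> xs ! 0]) as = h \<bullet> pr xs as"
proof (cases n)
  case 0
  then show ?thesis using assms by (auto simp: power_gens_def length_Suc_conv)
next
  case (Suc m)
  obtain u us where u: "xs = u # us" "u \<in> carrier H" "us \<in> power_gens H (Suc m)"
    using assms(1) unfolding Suc by (rule gens_SucE)
  obtain a as' where a: "as = a # as'" "a \<in> carrier A" "as' \<in> power_gens A m"
    using assms(2) unfolding Suc by (rule gens_SucE)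
  show ?thesis
    using gens_not_Nil[OF u(3)] pr_closed[OF u(3) a(3)] assms(3) u(2) a(2)
    by (simp add: u(1) a(1) pr_Cons m_assoc A_simps)
qed

lemma pr_balanced_left:
  assumes "xs \<in> power_gens H (Suc n)" "as \<in> power_gens A n" "i < n" "r \<in> R"
  shows "pr (xs[i := xs ! i \<bullet> r]) as = pr (xs[Suc i := r \<bullet> xs ! Suc i]) as"
  using assms
proof (induction n arbitrary: xs as i)
  case (Suc n)
  obtain u us where u: "xs = u # us" "u \<in> carrier H" "us \<in> power_gens H (Suc n)"
    using Suc.prems(1) by (rule gens_SucE)
  obtain a as' where a: "as = a # as'" "a \<in> carrier A" "as' \<in> power_gens A n"
    using Suc.prems(2) by (rule gens_SucE)
  note ne = gens_not_Nil[OF u(3)]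
  have aT: "a \<in> carrier TA" using a(2) by (simp add: A_simps)
  note c = pr_closed[OF u(3) a(3)] 
  show ?case
  proof (cases i)
    case 0
    then show ?thesis using ne c aT Suc.prems(4) u(2)
      by (simp add: u(1) a(1) pr_Cons pr_lmult[OF u(3) a(3)] Phi_R_linear m_assoc)
  next
    case (Suc j)
    then show ?thesis
      using ne Suc.prems(3) Suc.IH[OF u(3) a(3) _ Suc.prems(4), of j]
      by (simp add: u(1) a(1) pr_Cons)
  qed
qed simp

lemma pr_add_right:
  assumes "xs \<in> power_gens H (Suc n)" "as \<in> power_gens A n" "i < n" "x \<in> carrier A" "y \<in> carrier A"
  shows "pr xs (as[i := x \<oplus>\<^bsub>A\<^esub> y]) = pr xs (as[i := x]) \<oplus>\<^bsub>H\<^esub> pr xs (as[i := y])"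
  using assms
proof (induction n arbitrary: xs as i)
  case (Suc n)
  obtain u us where u: "xs = u # us" "u \<in> carrier H" "us \<in> power_gens H (Suc n)"
    using Suc.prems(1) by (rule gens_SucE)
  obtain a as' where a: "as = a # as'" "a \<in> carrier A" "as' \<in> power_gens A n"
    using Suc.prems(2) by (rule gens_SucE)
  note ne = gens_not_Nil[OF u(3)]
  have T: "a \<in> carrier TA" "x \<in> carrier TA" "y \<in> carrier TA"
    using a(2) Suc.prems by (auto simp: A_simps)
  note c = pr_closed[OF u(3) a(3)]
  show ?case
  proof (cases i)
    case 0
    then show ?thesis using ne c T u(2)
      by (simp add: u(1) a(1) pr_Cons A_simps ahom_add[OF Phi_ahom_left] r_distr)
  next
    case (Suc j)
    have "pr us (as'[j := x]) \<in> carrier H" "pr us (as'[j := y]) \<in> carrier H"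
      using u a Suc.prems by (auto intro!: pr_closed power_gens_update)
    then show ?thesis
      using ne T u(2) Suc Suc.prems(3) Suc.IH[OF u(3) a(3) _ Suc.prems(4,5), of j]
      by (simp add: u(1) a(1) pr_Cons ahom_add[OF Phi_ahom_right] r_distr)
  qed
qed simp

lemma pr_rmult:
  assumes "xs \<in> power_gens H (Suc (Suc n))" "as \<in> power_gens A (Suc n)" "h \<in> carrier H"
  shows "pr xs (as[0 := as ! 0 \<star> e h]) = pr xs as \<bullet> h"
proof -
  obtain u us where u: "xs = u # us" "u \<in> carrier H" "us \<in> power_gens H (Suc n)"
    using assms(1) by (rule gens_SucE)
  obtain a as' where a: "as = a # as'" "a \<in> carrier A" "as' \<in> power_gens A n"
    using assms(2) by (rule gens_SucE)
  show ?thesis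
    using gens_not_Nil[OF u(3)] pr_closed[OF u(3) a(3)] assms(3) u(2) a(2)
    by (simp add: u(1) a(1) pr_Cons m_assoc A_simps Phi_mult_e)
qed

lemma pr_balanced_right:
  assumes "xs \<in> power_gens H (Suc n)" "as \<in> power_gens A n" "Suc i < n" "h \<in> carrier H"
  shows "pr xs (as[i := e h \<star> as ! i]) = pr xs (as[Suc i := as ! Suc i \<star> e h])"
  using assms
proof (induction n arbitrary: xs as i)
  case (Suc n)
  obtain u us where u: "xs = u # us" "u \<in> carrier H" "us \<in> power_gens H (Suc n)"
    using Suc.prems(1) by (rule gens_SucE)
  obtain a as' where a: "as = a # as'" "a \<in> carrier A" "as' \<in> power_gens A n"
    using Suc.prems(2) by (rule gens_SucE)
  note ne = gens_not_Nil[OF u(3)]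
  have aT: "a \<in> carrier TA" using a(2) by (simp add: A_simps)
  note c = pr_closed[OF u(3) a(3)] 
  show ?case
  proof (cases i)
    case 0
    obtain m where m: "n = Suc m" using Suc.prems(3) 0 by (cases n) auto
    show ?thesis using 0 ne c aT Suc.prems(4) u(2) pr_rmult[OF u(3)[unfolded m] a(3)[unfolded m] Suc.prems(4)]
      by (simp add: u(1) a(1) pr_Cons Phi_e_mult)
  next
    case (Suc j)
    then show ?thesis
      using ne Suc.prems(3) Suc.IH[OF u(3) a(3) _ Suc.prems(4), of j]
      by (simp add: u(1) a(1) pr_Cons)
  qed
qed simp

lemma pr_mult_last:
  assumes "xs \<in> power_gens H (Suc (Suc n))" "as \<in> power_gens A (Suc n)" "h \<in> carrier H"
  shows "pr (xs[Suc n := xs ! Suc n \<bullet> h]) as = pr xs (as[n := e h \<star> as ! n])"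
  using assms
proof (induction n arbitrary: xs as)
  case 0
  then obtain x y a where [simp]: "xs = [x, y]" "as = [a]" and c: "x \<in> carrier H" "y \<in> carrier H" "a \<in> carrier TA"
    by (auto simp: power_gens_def length_Suc_conv A_simps)
  show ?case using c 0(3) by (simp add: Phi_e_mult)
next
  case (Suc n)
  obtain u us where u: "xs = u # us" "u \<in> carrier H" "us \<in> power_gens H (Suc (Suc n))"
    using Suc.prems(1) by (rule gens_SucE)
  obtain a as' where a: "as = a # as'" "a \<in> carrier A" "as' \<in> power_gens A (Suc n)"
    using Suc.prems(2) by (rule gens_SucE)
  show ?case
    using gens_not_Nil[OF u(3)] Suc.IH[OF u(3) a(3) Suc.prems(3)] by (simp add: u(1) a(1) pr_Cons)
qed

definition "pairing xs as = pr xs (rev as)"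

lemma rev_gens: "as \<in> power_gens C n \<Longrightarrow> rev as \<in> power_gens C n"
  by (auto simp: power_gens_def)

lemma pairing_closed: "xs \<in> power_gens H (Suc n) \<Longrightarrow> as \<in> power_gens A n \<Longrightarrow> pairing xs as \<in> carrier H"
  unfolding pairing_def by (rule pr_closed[OF _ rev_gens])

lemma multiadd_pairing_left:
  assumes as: "as \<in> power_gens A n" shows "multiadd H R (Suc n) H (\<lambda>xs. pairing xs as)"
  by (rule multiaddI)
    (use as in \<open>auto simp: pairing_def intro!: pr_closed pr_add_left pr_balanced_left rev_gens\<close>)

lemma multiadd_pairing_right:
  assumes xs: "xs \<in> power_gens H (Suc n)" shows "multiadd A base n H (pairing xs)"
proof (rule multiaddI)
  fix as assume as: "as \<in> power_gens A n"
  note r = rev_gens[OF as]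
  have l: "length as = n" by (rule power_gens_length[OF as])
  show "pairing xs as \<in> carrier H" by (rule pairing_closed[OF xs as])
  show "pairing xs (as[i := a \<oplus>\<^bsub>A\<^esub> a']) = pairing xs (as[i := a]) \<oplus>\<^bsub>H\<^esub> pairing xs (as[i := a'])"
    if "i < n" "a \<in> carrier A" "a' \<in> carrier A" for i a a'
    using that xs r l by (simp add: pairing_def rev_update_Suc pr_add_right)
  show "pairing xs (as[i := as ! i \<star> b]) = pairing xs (as[Suc i := b \<star> as ! Suc i])"
    if i: "Suc i < n" and b: "b \<in> base" for i b
  proof -
    obtain h where h: "b = e h" "h \<in> carrier H" using b by (auto simp: base_eq)
    let ?j = "n - Suc (Suc i)"
    have "Suc ?j < n" "n - Suc i = Suc ?j" using i by auto
    moreover have "rev as ! ?j = as ! Suc i" "rev as ! Suc ?j = as ! i"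
      using i l by (auto simp: rev_nth Suc_diff_Suc)
    ultimately show ?thesis
      using pr_balanced_right[OF xs r _ h(2), of ?j] i l by (simp add: pairing_def rev_update_Suc h(1))
  qed
qed

text \<open>\<open>M\<^sub>n\<^sub>+\<^sub>1\<close> is \<open>(H \<otimes>\<^sub>R H) \<otimes>\<^sub>H M\<^sub>n\<close>, dual to \<open>N\<^sub>n \<otimes>\<^sub>H A\<close>, and dual bases of tensor products are tensor products
  of dual bases. As a list, \<open>(u \<otimes> v) \<otimes>\<^sub>H (x\<^sub>0 \<otimes> \<dots> \<otimes> x\<^sub>n)\<close> is \<open>[u, v x\<^sub>0, \<dots>, x\<^sub>n]\<close>.\<close>

primrec basis_list :: "nat \<Rightarrow> ('h list \<times> (('h set \<Rightarrow> 'k) \<times> 'h \<Rightarrow>\<^sub>0 int) set list) list" where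
  "basis_list 0 = [([\<one>\<^bsub>H\<^esub>], [])]"
| "basis_list (Suc n) = concat (map (\<lambda>p. map (\<lambda>q.
      (fst (fst p) # (snd (fst p) \<bullet> hd (fst q)) # tl (fst q), snd q @ [snd p])) (basis_list n)) basis1)"

lemma basis_list_gens: "set (basis_list n) \<subseteq> power_gens H (Suc n) \<times> power_gens A n"
proof (induction n)
  case 0
  show ?case by (auto simp: power_gens_def)
next
  case (Suc n)
  show ?case
  proof
    fix z assume "z \<in> set (basis_list (Suc n))"
    then obtain p q where p: "p \<in> set basis1" and q: "q \<in> set (basis_list n)"
      and z: "z = (fst (fst p) # (snd (fst p) \<bullet> hd (fst q)) # tl (fst q), snd q @ [snd p])"
      by auto
    from q Suc have "fst q \<in> power_gens H (Suc n)" and q2: "snd q \<in> power_gens A n" by auto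
    then obtain x xs where x: "fst q = x # xs" "x \<in> carrier H" "xs \<in> power_gens H n"
      by (rule_tac gens_SucE)
    from p basis1 have "fst (fst p) \<in> carrier H" "snd (fst p) \<in> carrier H" "snd p \<in> carrier A"
      by (auto simp: A_simps)
    then show "z \<in> power_gens H (Suc (Suc n)) \<times> power_gens A (Suc n)"
      using x q2 by (simp add: z power_gens_Cons power_gens_snoc)
  qed
qed

declare basis_list.simps(2) [simp del]

lemma lsum_basis_list_Suc:
  assumes G: "abelian_group G"
    and F: "\<And>xs as. xs \<in> power_gens H (Suc (Suc n)) \<Longrightarrow> as \<in> power_gens A (Suc n) \<Longrightarrow> F xs as \<in> carrier G"
  shows "lsum G (\<lambda>(xs, as). F xs as) (basis_list (Suc n)) =
    lsum G (\<lambda>((u, v), \<nu>). lsum G (\<lambda>(xs, as). F (u # (v \<bullet> hd xs) # tl xs) (as @ [\<nu>])) (basis_list n)) basis1"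
proof -
  interpret G: abelian_group G by (rule G)
  let ?ys = "\<lambda>p. map (\<lambda>q. (fst (fst p) # (snd (fst p) \<bullet> hd (fst q)) # tl (fst q), snd q @ [snd p])) (basis_list n)"
  have c: "(\<lambda>(xs, as). F xs as) y \<in> carrier G" if p: "p \<in> set basis1" and y: "y \<in> set (?ys p)" for p y
  proof -
    have "y \<in> set (basis_list (Suc n))" unfolding basis_list.simps set_concat set_map using p y by auto
    then show ?thesis using basis_list_gens[of "Suc n"] by (auto intro!: F)
  qed
  have "lsum G (\<lambda>(xs, as). F xs as) (basis_list (Suc n)) = lsum G (\<lambda>p. lsum G (\<lambda>(xs, as). F xs as) (?ys p)) basis1"
    unfolding basis_list.simps by (rule G.lsum_concat) (rule c)
  then show ?thesis by (simp add: split_def lsum_map)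
qed

lemma hd_tl_update: "xs \<in> power_gens C (Suc n) \<Longrightarrow> xs[0 := y] = y # tl xs \<and> xs ! 0 = hd xs"
  by (auto simp: power_gens_def length_Suc_conv)

text \<open>Testing against all maps \<open>f\<close> that factor through \<open>M\<^sub>n\<close> lets the induction hypothesis be applied to \<open>f\<close>
  with its first argument fixed. The sum over \<open>basis1\<close> is carried out first, on the two leading
  factors.\<close>

lemma basis_list_dual_left:
  assumes G: "abelian_group G"
  shows "multiadd H R (Suc n) G f \<Longrightarrow> ys \<in> power_gens H (Suc n) \<Longrightarrow>
    lsum G (\<lambda>(xs, as). f (xs[0 := pairing ys as \<bullet> xs ! 0])) (basis_list n) = f ys"
proof (induction n arbitrary: f ys)
  case 0
  interpret G: abelian_group G by (rule G)
  obtain y where [simp]: "ys = [y]" and y: "y \<in> carrier H" using 0(2) by (auto simp: power_gens_def length_Suc_conv)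
  have "f [y] \<in> carrier G" using multiaddD(1)[OF 0(1,2)] by simp
  then show ?case using y by (simp add: pairing_def)
next
  case (Suc n)
  interpret G: abelian_group G by (rule G)
  note f = Suc.prems(1)
  obtain y zs where y: "ys = y # zs" "y \<in> carrier H" "zs \<in> power_gens H (Suc n)"
    using Suc.prems(2) by (rule gens_SucE)
  have fc: "f (u # v # xs) \<in> carrier G" if "u \<in> carrier H" "v \<in> carrier H" "xs \<in> power_gens H n" for u v xs
    using that by (intro multiaddD(1)[OF f]) (simp add: power_gens_Cons)
  have bal: "balanced G (\<lambda>p q. f (p # (q \<bullet> hd xs) # tl xs))" if xs: "xs \<in> power_gens H (Suc n)" for xs
  proof -
    obtain x0 xs' where x: "xs = x0 # xs'" "x0 \<in> carrier H" "xs' \<in> power_gens H n" using xs by (rule gens_SucE)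
    show ?thesis unfolding balanced_def
    proof (intro conjI ballI)
      fix q assume q: "q \<in> carrier H"
      show "(\<lambda>p. f (p # (q \<bullet> hd xs) # tl xs)) \<in> ahom H G"
        using x q by (intro HH.multiadd_ahom_hd[OF f]) (simp add: power_gens_Cons)
    next
      fix p assume p: "p \<in> carrier H"
      show "(\<lambda>q. f (p # (q \<bullet> hd xs) # tl xs)) \<in> ahom H G"
        using ahom_comp[OF rmult_ahom[OF x(2)] HH.multiadd_ahom_hd[OF HH.multiadd_Cons[OF f p] x(3)]] x by simp
    next
      fix p q r assume *: "p \<in> carrier H" "q \<in> carrier H" "r \<in> R"
      have "p # (q \<bullet> x0) # xs' \<in> power_gens H (Suc (Suc n))" using * x by (simp add: power_gens_Cons)
      from multiaddD(3)[OF f this, of 0 r]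
      show "f ((p \<bullet> r) # (q \<bullet> hd xs) # tl xs) = f (p # ((r \<bullet> q) \<bullet> hd xs) # tl xs)"
        using * x by (simp add: m_assoc)
    qed
  qed
  have pc: "pairing zs as \<in> carrier H" if "as \<in> power_gens A n" for as by (rule pairing_closed[OF y(3) that])
  have "lsum G (\<lambda>(xs, as). f (xs[0 := pairing ys as \<bullet> xs ! 0])) (basis_list (Suc n)) =
    lsum G (\<lambda>((u, v), \<nu>). lsum G (\<lambda>(xs, as). f ((u # (v \<bullet> hd xs) # tl xs)
      [0 := pairing ys (as @ [\<nu>]) \<bullet> (u # (v \<bullet> hd xs) # tl xs) ! 0])) (basis_list n)) basis1"
  proof (rule lsum_basis_list_Suc[OF G])
    fix xs as assume "xs \<in> power_gens H (Suc (Suc n))" "as \<in> power_gens A (Suc n)"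
    then show "f (xs[0 := pairing ys as \<bullet> xs ! 0]) \<in> carrier G"
      using pairing_closed[OF Suc.prems(2)]
      by (intro multiaddD(1)[OF f] power_gens_update m_closed) (auto intro: power_gens_nth)
  qed
  also have "\<dots> = lsum G (\<lambda>p. lsum G (\<lambda>q. f (((y \<bullet> Phi (snd p) (pairing zs (snd q))) \<bullet> fst (fst p))
      # (snd (fst p) \<bullet> hd (fst q)) # tl (fst q))) (basis_list n)) basis1"
    using gens_not_Nil[OF y(3)] by (simp add: split_def y(1) pairing_def pr_Cons)
  also have "\<dots> = lsum G (\<lambda>q. lsum G (\<lambda>p. f (((y \<bullet> Phi (snd p) (pairing zs (snd q))) \<bullet> fst (fst p))
      # (snd (fst p) \<bullet> hd (fst q)) # tl (fst q))) basis1) (basis_list n)"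
  proof (rule G.lsum_swap)
    fix p q assume p: "p \<in> set basis1" and q: "q \<in> set (basis_list n)"
    from q basis_list_gens[of n] have q1: "fst q \<in> power_gens H (Suc n)" and q2: "snd q \<in> power_gens A n" by auto
    obtain x xs where x: "fst q = x # xs" "x \<in> carrier H" "xs \<in> power_gens H n"
      using q1 by (rule gens_SucE)
    from p basis1 have "fst (fst p) \<in> carrier H" "snd (fst p) \<in> carrier H" "snd p \<in> carrier TA" by auto
    then show "f (((y \<bullet> Phi (snd p) (pairing zs (snd q))) \<bullet> fst (fst p))
      # (snd (fst p) \<bullet> hd (fst q)) # tl (fst q)) \<in> carrier G"
      using x pc[OF q2] y(2) by (simp add: fc)
  qed
  also have "\<dots> = lsum G (\<lambda>(xs, as). f (y # xs[0 := pairing zs as \<bullet> xs ! 0])) (basis_list n)"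
  proof (rule lsum_cong)
    fix q assume q: "q \<in> set (basis_list n)"
    from q basis_list_gens[of n] have q1: "fst q \<in> power_gens H (Suc n)" and q2: "snd q \<in> power_gens A n" by auto
    have "lsum G (\<lambda>p. f (((y \<bullet> Phi (snd p) (pairing zs (snd q))) \<bullet> fst (fst p))
      # (snd (fst p) \<bullet> hd (fst q)) # tl (fst q))) basis1 = f (y # (pairing zs (snd q) \<bullet> hd (fst q)) # tl (fst q))"
      using basis1_dual_left[OF G bal[OF q1] y(2) pc[OF q2]] by (simp add: split_def)
    then show "lsum G (\<lambda>p. f (((y \<bullet> Phi (snd p) (pairing zs (snd q))) \<bullet> fst (fst p))
      # (snd (fst p) \<bullet> hd (fst q)) # tl (fst q))) basis1 =
      (case q of (xs, as) \<Rightarrow> f (y # xs[0 := pairing zs as \<bullet> xs ! 0]))"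
      using hd_tl_update[OF q1] by (simp add: split_def)
  qed simp
  also have "\<dots> = f ys" using Suc.IH[OF HH.multiadd_Cons[OF f y(2)] y(3)] by (simp add: y(1))
  finally show ?case .
qed

text \<open>Write \<open>z\<close> for the pairing of \<open>xs\<close> with \<open>bs\<close>. The new factors contribute
  \<open>\<nu> \<cdot> u \<Phi>\<^sub>b(v z) = \<nu> \<cdot> u \<Phi>\<^bsub>zb\<^esub>(v)\<close>, whose sum over \<open>basis1\<close> is \<open>zb\<close>.\<close>

lemma basis_list_dual_right_step:
  assumes G: "abelian_group G" and g: "multiadd A base (Suc n) G g"
    and b: "b \<in> carrier TA" and bs: "bs \<in> power_gens A n"
  shows "lsum G (\<lambda>(xs, as). g (as[n := as ! n \<star> e (pairing xs (bs @ [b]))])) (basis_list (Suc n)) =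
    lsum G (\<lambda>(xs, as). g (as @ [e (pairing xs bs) \<star> b])) (basis_list n)"
proof -
  interpret G: abelian_group G by (rule G)
  have bsb: "bs @ [b] \<in> power_gens A (Suc n)" using b bs by (simp add: power_gens_snoc A_simps)
  have Ae: "a \<star> e h \<in> carrier A" if "a \<in> carrier TA" "h \<in> carrier H" for a h
    using ahom_closed[OF mult_e_ahom[OF that(1)] that(2)] by (simp add: A_simps)
  have gl: "(\<lambda>a. g (as @ [a])) \<in> ahom TA G" if "as \<in> power_gens A n" for as
    using AA.multiadd_ahom_last[OF g that] by (simp add: ahom_A)
  have pc: "pairing xs bs \<in> carrier H" if "xs \<in> power_gens H (Suc n)" for xs by (rule pairing_closed[OF that bs])
  have eb: "e (pairing xs bs) \<star> b \<in> carrier TA" if "xs \<in> power_gens H (Suc n)" for xs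
    using ahom_closed[OF e_mult_ahom[OF pc[OF that]] b] .
  have "lsum G (\<lambda>(xs, as). g (as[n := as ! n \<star> e (pairing xs (bs @ [b]))])) (basis_list (Suc n)) =
    lsum G (\<lambda>((u, v), \<nu>). lsum G (\<lambda>(xs, as). g ((as @ [\<nu>])[n := (as @ [\<nu>]) ! n \<star>
      e (pairing (u # (v \<bullet> hd xs) # tl xs) (bs @ [b]))])) (basis_list n)) basis1"
  proof (rule lsum_basis_list_Suc[OF G])
    fix xs as assume *: "xs \<in> power_gens H (Suc (Suc n))" "as \<in> power_gens A (Suc n)"
    have "as ! n \<in> carrier TA" using power_gens_nth[OF *(2), of n] by (simp add: A_simps)
    then show "g (as[n := as ! n \<star> e (pairing xs (bs @ [b]))]) \<in> carrier G"
      using * pairing_closed[OF *(1) bsb] by (intro multiaddD(1)[OF g] power_gens_update Ae)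
  qed
  also have "\<dots> = lsum G (\<lambda>p. lsum G (\<lambda>q. g (snd q @ [snd p \<star>
      e (fst (fst p) \<bullet> Phi (e (pairing (fst q) bs) \<star> b) (snd (fst p)))])) (basis_list n)) basis1"
    unfolding split_def
  proof (intro lsum_cong refl)
    fix p q assume p: "p \<in> set basis1" and q: "q \<in> set (basis_list n)"
    from q basis_list_gens[of n] have q1: "fst q \<in> power_gens H (Suc n)" and q2: "snd q \<in> power_gens A n" by auto
    obtain x xs where x: "fst q = x # xs" "x \<in> carrier H" "xs \<in> power_gens H n"
      using q1 by (rule gens_SucE)
    from p basis1 have p': "fst (fst p) \<in> carrier H" "snd (fst p) \<in> carrier H" "snd p \<in> carrier TA" by auto
    have "pr ((snd (fst p) \<bullet> x) # xs) (rev bs) = snd (fst p) \<bullet> pairing (fst q) bs"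
      using pr_lmult[OF q1 rev_gens[OF bs] p'(2)] by (simp add: x(1) pairing_def)
    then have "pairing (fst (fst p) # (snd (fst p) \<bullet> hd (fst q)) # tl (fst q)) (bs @ [b]) =
        fst (fst p) \<bullet> Phi (e (pairing (fst q) bs) \<star> b) (snd (fst p))"
      using p' pc[OF q1] b by (simp add: pairing_def[of _ "bs @ [b]"] x(1) Phi_e_mult)
    then show "g ((snd q @ [snd p])[n := (snd q @ [snd p]) ! n \<star>
          e (pairing (fst (fst p) # (snd (fst p) \<bullet> hd (fst q)) # tl (fst q)) (bs @ [b]))]) =
        g (snd q @ [snd p \<star> e (fst (fst p) \<bullet> Phi (e (pairing (fst q) bs) \<star> b) (snd (fst p)))])"
      using power_gens_length[OF q2] by (simp add: list_update_append nth_append)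
  qed
  also have "\<dots> = lsum G (\<lambda>q. lsum G (\<lambda>p. g (snd q @ [snd p \<star>
      e (fst (fst p) \<bullet> Phi (e (pairing (fst q) bs) \<star> b) (snd (fst p)))])) basis1) (basis_list n)"
  proof (rule G.lsum_swap)
    fix p q assume p: "p \<in> set basis1" and q: "q \<in> set (basis_list n)"
    from q basis_list_gens[of n] have q1: "fst q \<in> power_gens H (Suc n)" and q2: "snd q \<in> power_gens A n" by auto
    from p basis1 have p': "fst (fst p) \<in> carrier H" "snd (fst p) \<in> carrier H" "snd p \<in> carrier TA" by auto
    show "g (snd q @ [snd p \<star> e (fst (fst p) \<bullet> Phi (e (pairing (fst q) bs) \<star> b) (snd (fst p)))]) \<in> carrier G"
      using p' eb[OF q1] q2 by (intro multiaddD(1)[OF g]) (simp add: power_gens_snoc Ae)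
  qed
  also have "\<dots> = lsum G (\<lambda>(xs, as). g (as @ [e (pairing xs bs) \<star> b])) (basis_list n)"
    unfolding split_def
  proof (intro lsum_cong refl)
    fix q assume q: "q \<in> set (basis_list n)"
    from q basis_list_gens[of n] have q1: "fst q \<in> power_gens H (Suc n)" and q2: "snd q \<in> power_gens A n" by auto
    let ?a = "e (pairing (fst q) bs) \<star> b"
    have "lsum G (\<lambda>p. g (snd q @ [snd p \<star> e (fst (fst p) \<bullet> Phi ?a (snd (fst p)))])) basis1 =
        g (snd q @ [lsum TA (\<lambda>p. snd p \<star> e (fst (fst p) \<bullet> Phi ?a (snd (fst p)))) basis1])"
      using basis1 eb[OF q1]
      by (intro ahom_lsum[OF TA_abelian G gl[OF q2], symmetric]) (auto intro!: ahom_closed[OF mult_e_ahom])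
    then show "lsum G (\<lambda>p. g (snd q @ [snd p \<star> e (fst (fst p) \<bullet> Phi ?a (snd (fst p)))])) basis1 =
        g (snd q @ [?a])"
      using basis1_dual_right[OF eb[OF q1]] by (simp add: split_def)
  qed
  finally show ?thesis .
qed

text \<open>After the previous lemma \<open>z\<close> stands in front of the last factor, and the balancing relation moves it to the end of
  the list that the induction hypothesis speaks about.\<close>

lemma basis_list_dual_right:
  assumes G: "abelian_group G"
  shows "multiadd A base (Suc n) G g \<Longrightarrow> bs \<in> power_gens A (Suc n) \<Longrightarrow>
    lsum G (\<lambda>(xs, as). g (as[n := as ! n \<star> e (pairing xs bs)])) (basis_list (Suc n)) = g bs"
proof (induction n arbitrary: g bs)
  case 0
  interpret G: abelian_group G by (rule G)
  obtain b where b: "bs = [b]" "b \<in> carrier TA" using 0(2) by (auto simp: power_gens_def length_Suc_conv A_simps)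
  have "[] \<in> power_gens A 0" by (simp add: power_gens_def)
  from basis_list_dual_right_step[OF G 0(1) b(2) this] show ?case
    using b multiaddD(1)[OF 0] by (simp add: pairing_def e_one_mult)
next
  case (Suc n)
  obtain bs' b where bs: "bs = bs' @ [b]" using Suc.prems(2) by (cases bs rule: rev_cases) (auto simp: power_gens_def)
  then have bs': "bs' \<in> power_gens A (Suc n)" and b: "b \<in> carrier A"
    using Suc.prems(2) by (auto simp: power_gens_snoc)
  have bT: "b \<in> carrier TA" using b by (simp add: A_simps)
  have "lsum G (\<lambda>(xs, as). g (as[Suc n := as ! Suc n \<star> e (pairing xs bs)])) (basis_list (Suc (Suc n))) =
      lsum G (\<lambda>(xs, as). g (as @ [e (pairing xs bs') \<star> b])) (basis_list (Suc n))"
    unfolding bs by (rule basis_list_dual_right_step[OF G Suc.prems(1) bT bs'])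
  also have "\<dots> = lsum G (\<lambda>(xs, as). g (as[n := as ! n \<star> e (pairing xs bs')] @ [b])) (basis_list (Suc n))"
    unfolding split_def
  proof (intro lsum_cong refl)
    fix q assume q: "q \<in> set (basis_list (Suc n))"
    from q basis_list_gens[of "Suc n"] have q1: "fst q \<in> power_gens H (Suc (Suc n))" and q2: "snd q \<in> power_gens A (Suc n)" by auto
    have "e (pairing (fst q) bs') \<in> base" using pairing_closed[OF q1 bs'] by (auto simp: base_eq)
    moreover have "snd q @ [b] \<in> power_gens A (Suc (Suc n))" using q2 b by (simp add: power_gens_snoc)
    ultimately show "g (snd q @ [e (pairing (fst q) bs') \<star> b]) =
        g ((snd q)[n := snd q ! n \<star> e (pairing (fst q) bs')] @ [b])"
      using multiaddD(3)[OF Suc.prems(1), of "snd q @ [b]" n "e (pairing (fst q) bs')"] power_gens_length[OF q2]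
      by (simp add: list_update_append nth_append)
  qed
  also have "\<dots> = g bs" using Suc.IH[OF AA.multiadd_snoc[OF Suc.prems(1) b] bs'] by (simp add: bs)
  finally show ?case .
qed

abbreviation (input) "H_dual M N P L \<equiv> dual_pair H (mult H) M (lact M) (\<lambda>c v. ract M v c)
  N (\<lambda>c. lact N (e c)) (\<lambda>c v. ract N v (e c)) P L"

lemma bimod_power_H: "rbimod (carrier H) (tensor_power H R (Suc n))"
  by (simp add: bimod_def HH.abelian_power HH.lact_ahom HH.ract_ahom)

lemma bimod_power_A: "rbimod base (tensor_power A base (Suc n))"
  by (simp add: bimod_def AA.abelian_power AA.lact_ahom AA.ract_ahom)

lemma bimod_reindex: "bimod (f ` C) V l r \<longleftrightarrow> bimod C V (\<lambda>c. l (f c)) (\<lambda>c. r (f c))"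
  by (simp add: bimod_def)

lemma biadditive_ext:
  assumes "\<And>n. n \<in> carrier (tensor_power A base k) \<Longrightarrow> (\<lambda>m. F m n) \<in> ahom (tensor_power H R j) H"
    and "\<And>n. n \<in> carrier (tensor_power A base k) \<Longrightarrow> (\<lambda>m. F' m n) \<in> ahom (tensor_power H R j) H"
    and "\<And>m. m \<in> carrier (tensor_power H R j) \<Longrightarrow> F m \<in> ahom (tensor_power A base k) H"
    and "\<And>m. m \<in> carrier (tensor_power H R j) \<Longrightarrow> F' m \<in> ahom (tensor_power A base k) H"
    and "\<And>xs as. xs \<in> power_gens H j \<Longrightarrow> as \<in> power_gens A k \<Longrightarrow> F (HH.pg j xs) (AA.pg k as) = F' (HH.pg j xs) (AA.pg k as)"
    and m: "m \<in> carrier (tensor_power H R j)" and n: "n \<in> carrier (tensor_power A base k)"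
  shows "F m n = F' m n"
proof (rule HH.power_ext[OF H_abelian assms(1,2)[OF n] _ m])
  fix xs assume "xs \<in> power_gens H j"
  then show "F (HH.pg j xs) n = F' (HH.pg j xs) n"
    by (intro AA.power_ext[OF H_abelian assms(3,4) assms(5) n] HH.pg_closed)
qed

lemma dual_pair_powers:
  "\<exists>P L. H_dual (tensor_power H R (Suc (Suc n))) (tensor_power A base (Suc n)) P L"
proof -
  let ?M = "tensor_power H R (Suc (Suc n))" and ?N = "tensor_power A base (Suc n)"
  let ?gM = "HH.pg (Suc (Suc n))" and ?gN = "AA.pg (Suc n)"
  note G = H_abelian and MG = HH.abelian_power and NG = AA.abelian_power
  obtain P where P: "\<And>t. t \<in> carrier ?N \<Longrightarrow> (\<lambda>m. P m t) \<in> ahom ?M H"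
      "\<And>t. t \<in> carrier ?M \<Longrightarrow> P t \<in> ahom ?N H"
      "\<And>xs as. xs \<in> power_gens H (Suc (Suc n)) \<Longrightarrow> as \<in> power_gens A (Suc n) \<Longrightarrow> P (?gM xs) (?gN as) = pairing xs as"
    using presented_pairing[OF HH.presented_power AA.presented_power G
        HH.multiadd_extend[OF G multiadd_pairing_left] AA.multiadd_extend[OF G multiadd_pairing_right]]
    by metis
  have be: "e c \<in> base" if "c \<in> carrier H" for c using that by (auto simp: base_eq)
  note la = HH.lact_ahom[OF _ zero_less_Suc] and ra = HH.ract_ahom[OF _ zero_less_Suc]
  note laN = AA.lact_ahom[OF be zero_less_Suc] and raN = AA.ract_ahom[OF be zero_less_Suc]
  note gens = power_gens_update power_gens_nth
  define L where "L = map (\<lambda>(xs, as). (?gM xs, ?gN as)) (basis_list (Suc n))"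
  have "H_dual ?M ?N P L"
  proof (rule dual_pair.intro)
    show "rbimod (carrier H) ?M" by (rule bimod_power_H)
    show "bimod (carrier H) ?N (\<lambda>c. lact ?N (e c)) (\<lambda>c v. ract ?N v (e c))"
      using bimod_power_A[of n] unfolding base_eq by (simp only: bimod_reindex)
    show "set L \<subseteq> carrier ?M \<times> carrier ?N"
      using basis_list_gens[of "Suc n"] by (auto simp: L_def intro!: HH.pg_closed AA.pg_closed)
  next
    fix c m t assume c: "c \<in> carrier H" and m: "m \<in> carrier ?M" and t: "t \<in> carrier ?N"
    show "P (lact ?M c m) t = c \<bullet> P m t"
    proof (rule biadditive_ext[OF _ _ _ _ _ m t])
      show "(\<lambda>m. P (lact ?M c m) t) \<in> ahom ?M H" if "t \<in> carrier ?N" for t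
        using ahom_comp[OF la[OF c] P(1)[OF that]] .
      show "(\<lambda>m. c \<bullet> P m t) \<in> ahom ?M H" if "t \<in> carrier ?N" for t
        using ahom_comp[OF P(1)[OF that] lmult_ahom[OF c]] .
      show "P (lact ?M c m) \<in> ahom ?N H" if "m \<in> carrier ?M" for m
        using P(2)[OF ahom_closed[OF la[OF c] that]] .
      show "(\<lambda>t. c \<bullet> P m t) \<in> ahom ?N H" if "m \<in> carrier ?M" for m
        using ahom_comp[OF P(2)[OF that] lmult_ahom[OF c]] .
      fix xs as assume xs: "xs \<in> power_gens H (Suc (Suc n))" and as: "as \<in> power_gens A (Suc n)"
      then have "xs[0 := c \<bullet> xs ! 0] \<in> power_gens H (Suc (Suc n))" using c by (intro gens m_closed) auto
      then show "P (lact ?M c (?gM xs)) (?gN as) = c \<bullet> P (?gM xs) (?gN as)"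
        using xs as c rev_gens[OF as] by (simp add: HH.lact_pg P(3) pairing_def pr_lmult)
    qed
    show "P m (ract ?N t (e c)) = P m t \<bullet> c"
    proof (rule biadditive_ext[OF _ _ _ _ _ m t])
      show "(\<lambda>m. P m (ract ?N t (e c))) \<in> ahom ?M H" if "t \<in> carrier ?N" for t
        using P(1)[OF ahom_closed[OF raN[OF c] that]] .
      show "(\<lambda>m. P m t \<bullet> c) \<in> ahom ?M H" if "t \<in> carrier ?N" for t
        using ahom_comp[OF P(1)[OF that] rmult_ahom[OF c]] .
      show "(\<lambda>t. P m (ract ?N t (e c))) \<in> ahom ?N H" if "m \<in> carrier ?M" for m
        using ahom_comp[OF raN[OF c] P(2)[OF that]] .
      show "(\<lambda>t. P m t \<bullet> c) \<in> ahom ?N H" if "m \<in> carrier ?M" for m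
        using ahom_comp[OF P(2)[OF that] rmult_ahom[OF c]] .
      fix xs as assume xs: "xs \<in> power_gens H (Suc (Suc n))" and as: "as \<in> power_gens A (Suc n)"
      then have g: "as[n := as ! n \<star> e c] \<in> power_gens A (Suc n)" using c be by (intro gens AA.rmult_closed) auto
      have "rev (as[n := as ! n \<star> e c]) = (rev as)[0 := rev as ! 0 \<star> e c]"
        using power_gens_length[OF as] by (simp add: rev_update_Suc rev_nth)
      then show "P (?gM xs) (ract ?N (?gN as) (e c)) = P (?gM xs) (?gN as) \<bullet> c"
        using xs as g c be pr_rmult[OF xs rev_gens[OF as] c]
        by (simp add: AA.ract_pg P(3) pairing_def)
    qed
    show "P (ract ?M m c) t = P m (lact ?N (e c) t)"
    proof (rule biadditive_ext[OF _ _ _ _ _ m t])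
      show "(\<lambda>m. P (ract ?M m c) t) \<in> ahom ?M H" if "t \<in> carrier ?N" for t
        using ahom_comp[OF ra[OF c] P(1)[OF that]] .
      show "(\<lambda>m. P m (lact ?N (e c) t)) \<in> ahom ?M H" if "t \<in> carrier ?N" for t
        using P(1)[OF ahom_closed[OF laN[OF c] that]] .
      show "P (ract ?M m c) \<in> ahom ?N H" if "m \<in> carrier ?M" for m
        using P(2)[OF ahom_closed[OF ra[OF c] that]] .
      show "(\<lambda>t. P m (lact ?N (e c) t)) \<in> ahom ?N H" if "m \<in> carrier ?M" for m
        using ahom_comp[OF laN[OF c] P(2)[OF that]] .
      fix xs as assume xs: "xs \<in> power_gens H (Suc (Suc n))" and as: "as \<in> power_gens A (Suc n)"
      then have g: "as[0 := e c \<star> as ! 0] \<in> power_gens A (Suc n)" using c be by (intro gens AA.lmult_closed) auto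
      have g': "xs[Suc n := xs ! Suc n \<bullet> c] \<in> power_gens H (Suc (Suc n))" using c xs by (intro gens m_closed) auto
      have "rev (as[0 := e c \<star> as ! 0]) = (rev as)[n := e c \<star> rev as ! n]"
        using power_gens_length[OF as] by (simp add: rev_update_Suc rev_nth)
      then show "P (ract ?M (?gM xs) c) (?gN as) = P (?gM xs) (lact ?N (e c) (?gN as))"
        using xs as g g' c be pr_mult_last[OF xs rev_gens[OF as] c]
        by (simp add: AA.lact_pg HH.ract_pg P(3) pairing_def)
    qed
  next
    fix m assume m: "m \<in> carrier ?M"
    have aux: "(\<lambda>h. lact ?M h (?gM xs)) \<in> ahom H ?M" if xs: "xs \<in> power_gens H (Suc (Suc n))" for xs
      using ahom_comp[OF rmult_ahom HH.multiadd_ahom[OF HH.multiadd_pg xs zero_less_Suc], of "xs ! 0"] xs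
      by (simp add: ahom_def HH.lact_pg power_gens_nth)
    show "lsum ?M (\<lambda>(a, b). lact ?M (P m b) a) L = m"
    proof (rule HH.power_ext[OF MG _ ahom_id _ m])
      show "(\<lambda>m. lsum ?M (\<lambda>(a, b). lact ?M (P m b) a) L) \<in> ahom ?M ?M"
        unfolding split_def
      proof (rule ahom_lsum_fun[OF MG])
        fix i assume "i \<in> set L"
        then obtain xs as where i: "i = (?gM xs, ?gN as)" and g: "xs \<in> power_gens H (Suc (Suc n))" "as \<in> power_gens A (Suc n)"
          using basis_list_gens[of "Suc n"] by (auto simp: L_def)
        show "(\<lambda>m. lact ?M (P m (snd i)) (fst i)) \<in> ahom ?M ?M"
          using ahom_comp[OF P(1)[OF AA.pg_closed[OF g(2)]] aux[OF g(1)]] by (simp add: i)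
      qed
      fix ys assume ys: "ys \<in> power_gens H (Suc (Suc n))"
      have "lsum ?M (\<lambda>(a, b). lact ?M (P (?gM ys) b) a) L =
          lsum ?M (\<lambda>(xs, as). ?gM (xs[0 := pairing ys as \<bullet> xs ! 0])) (basis_list (Suc n))"
        unfolding L_def lsum_map
      proof (rule lsum_cong)
        fix q assume "q \<in> set (basis_list (Suc n))"
        moreover obtain xs as where "q = (xs, as)" by (cases q)
        ultimately show "(\<lambda>(a, b). lact ?M (P (?gM ys) b) a) ((\<lambda>(xs, as). (?gM xs, ?gN as)) q) =
            (\<lambda>(xs, as). ?gM (xs[0 := pairing ys as \<bullet> xs ! 0])) q"
          using basis_list_gens[of "Suc n"] ys pairing_closed[OF ys, of as] by (auto simp: P(3) HH.lact_pg)
      qed simp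
      then show "lsum ?M (\<lambda>(a, b). lact ?M (P (?gM ys) b) a) L = ?gM ys"
        using basis_list_dual_left[OF MG HH.multiadd_pg ys] by simp
    qed
  next
    fix t assume t: "t \<in> carrier ?N"
    have aux: "(\<lambda>h. ract ?N (?gN as) (e h)) \<in> ahom H ?N" if as: "as \<in> power_gens A (Suc n)" for as
    proof -
      have a: "as ! n \<in> carrier TA" using power_gens_nth[OF as, of n] by (simp add: A_simps)
      have "(\<lambda>a. ?gN (as[n := a])) \<in> ahom TA ?N"
        using AA.multiadd_ahom[OF AA.multiadd_pg as lessI] by (simp add: ahom_A)
      from ahom_comp[OF mult_e_ahom[OF a] this] show ?thesis
        using as be by (simp add: ahom_def AA.ract_pg)
    qed
    show "lsum ?N (\<lambda>(a, b). ract ?N b (e (P a t))) L = t"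
    proof (rule AA.power_ext[OF NG _ ahom_id _ t])
      show "(\<lambda>t. lsum ?N (\<lambda>(a, b). ract ?N b (e (P a t))) L) \<in> ahom ?N ?N"
        unfolding split_def
      proof (rule ahom_lsum_fun[OF NG])
        fix i assume "i \<in> set L"
        then obtain xs as where i: "i = (?gM xs, ?gN as)" and g: "xs \<in> power_gens H (Suc (Suc n))" "as \<in> power_gens A (Suc n)"
          using basis_list_gens[of "Suc n"] by (auto simp: L_def)
        show "(\<lambda>t. ract ?N (snd i) (e (P (fst i) t))) \<in> ahom ?N ?N"
          using ahom_comp[OF P(2)[OF HH.pg_closed[OF g(1)]] aux[OF g(2)]] by (simp add: i)
      qed
      fix bs assume bs: "bs \<in> power_gens A (Suc n)"
      have "lsum ?N (\<lambda>(a, b). ract ?N b (e (P a (?gN bs)))) L =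
          lsum ?N (\<lambda>(xs, as). ?gN (as[n := as ! n \<star> e (pairing xs bs)])) (basis_list (Suc n))"
        unfolding L_def lsum_map
      proof (rule lsum_cong)
        fix q assume "q \<in> set (basis_list (Suc n))"
        moreover obtain xs as where "q = (xs, as)" by (cases q)
        ultimately show "(\<lambda>(a, b). ract ?N b (e (P a (?gN bs)))) ((\<lambda>(xs, as). (?gM xs, ?gN as)) q) =
            (\<lambda>(xs, as). ?gN (as[n := as ! n \<star> e (pairing xs bs)])) q"
          using basis_list_gens[of "Suc n"] bs pairing_closed[OF _ bs, of xs] be by (auto simp: P(3) AA.ract_pg)
      qed simp
      then show "lsum ?N (\<lambda>(a, b). ract ?N b (e (P a (?gN bs)))) L = ?gN bs"
        using basis_list_dual_right[OF NG AA.multiadd_pg bs] by simp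
    qed
  qed (use P G in auto)
  then show ?thesis by blast
qed

lemma regular_simps:
  "carrier (regular_bimodule A base) = base" "add (regular_bimodule A base) = add TA"
  "zero (regular_bimodule A base) = zero TA"
  "lact (regular_bimodule A base) = mult A" "ract (regular_bimodule A base) = mult A"
  by (simp_all add: regular_bimodule_def A_simps)

lemmas regular_image_simps = regular_simps[unfolded base_eq]

lemma bimod_regular: "rbimod base (regular_bimodule A base)"
proof -
  have e0: "e \<zero>\<^bsub>H\<^esub> = \<zero>\<^bsub>TA\<^esub>" by (rule ahom_zero[OF H_abelian TA_abelian e_ahom])
  have "abelian_group (regular_bimodule A base)"
  proof (rule abelian_groupI)
    fix x assume "x \<in> carrier (regular_bimodule A base)"
    then obtain h where h: "x = e h" "h \<in> carrier H" by (auto simp: regular_image_simps base_eq)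
    have "e (\<ominus>\<^bsub>H\<^esub> h) \<oplus>\<^bsub>TA\<^esub> e h = \<zero>\<^bsub>TA\<^esub>"
      using h e0 by (simp add: ahom_add[OF e_ahom, symmetric] l_neg)
    then show "\<exists>y\<in>carrier (regular_bimodule A base). y \<oplus>\<^bsub>regular_bimodule A base\<^esub> x = \<zero>\<^bsub>regular_bimodule A base\<^esub>"
      using h by (auto simp: regular_image_simps base_eq)
  qed (auto simp: regular_image_simps base_eq SM.T.a_ac ahom_add[OF e_ahom, symmetric] e0[symmetric] a_ac)
  then show ?thesis
    by (auto simp: bimod_def regular_image_simps base_eq e_mult_e r_distr l_distr ahom_add[OF e_ahom, symmetric] intro!: ahomI)
qed

text \<open>The zeroth tensor power of the smash product is \<open>H\<close> itself, embedded as \<open>base\<close>. Since \<open>\<Phi>\<^bsub>e(h)\<^esub>(1) = h\<close>,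
  applying \<open>\<Phi>\<close> to \<open>1\<close> inverts this embedding, and the pairing is the product of \<open>H\<close>.\<close>

lemma dual_pair_base:
  "\<exists>P L. H_dual (tensor_power H R (Suc 0)) (regular_bimodule A base) P L"
proof -
  let ?M = "tensor_power H R (Suc 0)" and ?N = "regular_bimodule A base" and ?gM = "HH.pg (Suc 0)"
  note G = H_abelian and MG = HH.abelian_power
  have "[] \<in> power_gens A 0" by (simp add: power_gens_def)
  from HH.multiadd_extend[OF G multiadd_pairing_left[OF this]] obtain p where
    p: "p \<in> ahom ?M H" "\<And>xs. xs \<in> power_gens H (Suc 0) \<Longrightarrow> p (?gM xs) = pairing xs []" by blast
  have sing: "[x] \<in> power_gens H (Suc 0)" if "x \<in> carrier H" for x using that by (simp add: power_gens_def)
  have p1: "p (?gM [x]) = x" if "x \<in> carrier H" for x using p(2)[OF sing[OF that]] by (simp add: pairing_def)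
  have singE: "\<exists>x\<in>carrier H. xs = [x]" if "xs \<in> power_gens H (Suc 0)" for xs
    using that by (auto simp: power_gens_def length_Suc_conv)
  have pc: "p m \<in> carrier H" if "m \<in> carrier ?M" for m using ahom_closed[OF p(1) that] .
  note la = HH.lact_ahom[OF _ zero_less_Suc] and ra = HH.ract_ahom[OF _ zero_less_Suc]
  have pl: "p (lact ?M c m) = c \<bullet> p m" if c: "c \<in> carrier H" and m: "m \<in> carrier ?M" for c m
    by (rule HH.power_ext[OF G ahom_comp[OF la[OF c] p(1)] ahom_comp[OF p(1) lmult_ahom[OF c]] _ m])
      (use c in \<open>auto dest!: singE simp: HH.lact_pg sing p1\<close>)
  have prr: "p (ract ?M m c) = p m \<bullet> c" if c: "c \<in> carrier H" and m: "m \<in> carrier ?M" for c m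
    by (rule HH.power_ext[OF G ahom_comp[OF ra[OF c] p(1)] ahom_comp[OF p(1) rmult_ahom[OF c]] _ m])
      (use c in \<open>auto dest!: singE simp: HH.ract_pg sing p1\<close>)
  define P where "P m t = p m \<bullet> Phi t \<one>\<^bsub>H\<^esub>" for m t
  have Pe: "P m (e h) = p m \<bullet> h" if "h \<in> carrier H" for m h
    using that by (simp add: P_def Phi_e)
  have "H_dual ?M ?N P [(?gM [\<one>\<^bsub>H\<^esub>], e \<one>\<^bsub>H\<^esub>)]"
  proof (rule dual_pair.intro)
    show "abelian_group H" by (rule G)
    show "rbimod (carrier H) ?M" by (rule bimod_power_H)
    show "bimod (carrier H) ?N (\<lambda>c. lact ?N (e c)) (\<lambda>c v. ract ?N v (e c))"
      using bimod_regular unfolding base_eq by (simp only: bimod_reindex)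
    show "set [(?gM [\<one>\<^bsub>H\<^esub>], e \<one>\<^bsub>H\<^esub>)] \<subseteq> carrier ?M \<times> carrier ?N"
      using HH.pg_closed[OF sing[OF one_closed]] by (auto simp: regular_image_simps base_eq)
  next
    fix t assume "t \<in> carrier ?N"
    then obtain h where h: "t = e h" "h \<in> carrier H" by (auto simp: regular_image_simps base_eq)
    show "(\<lambda>m. P m t) \<in> ahom ?M H"
      using ahom_comp[OF p(1) rmult_ahom[OF h(2)]] h by (simp add: Pe)
    show "lsum ?N (\<lambda>(a, b). ract ?N b (e (P a t))) [(?gM [\<one>\<^bsub>H\<^esub>], e \<one>\<^bsub>H\<^esub>)] = t"
      using h by (simp add: regular_simps Pe p1 e_mult_e)
  next
    fix m assume m: "m \<in> carrier ?M"
    show "P m \<in> ahom ?N H"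
      using pc[OF m] by (intro ahomI)
        (auto simp: regular_image_simps base_eq Pe ahom_add[OF e_ahom, symmetric] r_distr)
    have aux: "(\<lambda>h. lact ?M h (?gM [\<one>\<^bsub>H\<^esub>])) \<in> ahom H ?M"
      using ahom_comp[OF rmult_ahom[OF one_closed] HH.multiadd_ahom[OF HH.multiadd_pg sing[OF one_closed] zero_less_Suc]]
      by (simp add: ahom_def HH.lact_pg sing)
    have "lact ?M (p m) (?gM [\<one>\<^bsub>H\<^esub>]) = m"
      by (rule HH.power_ext[OF MG ahom_comp[OF p(1) aux] ahom_id _ m])
        (auto dest!: singE simp: HH.lact_pg sing p1)
    moreover have "lact ?M (p m) (?gM [\<one>\<^bsub>H\<^esub>]) \<in> carrier ?M" using m calculation by simp
    ultimately show "lsum ?M (\<lambda>(a, b). lact ?M (P m b) a) [(?gM [\<one>\<^bsub>H\<^esub>], e \<one>\<^bsub>H\<^esub>)] = m"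
      using pc[OF m] m abelian_group.axioms(1)[OF MG]
      by (simp add: Pe abelian_monoid.r_zero)
  next
    fix c m t assume c: "c \<in> carrier H" and m: "m \<in> carrier ?M" and "t \<in> carrier ?N"
    then obtain h where h: "t = e h" "h \<in> carrier H" by (auto simp: regular_image_simps base_eq)
    show "P (lact ?M c m) t = c \<bullet> P m t" using c m h pc[OF m] by (simp add: Pe pl m_assoc)
    show "P m (ract ?N t (e c)) = P m t \<bullet> c" using c m h pc[OF m] by (simp add: regular_simps e_mult_e Pe m_assoc)
    show "P (ract ?M m c) t = P m (lact ?N (e c) t)" using c m h pc[OF m] by (simp add: regular_simps e_mult_e Pe prr m_assoc)
  qed
  then show ?thesis by blast
qed

section \<open>Comparison of the depths\<close>

text \<open>The scalars on the side of the smash product are the elements of \<open>base\<close>, on the other side those of \<open>H\<close>; the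
  embedding \<open>e\<close> translates.\<close>

lemma divides_power_transfer:
  assumes d: "H_dual M N P L"
    and d': "H_dual M' N' P' L'"
    and N: "rbimod base N" and N': "rbimod base N'"
  shows "divides_power (carrier H) M M' \<longleftrightarrow> divides_power base N N'"
proof -
  have "divides_power (carrier H) M M' \<longleftrightarrow>
      rretracts (carrier H) M M'"
    by (rule divides_power_iff_retracts[OF dual_pair.M[OF d] dual_pair.M[OF d']])
  also have "\<dots> \<longleftrightarrow> retracts (carrier H) N (\<lambda>c. lact N (e c)) (\<lambda>c v. ract N v (e c))
      N' (\<lambda>c. lact N' (e c)) (\<lambda>c v. ract N' v (e c))"
    by (rule dual_pair_retracts_iff[OF d d'])
  also have "\<dots> \<longleftrightarrow> rretracts base N N'"
    unfolding base_eq retracts_reindex ..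
  also have "\<dots> \<longleftrightarrow> divides_power base N N'"
    by (rule divides_power_iff_retracts[OF N N', symmetric])
  finally show ?thesis .
qed

text \<open>Odd depth counts tensor powers from \<open>0\<close> and \<open>H\<close>-depth from \<open>1\<close>; at \<open>n = 0\<close> the first tensor power on the
  smash product side is \<open>base\<close>.\<close>

lemma depth_conditions: "odd_depth_cond base A n \<longleftrightarrow> H_depth_cond R H (Suc n)"
proof (cases n)
  case 0
  obtain P L P' L' where "H_dual (tensor_power H R (Suc 0)) (regular_bimodule A base) P L"
    "H_dual (tensor_power H R (Suc (Suc 0))) (tensor_power A base (Suc 0)) P' L'"
    using dual_pair_base dual_pair_powers[of 0] by blast
  from divides_power_transfer[OF this bimod_regular bimod_power_A]
    divides_power_transfer[OF this(2,1) bimod_power_A bimod_regular]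
  show ?thesis by (simp add: 0 odd_depth_cond_def H_depth_cond_def similar_def)
next
  case (Suc m)
  obtain P L P' L' where "H_dual (tensor_power H R (Suc (Suc m))) (tensor_power A base (Suc m)) P L"
    "H_dual (tensor_power H R (Suc (Suc (Suc m)))) (tensor_power A base (Suc (Suc m))) P' L'"
    using dual_pair_powers[of m] dual_pair_powers[of "Suc m"] by blast
  from divides_power_transfer[OF this bimod_power_A bimod_power_A]
    divides_power_transfer[OF this(2,1) bimod_power_A bimod_power_A]
  show ?thesis by (simp add: Suc odd_depth_cond_def H_depth_cond_def similar_def)
qed

lemma odd_depth_eq_H_depth: "odd_depth base A = H_depth R H"
proof (cases "\<exists>n. odd_depth_cond base A n")
  case True
  then have H: "\<exists>n. H_depth_cond R H n" by (auto simp: depth_conditions)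
  then obtain k where "H_depth_cond R H k" by blast
  moreover have "\<not> H_depth_cond R H 0" by (simp add: H_depth_cond_def)
  ultimately have "(LEAST n. H_depth_cond R H n) = Suc (LEAST n. H_depth_cond R H (Suc n))"
    by (rule Least_Suc)
  moreover have "odd_depth_cond base A = (\<lambda>n. H_depth_cond R H (Suc n))"
    by (rule ext) (rule depth_conditions)
  ultimately show ?thesis using True H by (simp add: odd_depth_def H_depth_def)
next
  case False
  have "\<not> H_depth_cond R H k" for k
    using False by (cases k) (auto simp: depth_conditions H_depth_cond_def[of R H 0])
  then show ?thesis using False by (simp add: odd_depth_def H_depth_def)
qed

end

theorem theorem3p11:
  fixes K :: "('k, 'z) ring_scheme" and H :: "('k, 'h, 'x) hopf_scheme" and R :: "'h set"
  assumes "field K"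
    and "\<And>n :: nat. n > 0 \<Longrightarrow> [n] \<cdot>\<^bsub>K\<^esub> \<one>\<^bsub>K\<^esub> \<noteq> \<zero>\<^bsub>K\<^esub>"
    and "hopf_algebra K H"
    and "vectorspace.fin_dim K H"
    and "hopf_subalgebra K R H"
  shows "odd_depth (smash_base K H R) (smash K H R) = H_depth R H"
proof -
  interpret hopf_extension K H R
    by (intro hopf_extension.intro hopf_extension_axioms.intro assms)
  show ?thesis by (rule odd_depth_eq_H_depth)
qed

end
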